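(* Let $n$ be a positive integer, $Y$ a Banach space such that $Y'$ is separable, $k$ a nonnegative integer, $\nu$ a real valued seminorm on $\mathscr D_{\mathbf B(0,1)}(\mathbf R^n,Y)$, $T\in\mathscr D'(\mathbf R^n,Y)$, and let $A$ be the set of $a\in\mathbf R^n$ such that $T$ is $\nu$ pointwise differentiable of order $k$ at $a$. Then for every $0<\epsilon<+\infty$ there exists a function $g:\mathbf R^n\to Y'$ of class $k$ such that $$\mathscr L^n\bigl(A\setminus\{a:\mathrm{pt}\,D^mT(a)=D^mg(a)\text{ for }m=0,\dots,k\}\bigr)<\epsilon.$$
   Context: All vector spaces are real. $Y'$ is the topological dual of $Y$. $\mathscr D(\mathbf R^n,Y)$ is the space of smooth compactly supported functions $\mathbf R^n\to Y$; $\mathscr D_K(\mathbf R^n,Y)$ the subspace of those with support in the compact set $K$, topologized by the seminorms $\sup_{x\in K}\|D^j\theta(x)\|$. $\mathscr D'(\mathbf R^n,Y)$ is the space of distributions: linear $T:\mathscr D(\mathbf R^n,Y)\to\mathbf R$ continuous on each $\mathscr D_K(\mathbf R^n,Y)$. $\mathbf B(a,r)$ is the closed ball; $\mathscr L^n$ is Lebesgue (outer) measure on $\mathbf R^n$. "Class $k$" means $k$ times continuously differentiable. A polynomial function $P:\mathbf R^n\to Y'$ is a finite sum of maps $x\mapsto\psi_m(x,\dots,x)$ with $\psi_m$ symmetric $m$-linear with values in $Y'$; it is identified with the distribution $P(\theta)=\int\langle\theta(x),P(x)\rangle\,d\mathscr L^n_x$. For a distribution $T$, $a\in\mathbf R^n$,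 $0<r<\infty$: $T^{a,r}(\theta)=r^{-n}T_x(\theta(r^{-1}(x-a)))$. $T$ is $\nu$ pointwise differentiable of order $k$ at $a$ iff there is a polynomial function $P:\mathbf R^n\to Y'$ of degree at most $k$ with $$\lim_{r\to0^+}\sup\{r^{-k}(T-P)^{a,r}(\theta):\theta\in\mathscr D_{\mathbf B(0,1)}(\mathbf R^n,Y),\ \nu(\theta)\le1\}=0.$$ In this case $T$ is also pointwise differentiable of order $k$ at $a$, meaning that $\lim_{r\to0^+}r^{-k}(T-P)^{a,r}(\theta)=0$ for every $\theta\in\mathscr D_{\mathbf B(0,1)}(\mathbf R^n,Y)$; the polynomial function $P$ of degree at most $k$ with this property is unique, and $\mathrm{pt}\,D^mT(a)=D^mP(a)$ for $0\le m\le k$. *)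

theory Defs
  imports "HOL-Analysis.Analysis"
begin

section \<open>Iterated derivatives, functions of class \<open>k\<close>\<close>

text \<open>
  An \<open>m\<close>-linear map on \<open>'a\<close> is encoded as a function on the lists over \<open>'a\<close> of length \<open>m\<close>; it is
  \<open>undefined\<close> on all other lists, so that \<open>=\<close> is equality of \<open>m\<close>-linear maps.
\<close>

primrec iter_deriv ::
    "('a::real_normed_vector \<Rightarrow> 'b::real_normed_vector) \<Rightarrow> 'a list \<Rightarrow> 'a \<Rightarrow> 'b" where
  "iter_deriv f [] = f"
| "iter_deriv f (v # vs) = (\<lambda>x. frechet_derivative (iter_deriv f vs) (at x) v)"

definition nth_deriv ::
    "nat \<Rightarrow> ('a::real_normed_vector \<Rightarrow> 'b::real_normed_vector) \<Rightarrow> 'a \<Rightarrow> 'a list \<Rightarrow> 'b" where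
  "nth_deriv m f x = (\<lambda>vs \<in> {vs. length vs = m}. iter_deriv f vs x)"

definition multilinear_norm :: "nat \<Rightarrow> ('a::real_normed_vector list \<Rightarrow> 'b::real_normed_vector) \<Rightarrow> real"
  where "multilinear_norm m \<phi> =
    (SUP vs \<in> {vs. length vs = m \<and> (\<forall>v\<in>set vs. norm v \<le> 1)}. norm (\<phi> vs))"

text \<open>
  The derivatives are evaluated at fixed directions. As the domain is finite-dimensional, this is
  the same as differentiability and continuity of \<open>x \<mapsto> D\<^sup>m f(x)\<close> as a map into the
  normed space of \<open>m\<close>-linear maps.
\<close>

definition of_class :: "nat \<Rightarrow> ('a::euclidean_space \<Rightarrow> 'b::real_normed_vector) \<Rightarrow> bool" where
  "of_class k f \<longleftrightarrow>
    (\<forall>vs x. length vs < k \<longrightarrow> iter_deriv f vs differentiable (at x)) \<and>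
    (\<forall>vs. length vs \<le> k \<longrightarrow> continuous_on UNIV (iter_deriv f vs))"

definition smooth :: "('a::euclidean_space \<Rightarrow> 'b::real_normed_vector) \<Rightarrow> bool" where
  "smooth f \<longleftrightarrow> (\<forall>k. of_class k f)"


section \<open>Test functions and distributions\<close>

definition supp :: "('a::topological_space \<Rightarrow> 'b::zero) \<Rightarrow> 'a set" where
  "supp f = closure {x. f x \<noteq> 0}"

definition test_functions :: "('a::euclidean_space \<Rightarrow> 'b::real_normed_vector) set" where
  "test_functions = {\<theta>. smooth \<theta> \<and> compact (supp \<theta>)}"

definition test_functions_in :: "'a set \<Rightarrow> ('a::euclidean_space \<Rightarrow> 'b::real_normed_vector) set" where
  "test_functions_in K = {\<theta> \<in> test_functions. supp \<theta> \<subseteq> K}"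

definition deriv_sup :: "'a set \<Rightarrow> nat \<Rightarrow> ('a::euclidean_space \<Rightarrow> 'b::real_normed_vector) \<Rightarrow> real" where
  "deriv_sup K j \<theta> = (SUP x\<in>K. multilinear_norm j (nth_deriv j \<theta> x))"

text \<open>
  The topology of \<open>test_functions_in K\<close> defined by the seminorms \<open>deriv_sup K j\<close>. For \<open>K = {}\<close> the
  supremum is an unspecified real number, but then the space is \<open>{0}\<close> and carries its only topology.
\<close>

definition test_topology ::
    "'a set \<Rightarrow> ('a::euclidean_space \<Rightarrow> 'b::real_normed_vector) topology" where
  "test_topology K = topology_generated_by
    {{\<theta> \<in> test_functions_in K. deriv_sup K j (\<lambda>x. \<theta> x - \<phi> x) < e} | j \<phi> e.
       \<phi> \<in> test_functions_in K \<and> 0 < e}"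

text \<open>The values of a distribution outside of \<open>test_functions\<close> are irrelevant.\<close>

definition distribution :: "(('a::euclidean_space \<Rightarrow> 'b::real_normed_vector) \<Rightarrow> real) \<Rightarrow> bool" where
  "distribution T \<longleftrightarrow>
    (\<forall>\<theta>\<in>test_functions. \<forall>\<phi>\<in>test_functions. T (\<lambda>x. \<theta> x + \<phi> x) = T \<theta> + T \<phi>) \<and>
    (\<forall>c. \<forall>\<theta>\<in>test_functions. T (\<lambda>x. c *\<^sub>R \<theta> x) = c * T \<theta>) \<and>
    (\<forall>K. compact K \<longrightarrow> continuous_map (test_topology K) euclideanreal T)"

definition seminorm_on_test ::
    "'a set \<Rightarrow> (('a::euclidean_space \<Rightarrow> 'b::real_normed_vector) \<Rightarrow> real) \<Rightarrow> bool" where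
  "seminorm_on_test K \<nu> \<longleftrightarrow>
    (\<forall>\<theta>\<in>test_functions_in K. 0 \<le> \<nu> \<theta>) \<and>
    (\<forall>\<theta>\<in>test_functions_in K. \<forall>\<phi>\<in>test_functions_in K. \<nu> (\<lambda>x. \<theta> x + \<phi> x) \<le> \<nu> \<theta> + \<nu> \<phi>) \<and>
    (\<forall>c. \<forall>\<theta>\<in>test_functions_in K. \<nu> (\<lambda>x. c *\<^sub>R \<theta> x) = \<bar>c\<bar> * \<nu> \<theta>)"

definition rescale ::
    "(('a::euclidean_space \<Rightarrow> 'b) \<Rightarrow> real) \<Rightarrow> 'a \<Rightarrow> real \<Rightarrow> ('a \<Rightarrow> 'b) \<Rightarrow> real" where
  "rescale T a r \<theta> = inverse (r ^ DIM('a)) * T (\<lambda>x. \<theta> (inverse r *\<^sub>R (x - a)))"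


section \<open>Polynomial functions\<close>

definition symmetric_multilinear ::
    "nat \<Rightarrow> ('a::real_vector list \<Rightarrow> 'b::real_vector) \<Rightarrow> bool" where
  "symmetric_multilinear m \<psi> \<longleftrightarrow>
    (\<forall>us ws. length us + 1 + length ws = m \<longrightarrow> linear (\<lambda>v. \<psi> (us @ v # ws))) \<and>
    (\<forall>vs ws. length vs = m \<and> mset vs = mset ws \<longrightarrow> \<psi> vs = \<psi> ws)"

definition polynomial_of_degree_le ::
    "nat \<Rightarrow> ('a::real_vector \<Rightarrow> 'b::real_vector) \<Rightarrow> bool" where
  "polynomial_of_degree_le k P \<longleftrightarrow>
    (\<exists>\<psi>. (\<forall>m\<le>k. symmetric_multilinear m (\<psi> m)) \<and> P = (\<lambda>x. \<Sum>m\<le>k. \<psi> m (replicate m x)))"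

definition function_distribution ::
    "('a::euclidean_space \<Rightarrow> 'b::real_normed_vector \<Rightarrow>\<^sub>L real) \<Rightarrow> ('a \<Rightarrow> 'b) \<Rightarrow> real" where
  "function_distribution P \<theta> = (LINT x|lborel. blinfun_apply (P x) (\<theta> x))"


section \<open>Pointwise differentiability\<close>

text \<open>The quantity \<open>r\<^sup>-\<^sup>k (T - P)\<^sup>a\<^sup>,\<^sup>r(\<theta>)\<close>.\<close>

definition scaled_error ::
    "(('a::euclidean_space \<Rightarrow> 'b::real_normed_vector) \<Rightarrow> real) \<Rightarrow> nat \<Rightarrow> 'a \<Rightarrow>
     ('a \<Rightarrow> 'b \<Rightarrow>\<^sub>L real) \<Rightarrow> real \<Rightarrow> ('a \<Rightarrow> 'b) \<Rightarrow> real" where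
  "scaled_error T k a P r \<theta> =
    inverse (r ^ k) * rescale (\<lambda>\<phi>. T \<phi> - function_distribution P \<phi>) a r \<theta>"

text \<open>The supremum may be infinite for some \<open>r\<close>, hence is taken in the extended reals.\<close>

definition nu_pt_differentiable ::
    "(('a::euclidean_space \<Rightarrow> 'b::real_normed_vector) \<Rightarrow> real) \<Rightarrow>
     (('a \<Rightarrow> 'b) \<Rightarrow> real) \<Rightarrow> nat \<Rightarrow> 'a \<Rightarrow> bool" where
  "nu_pt_differentiable \<nu> T k a \<longleftrightarrow>
    (\<exists>P. polynomial_of_degree_le k P \<and>
      ((\<lambda>r. SUP \<theta> \<in> {\<theta> \<in> test_functions_in (cball 0 1). \<nu> \<theta> \<le> 1}.
              ereal (scaled_error T k a P r \<theta>)) \<longlongrightarrow> 0) (at_right 0))"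

definition pt_approximation ::
    "(('a::euclidean_space \<Rightarrow> 'b::real_normed_vector) \<Rightarrow> real) \<Rightarrow> nat \<Rightarrow> 'a \<Rightarrow>
     ('a \<Rightarrow> 'b \<Rightarrow>\<^sub>L real) \<Rightarrow> bool" where
  "pt_approximation T k a P \<longleftrightarrow>
    polynomial_of_degree_le k P \<and>
    (\<forall>\<theta>\<in>test_functions_in (cball 0 1). ((\<lambda>r. scaled_error T k a P r \<theta>) \<longlongrightarrow> 0) (at_right 0))"

text \<open>
  \<open>pt_deriv k T m a\<close> is \<open>pt D\<^sup>m T(a)\<close> for \<open>m \<le> k\<close>, provided that \<open>T\<close> is pointwise differentiable of
  order \<open>k\<close> at \<open>a\<close>, in which case the approximating polynomial is unique.
\<close>

definition pt_deriv ::
    "nat \<Rightarrow> (('a::euclidean_space \<Rightarrow> 'b::real_normed_vector) \<Rightarrow> real) \<Rightarrow> nat \<Rightarrow> 'a \<Rightarrow>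
     'a list \<Rightarrow> 'b \<Rightarrow>\<^sub>L real" where
  "pt_deriv k T m a = nth_deriv m (THE P. pt_approximation T k a P) a"

end

theory Submission
  imports Defs
begin

text \<open>
  The function \<open>g\<close> is glued from mollifications of \<open>T\<close> itself, at scales that shrink near a large
  set on which the differentiability is uniform. Four ideas carry the proof.

  \<^item> \<^emph>\<open>The seminorm can be replaced by a norm of class \<open>i\<close>.\<close> For a point \<open>a\<close> with approximating
  polynomial \<open>P\<^sub>a\<close> and for small \<open>r\<close>, the functionals \<open>r\<^sup>-\<^sup>k (T - P\<^sub>a)\<^sup>a\<^sup>,\<^sup>r / e\<close> are continuous and
  bounded pointwise by \<open>\<nu>\<close>, whatever \<open>a\<close> is. The test functions on the unit ball form a
  Frechet space, so the uniform boundedness principle gives one bound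
  \<open>C \<cdot> (sup of the derivatives of order \<le> i)\<close> for all of these functionals
  (\<open>uniform_boundedness_test_functions\<close>, \<open>scaled_error_uniform_bound\<close>). In contrast to \<open>\<nu>\<close>, this bound
  is controlled on all translates and derivatives of a fixed test function.

  \<^item> \<^emph>\<open>Mollification reads off the jets.\<close> Let \<open>\<phi>\<close> be a kernel whose convolution reproduces the
  polynomials of degree at most \<open>k\<close>, and let \<open>u\<^sub>j\<close> be \<open>T\<close> mollified with \<open>\<phi>\<close> at scale \<open>2\<^sup>-\<^sup>j\<close>. Then
  \<open>u\<^sub>j - P\<^sub>a\<close> is the mollification of \<open>T - P\<^sub>a\<close>, and its derivatives of order \<open>m\<close> are
  \<open>o(2\<^sup>-\<^sup>j\<^sup>(\<^sup>k\<^sup>-\<^sup>m\<^sup>))\<close> on the ball of radius \<open>7 \<cdot> 2\<^sup>-\<^sup>j\<close> about \<open>a\<close> (\<open>mollification_rate\<close>). In particular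
  the jet of \<open>P\<^sub>a\<close> at \<open>a\<close> is the limit of the jets of \<open>u\<^sub>j\<close>, which also makes \<open>P\<^sub>a\<close> unique.

  \<^item> \<^emph>\<open>Egorov's argument is run with closed sets\<close>, as \<open>A\<close> may be non-measurable. The set where a
  given rate holds is replaced by its closure: the gluing only asks that points with this rate
  exist arbitrarily near the points of the good set (\<open>egorov_closed_sets\<close>).

  \<^item> \<^emph>\<open>A telescoping sum replaces Whitney's extension.\<close> Let \<open>\<eta>\<^sub>j\<close> be a cutoff at distance about
  \<open>2\<^sup>-\<^sup>j\<close> from the good set \<open>C\<close>. The partial sums of \<open>u\<^sub>0 + \<Sum>\<^sub>j \<eta>\<^sub>j (u\<^sub>j\<^sub>+\<^sub>1 - u\<^sub>j)\<close> are Cauchy in class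
  \<open>k\<close>, locally uniformly: near any point all but one of the cutoffs are locally constant, so a
  block of the sum is a difference \<open>u\<^sub>q - u\<^sub>J\<close>, taken where both scales see a common good point,
  plus one transitional term. At the points of \<open>C\<close> all cutoffs are \<open>1\<close>, and the sum has the jet
  \<open>lim u\<^sub>j\<close> (\<open>glue_approximations\<close>).
\<close>

section \<open>Calculus of iterated derivatives\<close>

(* Unfolding the recursion exposes nested derivatives of functions; iter_deriv_Cons_eq is the
   controlled way to compute the head. *)
declare iter_deriv.simps(2) [simp del]

lemma iter_deriv_Cons_eq:
  assumes "iter_deriv f vs = F" "\<And>x. (F has_derivative D x) (at x)"
  shows "iter_deriv f (v # vs) = (\<lambda>x. D x v)"
  unfolding iter_deriv.simps assms(1) using frechet_derivative_at[OF assms(2)] by metis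

lemma smooth_iff_differentiable: "smooth f \<longleftrightarrow> (\<forall>vs x. iter_deriv f vs differentiable (at x))"
proof
  assume "smooth f"
  then show "\<forall>vs x. iter_deriv f vs differentiable (at x)"
    unfolding smooth_def of_class_def by (metis lessI)
next
  assume "\<forall>vs x. iter_deriv f vs differentiable (at x)"
  then show "smooth f"
    unfolding smooth_def of_class_def
    by (auto intro!: differentiable_imp_continuous_on simp: differentiable_on_def
        intro: differentiable_at_withinI)
qed

lemma iter_deriv_append: "iter_deriv f (us @ vs) = iter_deriv (iter_deriv f vs) us"
  by (induction us) (auto simp: iter_deriv.simps(2))

lemma smooth_iter_deriv: "smooth f \<Longrightarrow> smooth (iter_deriv f vs)"
  by (metis smooth_iff_differentiable iter_deriv_append)

lemma smooth_differentiable: "smooth f \<Longrightarrow> f differentiable (at x)"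
  by (metis smooth_iff_differentiable iter_deriv.simps(1))

lemma smooth_continuous_on: "smooth f \<Longrightarrow> continuous_on S f"
  using smooth_differentiable
  by (metis differentiable_imp_continuous_on differentiable_on_def differentiable_at_withinI)

lemma smooth_has_derivative:
  assumes "smooth f"
  shows "(iter_deriv f vs has_derivative (\<lambda>v. iter_deriv f (v # vs) x)) (at x)"
  using assms frechet_derivative_works smooth_iff_differentiable by (fastforce simp: iter_deriv.simps(2))

text \<open>For functions whose derivatives are again of the same kind, smoothness needs no formula for
  the iterated derivatives.\<close>

lemma smooth_by_invariance:
  assumes "f \<in> F"
    and "\<And>f x. f \<in> F \<Longrightarrow> f differentiable (at x)"
    and "\<And>f v. f \<in> F \<Longrightarrow> (\<lambda>x. frechet_derivative f (at x) v) \<in> F"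
  shows "smooth f"
proof -
  have "iter_deriv f vs \<in> F" for vs
    by (induction vs) (use assms in \<open>auto simp: iter_deriv.simps(2)\<close>)
  then show ?thesis using assms(2) smooth_iff_differentiable by blast
qed

lemma iter_deriv_cong_open:
  assumes "open S" "\<And>x. x \<in> S \<Longrightarrow> f x = g x" "x \<in> S" "smooth f"
  shows "iter_deriv f vs x = iter_deriv g vs x"
  using \<open>x \<in> S\<close>
proof (induction vs arbitrary: x)
  case (Cons v vs)
  have "frechet_derivative (iter_deriv f vs) (at x) = frechet_derivative (iter_deriv g vs) (at x)"
    by (intro frechet_derivative_transform_within_open[OF _ \<open>open S\<close>])
      (use Cons assms in \<open>auto simp: smooth_iff_differentiable[THEN iffD1]\<close>)
  then show ?case by (simp add: iter_deriv.simps(2))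
qed (use assms in auto)

lemma iter_deriv_const: "iter_deriv (\<lambda>x. c) vs = (\<lambda>x. if vs = [] then c else 0)"
  by (induction vs) (auto simp: iter_deriv.simps(2) if_distrib cong: if_cong)

lemma smooth_const [simp, intro]: "smooth (\<lambda>x. c)"
  unfolding smooth_iff_differentiable iter_deriv_const by (auto intro: differentiable_const)

lemma
  assumes f: "smooth f" and g: "smooth g"
  shows iter_deriv_add: "iter_deriv (\<lambda>x. f x + g x) vs = (\<lambda>x. iter_deriv f vs x + iter_deriv g vs x)"
    and smooth_add: "smooth (\<lambda>x. f x + g x)"
proof -
  show *: "iter_deriv (\<lambda>x. f x + g x) vs = (\<lambda>x. iter_deriv f vs x + iter_deriv g vs x)" for vs
  proof (induction vs)
    case (Cons v vs)
    have "((\<lambda>x. iter_deriv f vs x + iter_deriv g vs x) has_derivative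
      (\<lambda>v. iter_deriv f (v # vs) x + iter_deriv g (v # vs) x)) (at x)" for x
      by (intro has_derivative_add smooth_has_derivative f g)
    from iter_deriv_Cons_eq[OF Cons this] show ?case .
  qed simp
  show "smooth (\<lambda>x. f x + g x)"
    unfolding smooth_iff_differentiable *
    using f g by (auto intro!: differentiable_add simp: smooth_iff_differentiable)
qed

lemma
  assumes L: "bounded_linear L" and f: "smooth f"
  shows iter_deriv_bounded_linear: "iter_deriv (\<lambda>x. L (f x)) vs = (\<lambda>x. L (iter_deriv f vs x))"
    and smooth_bounded_linear: "smooth (\<lambda>x. L (f x))"
proof -
  show *: "iter_deriv (\<lambda>x. L (f x)) vs = (\<lambda>x. L (iter_deriv f vs x))" for vs
  proof (induction vs)
    case (Cons v vs)
    have "((\<lambda>x. L (iter_deriv f vs x)) has_derivative (\<lambda>v. L (iter_deriv f (v # vs) x))) (at x)" for x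
      by (intro bounded_linear.has_derivative[OF L] smooth_has_derivative f)
    from iter_deriv_Cons_eq[OF Cons this] show ?case .
  qed simp
  show "smooth (\<lambda>x. L (f x))"
    unfolding smooth_iff_differentiable *
    using f bounded_linear_imp_differentiable[OF L]
    by (metis differentiable_def bounded_linear.has_derivative[OF L] smooth_iff_differentiable)
qed

lemmas iter_deriv_scaleR = iter_deriv_bounded_linear[OF bounded_linear_scaleR_right]
lemmas smooth_scaleR = smooth_bounded_linear[OF bounded_linear_scaleR_right]
lemmas iter_deriv_scaleR_left = iter_deriv_bounded_linear[OF bounded_linear_scaleR_left]
lemmas smooth_scaleR_left = smooth_bounded_linear[OF bounded_linear_scaleR_left]

lemma
  assumes f: "smooth f" and g: "smooth g"
  shows iter_deriv_diff: "iter_deriv (\<lambda>x. f x - g x) vs = (\<lambda>x. iter_deriv f vs x - iter_deriv g vs x)"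
    and smooth_diff: "smooth (\<lambda>x. f x - g x)"
  using iter_deriv_add[OF f smooth_scaleR[OF g, of "-1"]] smooth_add[OF f smooth_scaleR[OF g, of "-1"]]
  by (simp_all add: iter_deriv_bounded_linear[OF bounded_linear_minus[OF bounded_linear_ident] g])

lemma smooth_sum:
  assumes "\<And>i. i \<in> I \<Longrightarrow> smooth (f i)"
  shows "smooth (\<lambda>x. \<Sum>i\<in>I. f i x)"
  using assms by (induction I rule: infinite_finite_induct) (auto intro: smooth_add)

lemma
  assumes f: "smooth f"
  shows iter_deriv_affine:
      "iter_deriv (\<lambda>x. f (c *\<^sub>R x + b)) vs = (\<lambda>x. c ^ length vs *\<^sub>R iter_deriv f vs (c *\<^sub>R x + b))"
    and smooth_affine: "smooth (\<lambda>x. f (c *\<^sub>R x + b))"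
proof -
  have d: "((\<lambda>x. c ^ length vs *\<^sub>R iter_deriv f vs (c *\<^sub>R x + b)) has_derivative
      (\<lambda>v. c ^ Suc (length vs) *\<^sub>R iter_deriv f (v # vs) (c *\<^sub>R x + b))) (at x)" for vs x
  proof -
    have "((\<lambda>x. iter_deriv f vs (c *\<^sub>R x + b)) has_derivative
        (\<lambda>v. iter_deriv f (c *\<^sub>R v # vs) (c *\<^sub>R x + b))) (at x)"
      using smooth_has_derivative[OF f, of vs "c *\<^sub>R x + b"]
      by (rule has_derivative_compose[rotated]) (auto intro!: derivative_eq_intros)
    then have "((\<lambda>x. c ^ length vs *\<^sub>R iter_deriv f vs (c *\<^sub>R x + b)) has_derivative
        (\<lambda>v. c ^ length vs *\<^sub>R iter_deriv f (c *\<^sub>R v # vs) (c *\<^sub>R x + b))) (at x)"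
      by (rule has_derivative_scaleR_right)
    moreover have "iter_deriv f (c *\<^sub>R v # vs) y = c *\<^sub>R iter_deriv f (v # vs) y" for v y
      using linear_cmul[OF has_derivative_linear[OF smooth_has_derivative[OF f]]] by blast
    ultimately show ?thesis by (simp add: mult.commute)
  qed
  show *: "iter_deriv (\<lambda>x. f (c *\<^sub>R x + b)) vs = (\<lambda>x. c ^ length vs *\<^sub>R iter_deriv f vs (c *\<^sub>R x + b))" for vs
  proof (induction vs)
    case (Cons v vs)
    show ?case
      using iter_deriv_Cons_eq[OF Cons d] by simp
  qed simp
  show "smooth (\<lambda>x. f (c *\<^sub>R x + b))"
    unfolding smooth_iff_differentiable * using d unfolding differentiable_def by blast
qed

lemma iter_deriv_eq_0_outside:
  assumes f: "smooth f" and S: "closed S" "\<And>x. x \<notin> S \<Longrightarrow> f x = 0" and x: "x \<notin> S"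
  shows "iter_deriv f vs x = 0"
proof -
  have "iter_deriv f vs x = iter_deriv (\<lambda>_. 0) vs x"
    by (rule iter_deriv_cong_open[of "- S"]) (use assms in auto)
  then show ?thesis by (simp add: iter_deriv_const)
qed

lemma iter_deriv_direction_scaleR:
  assumes "smooth f"
  shows "iter_deriv f (map (\<lambda>v. c v *\<^sub>R d v) vs) x = prod_list (map c vs) *\<^sub>R iter_deriv f (map d vs) x"
proof (induction vs arbitrary: x)
  case (Cons v vs)
  let ?C = "prod_list (map c vs)" and ?vs = "map d vs"
  have "iter_deriv f (map (\<lambda>v. c v *\<^sub>R d v) vs) = (\<lambda>x. ?C *\<^sub>R iter_deriv f ?vs x)"
    using Cons by blast
  then have "iter_deriv f (map (\<lambda>v. c v *\<^sub>R d v) (v # vs)) x = ?C *\<^sub>R iter_deriv f ((c v *\<^sub>R d v) # ?vs) x"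
    using frechet_derivative_at[OF has_derivative_scaleR_right[OF smooth_has_derivative[OF assms, of ?vs x], of ?C]]
    by (simp add: iter_deriv.simps(2)) metis
  also have "iter_deriv f ((c v *\<^sub>R d v) # ?vs) x = c v *\<^sub>R iter_deriv f (d v # ?vs) x"
    using linear_cmul[OF has_derivative_linear[OF smooth_has_derivative[OF assms]]] by blast
  finally show ?case by (simp add: mult.commute)
qed simp

lemma iter_deriv_normalise:
  assumes "smooth f"
  shows "iter_deriv f vs x = prod_list (map norm vs) *\<^sub>R iter_deriv f (map (\<lambda>v. v /\<^sub>R norm v) vs) x"
proof -
  have "norm v *\<^sub>R (v /\<^sub>R norm v) = v" for v :: 'a by (cases "v = 0") auto
  then have "vs = map (\<lambda>v. norm v *\<^sub>R (v /\<^sub>R norm v)) vs" by simp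
  then show ?thesis using iter_deriv_direction_scaleR[OF assms] by metis
qed

lemma iter_deriv_norm_le:
  assumes "smooth f"
    and "\<And>us. length us = length vs \<Longrightarrow> \<forall>u\<in>set us. norm u \<le> 1 \<Longrightarrow> norm (iter_deriv f us x) \<le> M"
  shows "norm (iter_deriv f vs x) \<le> prod_list (map norm vs) * M"
proof -
  have p: "0 \<le> prod_list (map norm vs)" by (auto intro!: prod_list_nonneg)
  have "norm (iter_deriv f (map (\<lambda>v. v /\<^sub>R norm v) vs) x) \<le> M"
    by (rule assms) (auto simp: mult.commute[of "inverse _"] divide_inverse[symmetric])
  then show ?thesis
    unfolding iter_deriv_normalise[OF assms(1), of vs x] using p by (simp add: mult_left_mono)
qed

text \<open>The symmetry of mixed derivatives follows from this limit, as the difference quotient is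
  symmetric in \<open>v\<close> and \<open>w\<close>. Along \<open>t \<mapsto> x + t v\<close> the quotient is an increment of
  \<open>t \<mapsto> f (x + t v + s w) - f (x + t v)\<close>, whose derivative is \<open>s D\<^sub>w D\<^sub>v f(x) + o(s)\<close> by the
  differentiability of \<open>D\<^sub>v f\<close> at \<open>x\<close>.\<close>

lemma second_difference_limit:
  fixes f :: "'a::euclidean_space \<Rightarrow> 'b::real_normed_vector"
  assumes f: "smooth f"
  shows "((\<lambda>s. (f (x + s *\<^sub>R v + s *\<^sub>R w) - f (x + s *\<^sub>R v) - f (x + s *\<^sub>R w) + f x) /\<^sub>R s\<^sup>2)
    \<longlongrightarrow> iter_deriv f [w, v] x) (at_right 0)"
proof -
  let ?N = "norm v + norm w + 1"
  have N: "0 < ?N" by (simp add: add_nonneg_pos)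
  have "\<exists>d>0. \<forall>s. 0 < s \<and> s < d \<longrightarrow> norm ((f (x + s *\<^sub>R v + s *\<^sub>R w) - f (x + s *\<^sub>R v) - f (x + s *\<^sub>R w) + f x) /\<^sub>R s\<^sup>2
      - iter_deriv f [w, v] x) < e" if "0 < e" for e
  proof -
    let ?A = "\<lambda>h. iter_deriv f (h # [v]) x" and ?g = "iter_deriv f [v]"
    let ?e = "e / (3 * ?N)"
    have A: "linear ?A" using has_derivative_linear[OF smooth_has_derivative[OF f]] .
    have "\<exists>d>0. \<forall>y. norm (y - x) < d \<longrightarrow> norm (?g y - ?g x - ?A (y - x)) \<le> ?e * norm (y - x)"
      using smooth_has_derivative[OF f, of "[v]" x] N \<open>0 < e\<close> unfolding has_derivative_at_alt
      by (metis divide_pos_pos mult_pos_pos zero_less_numeral)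
    then obtain d where d: "d > 0"
      "\<And>y. norm (y - x) < d \<Longrightarrow> norm (?g y - ?g x - ?A (y - x)) \<le> ?e * norm (y - x)" by blast
    show ?thesis
    proof (intro exI[of _ "d / ?N"] conjI allI impI)
      fix s assume s: "0 < s \<and> s < d / ?N"
      then have sN: "s * ?N < d" using N by (simp add: pos_less_divide_eq)
      let ?G = "\<lambda>t. f (x + t *\<^sub>R v + s *\<^sub>R w) - f (x + t *\<^sub>R v) - t *\<^sub>R s *\<^sub>R ?A w"
      have fd: "((\<lambda>t. f (y + t *\<^sub>R v)) has_derivative (\<lambda>h. h *\<^sub>R ?g (y + t *\<^sub>R v))) (at t within {0..s})" for y t
      proof -
        have "((\<lambda>t. f (y + t *\<^sub>R v)) has_derivative (\<lambda>h. iter_deriv f [h *\<^sub>R v] (y + t *\<^sub>R v))) (at t within {0..s})"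
          using smooth_has_derivative[OF f, of "[]" "y + t *\<^sub>R v"]
          by (intro has_derivative_compose[of "\<lambda>t. y + t *\<^sub>R v" _ _ _ f]) (auto intro!: derivative_eq_intros)
        moreover have "iter_deriv f [h *\<^sub>R v] z = h *\<^sub>R ?g z" for h z
          using linear_cmul[OF has_derivative_linear[OF smooth_has_derivative[OF f]]] by blast
        ultimately show ?thesis by simp
      qed
      have "norm (?G s - ?G 0) \<le> ((2 * ?e * ?N) * s) * norm (s - 0)"
      proof (rule differentiable_bound[where S = "{0..s}"])
        fix t assume t: "t \<in> {0..s}"
        show "(?G has_derivative (\<lambda>h. h *\<^sub>R (?g (x + s *\<^sub>R w + t *\<^sub>R v) - ?g (x + t *\<^sub>R v) - s *\<^sub>R ?A w)))
            (at t within {0..s})"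
          using fd[of "x + s *\<^sub>R w" t] fd[of x t]
          by (auto intro!: derivative_eq_intros simp: algebra_simps)
        have b: "norm (a *\<^sub>R v + b *\<^sub>R w) \<le> s * ?N" if "0 \<le> a" "a \<le> s" "0 \<le> b" "b \<le> s" for a b
        proof -
          have "norm (a *\<^sub>R v + b *\<^sub>R w) \<le> a * norm v + b * norm w"
            using norm_triangle_ineq[of "a *\<^sub>R v" "b *\<^sub>R w"] that by simp
          also have "\<dots> \<le> s * norm v + s * norm w" using that by (intro add_mono mult_right_mono) auto
          also have "\<dots> \<le> s * ?N" using s by (simp add: algebra_simps)
          finally show ?thesis .
        qed
        have g: "norm (?g (x + (a *\<^sub>R v + b *\<^sub>R w)) - ?g x - ?A (a *\<^sub>R v + b *\<^sub>R w)) \<le> ?e * (s * ?N)"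
          if "0 \<le> a" "a \<le> s" "0 \<le> b" "b \<le> s" for a b
          using d(2)[of "x + (a *\<^sub>R v + b *\<^sub>R w)"] b[OF that] sN N \<open>0 < e\<close>
          by (smt (verit, best) add_diff_cancel_left' divide_nonneg_nonneg mult_left_mono mult_nonneg_nonneg)
        have "norm ((?g (x + (t *\<^sub>R v + s *\<^sub>R w)) - ?g x - ?A (t *\<^sub>R v + s *\<^sub>R w))
           - (?g (x + (t *\<^sub>R v + 0 *\<^sub>R w)) - ?g x - ?A (t *\<^sub>R v + 0 *\<^sub>R w))) \<le> ?e * (s * ?N) + ?e * (s * ?N)"
          by (rule order_trans[OF norm_triangle_ineq4 add_mono]) (rule g; use t s in simp)+
        moreover have "?A (t *\<^sub>R v + s *\<^sub>R w) = ?A (t *\<^sub>R v) + s *\<^sub>R ?A w"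
          using linear_add[OF A] linear_cmul[OF A] by metis
        ultimately have *: "norm (?g (x + s *\<^sub>R w + t *\<^sub>R v) - ?g (x + t *\<^sub>R v) - s *\<^sub>R ?A w) \<le> (2 * ?e * ?N) * s"
          by (simp add: algebra_simps)
        show "onorm (\<lambda>h. h *\<^sub>R (?g (x + s *\<^sub>R w + t *\<^sub>R v) - ?g (x + t *\<^sub>R v) - s *\<^sub>R ?A w)) \<le> (2 * ?e * ?N) * s"
        proof (rule onorm_bound)
          show "0 \<le> (2 * ?e * ?N) * s" using N \<open>0 < e\<close> s by simp
          show "norm (h *\<^sub>R (?g (x + s *\<^sub>R w + t *\<^sub>R v) - ?g (x + t *\<^sub>R v) - s *\<^sub>R ?A w))
              \<le> (2 * ?e * ?N) * s * norm h" for h :: real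
            using mult_right_mono[OF *, of "norm h"] by (simp only: norm_scaleR real_norm_def mult.commute abs_ge_zero)
        qed
      qed (use s in auto)
      also have "\<dots> = (2 / 3 * e) * s\<^sup>2"
      proof -
        have "?e * ?N = e / 3" using N by (simp add: field_simps)
        then have "(2 * ?e * ?N) * s * s = 2 * (e / 3) * s * s" by (metis mult.assoc)
        then show ?thesis using s by (simp add: power2_eq_square)
      qed
      finally have *: "norm (?G s - ?G 0) \<le> (2 / 3 * e) * s\<^sup>2" .
      have "(f (x + s *\<^sub>R v + s *\<^sub>R w) - f (x + s *\<^sub>R v) - f (x + s *\<^sub>R w) + f x) /\<^sub>R s\<^sup>2 - ?A w
         = (?G s - ?G 0) /\<^sub>R s\<^sup>2"
        using s by (simp add: algebra_simps power2_eq_square)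
      then have "norm ((f (x + s *\<^sub>R v + s *\<^sub>R w) - f (x + s *\<^sub>R v) - f (x + s *\<^sub>R w) + f x) /\<^sub>R s\<^sup>2 - ?A w)
         = norm (?G s - ?G 0) / s\<^sup>2" by (simp add: divide_inverse)
      also have "\<dots> \<le> 2 / 3 * e" using * s by (simp add: pos_divide_le_eq)
      also have "\<dots> < e" using \<open>0 < e\<close> by simp
      finally show "norm ((f (x + s *\<^sub>R v + s *\<^sub>R w) - f (x + s *\<^sub>R v) - f (x + s *\<^sub>R w) + f x) /\<^sub>R s\<^sup>2
        - iter_deriv f [w, v] x) < e" .
    qed (use d N in auto)
  qed
  then show ?thesis
    unfolding tendsto_iff dist_norm eventually_at_right_field
    by (meson)
qed

lemma iter_deriv_swap:
  assumes "smooth f"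
  shows "iter_deriv f (v # w # vs) = iter_deriv f (w # v # vs)"
proof -
  have "iter_deriv g [w, v] x = iter_deriv g [v, w] x" if "smooth g" for g :: "'a \<Rightarrow> 'b" and x
    using tendsto_unique[OF _ second_difference_limit[OF that, of x v w] ]
      second_difference_limit[OF that, of x w v]
    by (simp add: algebra_simps)
  from this[OF smooth_iter_deriv[OF assms]] show ?thesis
    using iter_deriv_append[of f "[_, _]" vs] by (metis append_Cons append_Nil ext)
qed

text \<open>The head of the list is the derivative taken last. Moving it to the end exchanges
  \<open>D\<^sub>v (D\<^sup>v\<^sup>s f)\<close> and \<open>D\<^sup>v\<^sup>s (D\<^sub>v f)\<close>, which lets inductions run on either end of the list.\<close>

lemma iter_deriv_rotate:
  assumes "smooth f"
  shows "iter_deriv f (v # vs) = iter_deriv f (vs @ [v])"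
proof (induction vs)
  case (Cons w vs)
  have "iter_deriv f (v # w # vs) = iter_deriv f (w # v # vs)" by (rule iter_deriv_swap) fact
  also have "\<dots> = iter_deriv f (w # vs @ [v])" using Cons by (simp add: iter_deriv.simps(2)[of _ w])
  finally show ?case by simp
qed simp

inductive_set finite_sums :: "('a \<Rightarrow> 'b::real_normed_vector) set \<Rightarrow> ('a \<Rightarrow> 'b) set" for F where
  base: "f \<in> F \<Longrightarrow> f \<in> finite_sums F"
| add: "f \<in> finite_sums F \<Longrightarrow> g \<in> finite_sums F \<Longrightarrow> (\<lambda>x. f x + g x) \<in> finite_sums F"

text \<open>By the product and chain rules, the derivatives of products or of the bump function leave
  the given form, but only to finite sums of it.\<close>

lemma smooth_by_finite_sums:
  assumes "f \<in> F"
    and F: "\<And>f v. f \<in> F \<Longrightarrow> \<exists>D. (\<forall>x. (f has_derivative D x) (at x)) \<and> (\<forall>v. (\<lambda>x. D x v) \<in> finite_sums F)"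
  shows "smooth f"
proof (rule smooth_by_invariance[of f "finite_sums F"])
  have *: "\<exists>D. (\<forall>x. (f has_derivative D x) (at x)) \<and> (\<forall>v. (\<lambda>x. D x v) \<in> finite_sums F)"
    if "f \<in> finite_sums F" for f
    using that
  proof induction
    case (add f g)
    then obtain D E where "\<forall>x. (f has_derivative D x) (at x)" "\<forall>v. (\<lambda>x. D x v) \<in> finite_sums F"
      "\<forall>x. (g has_derivative E x) (at x)" "\<forall>v. (\<lambda>x. E x v) \<in> finite_sums F" by blast
    then show ?case
      by (intro exI[of _ "\<lambda>x v. D x v + E x v"]) (auto intro: has_derivative_add finite_sums.add)
  qed (use F in blast)
  show "f differentiable (at x)" if "f \<in> finite_sums F" for f x
    using *[OF that] unfolding differentiable_def by blast
  show "(\<lambda>x. frechet_derivative f (at x) v) \<in> finite_sums F" if f: "f \<in> finite_sums F" for f v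
  proof -
    obtain D where D: "\<And>x. (f has_derivative D x) (at x)" "\<And>v. (\<lambda>x. D x v) \<in> finite_sums F"
      using *[OF f] by blast
    then show ?thesis using frechet_derivative_at[OF D(1)] by simp
  qed
qed (use assms in \<open>auto intro: base\<close>)

lemma has_derivative_product:
  assumes "smooth f" "smooth h"
  shows "((\<lambda>x. f x *\<^sub>R h x) has_derivative
    (\<lambda>v. iter_deriv f [v] x *\<^sub>R h x + f x *\<^sub>R iter_deriv h [v] x)) (at x)"
  using has_derivative_scaleR[OF smooth_has_derivative[OF assms(1), of "[]" x] smooth_has_derivative[OF assms(2), of "[]" x]]
  by (simp add: add.commute)

lemma smooth_product:
  assumes "smooth f" "smooth h"
  shows "smooth (\<lambda>x. f x *\<^sub>R h x)"
proof (rule smooth_by_finite_sums[of _ "{(\<lambda>x. f x *\<^sub>R h x) | f h. smooth f \<and> smooth h}"])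
  fix p :: "'a \<Rightarrow> 'b" assume "p \<in> {(\<lambda>x. f x *\<^sub>R h x) | f h. smooth f \<and> smooth h}"
  then obtain f h where p: "p = (\<lambda>x. f x *\<^sub>R h x)" and s: "smooth f" "smooth h" by blast
  show "\<exists>D. (\<forall>x. (p has_derivative D x) (at x)) \<and>
      (\<forall>v. (\<lambda>x. D x v) \<in> finite_sums {(\<lambda>x. f x *\<^sub>R h x) | f h. smooth f \<and> smooth h})"
    unfolding p
    by (intro exI[of _ "\<lambda>x v. iter_deriv f [v] x *\<^sub>R h x + f x *\<^sub>R iter_deriv h [v] x"] conjI allI
        has_derivative_product s finite_sums.add finite_sums.base)
      (use s in \<open>auto intro: smooth_iter_deriv\<close>)
qed (use assms in blast)

text \<open>A quantitative Leibniz rule in the scale-invariant form \<open>|D\<^sup>m f| \<le> K s\<^sup>m\<close>: differentiating one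
  factor costs one power of \<open>s\<close>, and each step doubles the number of terms. The induction peels
  off the derivative taken first.\<close>

lemma iter_deriv_product_bound:
  assumes "smooth f" "smooth h" "0 \<le> K" "0 \<le> M" "0 \<le> s"
    and "\<And>us. length us \<le> length vs \<Longrightarrow> \<forall>u\<in>set us. norm u \<le> 1 \<Longrightarrow> norm (iter_deriv f us x) \<le> K * s ^ length us"
    and "\<And>us. length us \<le> length vs \<Longrightarrow> \<forall>u\<in>set us. norm u \<le> 1 \<Longrightarrow> norm (iter_deriv h us x) \<le> M * s ^ length us"
    and "\<forall>v\<in>set vs. norm v \<le> 1"
  shows "norm (iter_deriv (\<lambda>x. f x *\<^sub>R h x) vs x) \<le> 2 ^ length vs * K * M * s ^ length vs"
  using assms
proof (induction vs arbitrary: f h K M rule: rev_induct)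
  case Nil
  from Nil(6)[of "[]"] Nil(7)[of "[]"] show ?case using Nil(3,4) by (simp add: mult_mono)
next
  case (snoc v vs)
  let ?f = "iter_deriv f [v]" and ?h = "iter_deriv h [v]"
  have "iter_deriv (\<lambda>x. f x *\<^sub>R h x) (vs @ [v]) = iter_deriv (\<lambda>x. ?f x *\<^sub>R h x + f x *\<^sub>R ?h x) vs"
    unfolding iter_deriv_append using iter_deriv_Cons_eq[OF _ has_derivative_product[OF snoc.prems(1,2)]] by simp
  also have "\<dots> = (\<lambda>x. iter_deriv (\<lambda>x. ?f x *\<^sub>R h x) vs x + iter_deriv (\<lambda>x. f x *\<^sub>R ?h x) vs x)"
    by (intro iter_deriv_add smooth_product smooth_iter_deriv snoc.prems)
  finally have eq: "iter_deriv (\<lambda>x. f x *\<^sub>R h x) (vs @ [v]) x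
    = iter_deriv (\<lambda>x. ?f x *\<^sub>R h x) vs x + iter_deriv (\<lambda>x. f x *\<^sub>R ?h x) vs x" by meson
  have "norm (iter_deriv (\<lambda>x. ?f x *\<^sub>R h x) vs x) \<le> 2 ^ length vs * (K * s) * M * s ^ length vs"
    using snoc.prems(6)[of "_ @ [v]"] snoc.prems(3,4,5,8)
    by (intro snoc.IH smooth_iter_deriv snoc.prems) (auto simp: iter_deriv_append mult.assoc)
  moreover have "norm (iter_deriv (\<lambda>x. f x *\<^sub>R ?h x) vs x) \<le> 2 ^ length vs * K * (M * s) * s ^ length vs"
    using snoc.prems(7)[of "_ @ [v]"] snoc.prems(3,4,5,8)
    by (intro snoc.IH smooth_iter_deriv snoc.prems) (auto simp: iter_deriv_append mult.assoc)
  ultimately show ?case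
    unfolding eq by (intro order_trans[OF norm_triangle_ineq]) (simp add: algebra_simps)
qed

lemma iter_deriv_basis_expansion:
  assumes "smooth f"
  shows "iter_deriv f (h # vs) x = (\<Sum>b\<in>Basis. (h \<bullet> b) *\<^sub>R iter_deriv f (b # vs) x)"
proof -
  have l: "linear (\<lambda>v. iter_deriv f (v # vs) x)"
    by (rule has_derivative_linear[OF smooth_has_derivative[OF assms]])
  have "iter_deriv f (h # vs) x = iter_deriv f ((\<Sum>b\<in>Basis. (h \<bullet> b) *\<^sub>R b) # vs) x"
    by (simp add: euclidean_representation)
  also have "\<dots> = (\<Sum>b\<in>Basis. (h \<bullet> b) *\<^sub>R iter_deriv f (b # vs) x)"
    using linear_sum[OF l, of "\<lambda>b. (h \<bullet> b) *\<^sub>R b" Basis] linear_cmul[OF l] by simp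
  finally show ?thesis .
qed

text \<open>There are infinitely many unit directions, but expansion in the basis reduces the claim to
  finitely many continuous functions.\<close>

lemma iter_deriv_bounded_on_compact:
  assumes "smooth f" "compact K"
  shows "\<exists>M\<ge>0. \<forall>x\<in>K. \<forall>vs. length vs \<le> n \<longrightarrow> (\<forall>v\<in>set vs. norm v \<le> 1) \<longrightarrow> norm (iter_deriv f vs x) \<le> M"
  using assms(1)
proof (induction n arbitrary: f)
  case 0
  have "bounded (f ` K)"
    by (intro compact_imp_bounded compact_continuous_image smooth_continuous_on 0 assms)
  then obtain M where "0 < M" "\<And>x. x \<in> K \<Longrightarrow> norm (f x) \<le> M" by (auto simp: bounded_pos)
  then show ?case by (intro exI[of _ M]) auto
next
  case (Suc n)
  have "\<forall>b. \<exists>M\<ge>0. \<forall>x\<in>K. \<forall>vs. length vs \<le> n \<longrightarrow> (\<forall>v\<in>set vs. norm v \<le> 1) \<longrightarrow> norm (iter_deriv (iter_deriv f [b]) vs x) \<le> M"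
    using Suc smooth_iter_deriv by blast
  then obtain M where M: "\<And>b. 0 \<le> M b"
    "\<And>b x vs. x \<in> K \<Longrightarrow> length vs \<le> n \<Longrightarrow> \<forall>v\<in>set vs. norm v \<le> 1 \<Longrightarrow> norm (iter_deriv (iter_deriv f [b]) vs x) \<le> M b"
    by metis
  have "bounded (f ` K)"
    by (intro compact_imp_bounded compact_continuous_image smooth_continuous_on Suc assms)
  then obtain M0 where M0: "0 < M0" "\<And>x. x \<in> K \<Longrightarrow> norm (f x) \<le> M0" by (auto simp: bounded_pos)
  let ?M = "M0 + (\<Sum>b\<in>Basis. M b)"
  have s: "0 \<le> (\<Sum>b\<in>Basis. M b)" by (intro sum_nonneg M)
  show ?case
  proof (intro exI[of _ ?M] conjI ballI allI impI)
    fix x and vs :: "'a list" assume x: "x \<in> K" and vs: "length vs \<le> Suc n" "\<forall>v\<in>set vs. norm v \<le> (1::real)"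
    show "norm (iter_deriv f vs x) \<le> ?M"
    proof (cases vs)
      case Nil
      then show ?thesis using M0(2)[OF x] s by simp
    next
      case (Cons v us)
      have b: "iter_deriv f (b # us) x = iter_deriv (iter_deriv f [b]) us x" for b
        using iter_deriv_rotate[OF Suc.prems] by (metis iter_deriv_append)
      have "norm (iter_deriv f vs x) \<le> (\<Sum>b\<in>Basis. norm ((v \<bullet> b) *\<^sub>R iter_deriv f (b # us) x))"
        unfolding Cons iter_deriv_basis_expansion[OF Suc.prems, where h=v and vs=us and x=x] by (rule norm_sum)
      also have "\<dots> \<le> (\<Sum>b\<in>Basis. 1 * M b)"
        unfolding norm_scaleR
      proof (intro sum_mono mult_mono)
        fix b :: 'a assume "b \<in> Basis"
        then show "\<bar>v \<bullet> b\<bar> \<le> 1" using vs Cons Basis_le_norm[of b v] by fastforce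
        show "norm (iter_deriv f (b # us) x) \<le> M b" unfolding b using x vs Cons by (intro M) auto
      qed auto
      also have "\<dots> \<le> ?M" using M0 by simp
      finally show ?thesis .
    qed
  qed (use s M0 in auto)
qed

text \<open>Completeness of the functions of class \<open>k\<close> under locally uniform convergence of all
  derivatives of order at most \<open>k\<close>. It is used twice: for the completeness of the space of test
  functions and for the construction of \<open>g\<close>.\<close>

lemma
  fixes f :: "nat \<Rightarrow> 'a::euclidean_space \<Rightarrow> 'b::banach"
  assumes smooth: "\<And>n. smooth (f n)"
    and Cauchy: "\<And>vs R e. length vs \<le> k \<Longrightarrow> 0 < e \<Longrightarrow>
      \<exists>N. \<forall>m\<ge>N. \<forall>n\<ge>N. \<forall>x\<in>ball 0 R. norm (iter_deriv (f m) vs x - iter_deriv (f n) vs x) \<le> e"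
  shows of_class_limit: "of_class k (\<lambda>x. lim (\<lambda>n. f n x))"
    and iter_deriv_limit: "length vs \<le> k \<Longrightarrow>
      (\<lambda>n. iter_deriv (f n) vs x) \<longlonglongrightarrow> iter_deriv (\<lambda>x. lim (\<lambda>n. f n x)) vs x"
proof -
  define G where "G vs x = lim (\<lambda>n. iter_deriv (f n) vs x)" for vs x
  have lim: "(\<lambda>n. iter_deriv (f n) vs x) \<longlonglongrightarrow> G vs x" if vs: "length vs \<le> k" for vs x
  proof -
    have "Cauchy (\<lambda>n. iter_deriv (f n) vs x)"
    proof (rule metric_CauchyI)
      fix e :: real assume "0 < e"
      then obtain N where "\<forall>m\<ge>N. \<forall>n\<ge>N. \<forall>y\<in>ball 0 (norm x + 1). norm (iter_deriv (f m) vs y - iter_deriv (f n) vs y) \<le> e / 2"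
        using Cauchy[OF vs, of "e/2"] by (metis half_gt_zero)
      then show "\<exists>N. \<forall>m\<ge>N. \<forall>n\<ge>N. dist (iter_deriv (f m) vs x) (iter_deriv (f n) vs x) < e"
      proof (intro exI[of _ N] allI impI)
        fix m n assume "N \<le> m" "N \<le> n"
        moreover have "x \<in> ball 0 (norm x + 1)" by simp
        ultimately have "norm (iter_deriv (f m) vs x - iter_deriv (f n) vs x) \<le> e / 2"
          using \<open>\<forall>m\<ge>N. _\<close> by blast
        then show "dist (iter_deriv (f m) vs x) (iter_deriv (f n) vs x) < e"
          using \<open>0 < e\<close> by (simp add: dist_norm)
      qed
    qed
    then show ?thesis unfolding G_def by (simp add: Cauchy_convergent_iff convergent_LIMSEQ_iff)
  qed
  have unif: "\<exists>N. \<forall>n\<ge>N. \<forall>x\<in>ball 0 R. norm (iter_deriv (f n) vs x - G vs x) \<le> e"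
    if vs: "length vs \<le> k" and "0 < e" for vs R e
  proof -
    obtain N where N: "\<And>m n x. N \<le> m \<Longrightarrow> N \<le> n \<Longrightarrow> x\<in>ball 0 R \<Longrightarrow> norm (iter_deriv (f m) vs x - iter_deriv (f n) vs x) \<le> e"
      using Cauchy[OF vs \<open>0 < e\<close>] by blast
    have "norm (iter_deriv (f n) vs x - G vs x) \<le> e" if "N \<le> n" "x \<in> ball 0 R" for n x
    proof (rule Lim_norm_ubound[OF _ tendsto_diff[OF tendsto_const lim[OF vs]]])
      show "\<forall>\<^sub>F m in sequentially. norm (iter_deriv (f n) vs x - iter_deriv (f m) vs x) \<le> e"
        using N[OF that(1) _ that(2)] unfolding eventually_sequentially by blast
    qed simp
    then show ?thesis by blast
  qed
  have exp: "G (h # vs) x = (\<Sum>b\<in>Basis. (h \<bullet> b) *\<^sub>R G (b # vs) x)" if "length vs < k" for h vs x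
  proof (rule LIMSEQ_unique[OF lim])
    show "(\<lambda>n. iter_deriv (f n) (h # vs) x) \<longlonglongrightarrow> (\<Sum>b\<in>Basis. (h \<bullet> b) *\<^sub>R G (b # vs) x)"
      unfolding iter_deriv_basis_expansion[OF smooth, where h=h and vs=vs and x=x] using that
      by (intro tendsto_intros lim) auto
  qed (use that in auto)
  have deriv: "(G vs has_derivative (\<lambda>h. G (h # vs) x)) (at x)" if vs: "length vs < k" for vs x
  proof -
    let ?S = "ball (0::'a) (norm x + 1)"
    have "\<exists>g. \<forall>x\<in>?S. (\<lambda>n. iter_deriv (f n) vs x) \<longlonglongrightarrow> g x \<and> (g has_derivative (\<lambda>h. G (h # vs) x)) (at x within ?S)"
    proof (rule has_derivative_sequence[where ?x0.0=x and l="G vs x"])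
      show "(iter_deriv (f n) vs has_derivative (\<lambda>h. iter_deriv (f n) (h # vs) y)) (at y within ?S)" for n y
        by (rule has_derivative_at_withinI[OF smooth_has_derivative[OF smooth]])
      fix e :: real assume "0 < e"
      let ?d = "e / DIM('a)"
      have "0 < ?d" using \<open>0 < e\<close> by simp
      then have "\<forall>b. \<exists>N. \<forall>n\<ge>N. \<forall>y\<in>?S. norm (iter_deriv (f n) (b # vs) y - G (b # vs) y) \<le> ?d"
        using unif[of "_ # vs" ?d "norm x + 1"] vs by simp
      then obtain N where N: "\<And>b n y. N b \<le> n \<Longrightarrow> y \<in> ?S \<Longrightarrow> norm (iter_deriv (f n) (b # vs) y - G (b # vs) y) \<le> ?d"
        by metis
      have "norm (iter_deriv (f n) (h # vs) y - G (h # vs) y) \<le> e * norm h"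
        if n: "Max (N ` Basis) \<le> n" and y: "y \<in> ?S" for n y h
      proof -
        have "norm (iter_deriv (f n) (h # vs) y - G (h # vs) y)
          = norm (\<Sum>b\<in>Basis. (h \<bullet> b) *\<^sub>R (iter_deriv (f n) (b # vs) y - G (b # vs) y))"
          unfolding exp[OF vs, where h=h and x=y] iter_deriv_basis_expansion[OF smooth, where h=h and vs=vs and x=y]
          by (simp add: sum_subtractf scaleR_diff_right)
        also have "\<dots> \<le> (\<Sum>b\<in>(Basis::'a set). norm h * ?d)"
        proof (rule order_trans[OF norm_sum sum_mono])
          fix b :: 'a assume b: "b \<in> Basis"
          then have "N b \<le> n" using n by simp
          then show "norm ((h \<bullet> b) *\<^sub>R (iter_deriv (f n) (b # vs) y - G (b # vs) y)) \<le> norm h * ?d"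
            unfolding norm_scaleR using N[of b n y] y Basis_le_norm[OF b, of h]
            by (intro mult_mono) auto
        qed
        also have "\<dots> = e * norm h" by simp
        finally show ?thesis .
      qed
      then show "\<forall>\<^sub>F n in sequentially. \<forall>y\<in>?S. \<forall>h. norm (iter_deriv (f n) (h # vs) y - G (h # vs) y) \<le> e * norm h"
        unfolding eventually_sequentially by blast
    qed (use lim vs in \<open>auto simp: add_pos_nonneg\<close>)
    then obtain g where g: "\<And>y. y \<in> ?S \<Longrightarrow> (\<lambda>n. iter_deriv (f n) vs y) \<longlonglongrightarrow> g y"
      and g': "(g has_derivative (\<lambda>h. G (h # vs) x)) (at x within ?S)" by force
    have "g y = G vs y" if "y \<in> ?S" for y
      using LIMSEQ_unique[OF g[OF that] lim] vs by simp
    moreover have "(g has_derivative (\<lambda>h. G (h # vs) x)) (at x)"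
      using g' by (subst (asm) at_within_open) auto
    ultimately show ?thesis
      using has_derivative_transform_within_open[of g _ x UNIV ?S "G vs"] by simp
  qed
  have G: "iter_deriv (\<lambda>x. lim (\<lambda>n. f n x)) vs = G vs" if "length vs \<le> k" for vs
    using that
  proof (induction vs)
    case Nil
    then show ?case by (simp add: G_def)
  next
    case (Cons v vs)
    then have IH: "iter_deriv (\<lambda>x. lim (\<lambda>n. f n x)) vs = G vs" and l: "length vs < k" by auto
    from iter_deriv_Cons_eq[OF IH deriv[OF l]] show ?case by simp
  qed
  show "(\<lambda>n. iter_deriv (f n) vs x) \<longlonglongrightarrow> iter_deriv (\<lambda>x. lim (\<lambda>n. f n x)) vs x" if "length vs \<le> k"
    using lim[OF that] by (simp add: G[OF that])
  have "isCont (G vs) x" if vs: "length vs \<le> k" for vs x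
  proof -
    have "uniform_limit (ball 0 (norm x + 1)) (\<lambda>n. iter_deriv (f n) vs) (G vs) sequentially"
    proof (rule uniform_limitI)
      fix e :: real assume "0 < e"
      then obtain N where "\<And>n y. N \<le> n \<Longrightarrow> y \<in> ball 0 (norm x + 1) \<Longrightarrow> norm (iter_deriv (f n) vs y - G vs y) \<le> e / 2"
        using unif[OF vs half_gt_zero[OF \<open>0 < e\<close>], of "norm x + 1"] by blast
      then show "\<forall>\<^sub>F n in sequentially. \<forall>y\<in>ball 0 (norm x + 1). dist (iter_deriv (f n) vs y) (G vs y) < e"
        unfolding eventually_sequentially dist_norm using \<open>0 < e\<close>
        by (intro exI[of _ N]) fastforce
    qed
    then have "continuous_on (ball 0 (norm x + 1)) (G vs)"
      by (rule uniform_limit_theorem[rotated])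
        (auto intro!: always_eventually smooth_continuous_on smooth_iter_deriv smooth)
    then show ?thesis by (simp add: continuous_on_eq_continuous_at)
  qed
  then show "of_class k (\<lambda>x. lim (\<lambda>n. f n x))"
    unfolding of_class_def using G differentiableI[OF deriv]
    by (auto simp: continuous_on_eq_continuous_at)
qed

section \<open>Polynomial functions\<close>

text \<open>Polynomials of degree at most \<open>k\<close> are the smooth functions without derivatives of order above
  \<open>k\<close>. This form is stable under differentiation and avoids all bookkeeping of multilinear maps.\<close>

definition poly_fun :: "nat \<Rightarrow> ('a::euclidean_space \<Rightarrow> 'b::real_normed_vector) \<Rightarrow> bool" where
  "poly_fun k f \<longleftrightarrow> smooth f \<and> (\<forall>vs. k < length vs \<longrightarrow> iter_deriv f vs = (\<lambda>_. 0))"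

lemma poly_fun_smooth: "poly_fun k f \<Longrightarrow> smooth f"
  by (simp add: poly_fun_def)

lemma poly_fun_mono: "poly_fun j f \<Longrightarrow> j \<le> k \<Longrightarrow> poly_fun k f"
  by (simp add: poly_fun_def)

lemma poly_fun_const: "poly_fun k (\<lambda>_. c)"
  by (auto simp: poly_fun_def iter_deriv_const)

lemma poly_fun_add: "poly_fun k f \<Longrightarrow> poly_fun k g \<Longrightarrow> poly_fun k (\<lambda>x. f x + g x)"
  by (simp add: poly_fun_def smooth_add iter_deriv_add)

lemma poly_fun_diff: "poly_fun k f \<Longrightarrow> poly_fun k g \<Longrightarrow> poly_fun k (\<lambda>x. f x - g x)"
  by (simp add: poly_fun_def smooth_diff iter_deriv_diff)

lemma poly_fun_bounded_linear:
  assumes "bounded_linear L" "poly_fun k f"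
  shows "poly_fun k (\<lambda>x. L (f x))"
  using assms
  by (simp add: poly_fun_def smooth_bounded_linear iter_deriv_bounded_linear linear_0 bounded_linear.linear)

lemma poly_fun_affine: "poly_fun k f \<Longrightarrow> poly_fun k (\<lambda>x. f (c *\<^sub>R x + b))"
  by (simp add: poly_fun_def smooth_affine iter_deriv_affine)

lemma poly_fun_sum:
  "(\<And>i. i \<in> I \<Longrightarrow> poly_fun k (f i)) \<Longrightarrow> poly_fun k (\<lambda>x. \<Sum>i\<in>I. f i x)"
  by (induction I rule: infinite_finite_induct) (auto intro: poly_fun_add poly_fun_const)

lemma poly_fun_SucI:
  assumes d: "\<And>x. (f has_derivative D x) (at x)" and D: "\<And>v. poly_fun k (\<lambda>x. D x v)"
  shows "poly_fun (Suc k) f"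
proof -
  have eq: "iter_deriv f (vs @ [v]) = iter_deriv (\<lambda>x. D x v) vs" for vs v
    unfolding iter_deriv_append using iter_deriv_Cons_eq[OF iter_deriv.simps(1) d] by simp
  have "iter_deriv f vs differentiable (at x)" for vs x
  proof (cases vs rule: rev_exhaust)
    case Nil
    then show ?thesis using d by (auto simp: differentiable_def)
  next
    case (snoc us v)
    then show ?thesis using poly_fun_smooth[OF D] eq smooth_iff_differentiable by metis
  qed
  moreover have "iter_deriv f vs = (\<lambda>_. 0)" if "Suc k < length vs" for vs
    using that D eq by (cases vs rule: rev_exhaust) (auto simp: poly_fun_def)
  ultimately show ?thesis by (simp add: poly_fun_def smooth_iff_differentiable)
qed

lemma poly_fun_iter_deriv: "poly_fun (Suc k) f \<Longrightarrow> poly_fun k (iter_deriv f [v])"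
  by (auto simp: poly_fun_def smooth_iter_deriv iter_deriv_append[symmetric])

lemma poly_fun_inner_scaleR:
  assumes "poly_fun k f"
  shows "poly_fun (Suc k) (\<lambda>x. (x \<bullet> b) *\<^sub>R f x)"
  using assms
proof (induction k arbitrary: f)
  case 0
  have "((\<lambda>x. (x \<bullet> b) *\<^sub>R f x) has_derivative (\<lambda>v. (v \<bullet> b) *\<^sub>R f x)) (at x)" for x
  proof -
    have "iter_deriv f [v] = (\<lambda>_. 0)" for v using 0 by (simp add: poly_fun_def)
    then have [derivative_intros]: "(f has_derivative (\<lambda>_. 0)) (at x)"
      using smooth_has_derivative[OF poly_fun_smooth[OF 0], of "[]" x] by simp
    show ?thesis by (auto intro!: derivative_eq_intros)
  qed
  then show ?case
    by (rule poly_fun_SucI) (intro poly_fun_bounded_linear[OF bounded_linear_scaleR_right] 0)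
next
  case (Suc k)
  have d: "((\<lambda>x. (x \<bullet> b) *\<^sub>R f x) has_derivative (\<lambda>v. (v \<bullet> b) *\<^sub>R f x + (x \<bullet> b) *\<^sub>R iter_deriv f [v] x)) (at x)" for x
    using smooth_has_derivative[OF poly_fun_smooth[OF Suc.prems], of "[]" x]
    by (auto intro!: derivative_eq_intros simp: add.commute)
  show ?case
    by (rule poly_fun_SucI[OF d])
      (intro poly_fun_add Suc poly_fun_iter_deriv poly_fun_bounded_linear[OF bounded_linear_scaleR_right])
qed

text \<open>By linearity in the first slot, \<open>\<psi>(x, x, \<dots>) = \<Sum>\<^sub>b (x \<bullet> b) \<psi>(b, x, \<dots>)\<close>; symmetry moves \<open>b\<close> to the
  end, and the remaining factor is of lower degree.\<close>

lemma poly_fun_symmetric_multilinear: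
  fixes \<psi> :: "'a::euclidean_space list \<Rightarrow> 'b::real_normed_vector"
  assumes \<psi>: "symmetric_multilinear M \<psi>" and "m + length us = M"
  shows "poly_fun m (\<lambda>x. \<psi> (replicate m x @ us))"
  using assms(2)
proof (induction m arbitrary: us)
  case 0
  then show ?case by (simp add: poly_fun_const)
next
  case (Suc m)
  have "\<psi> (replicate (Suc m) x @ us) = (\<Sum>b\<in>Basis. (x \<bullet> b) *\<^sub>R \<psi> (replicate m x @ b # us))" for x
  proof -
    have l: "linear (\<lambda>v. \<psi> (v # replicate m x @ us))"
    proof -
      have "\<forall>us ws. length us + 1 + length ws = M \<longrightarrow> linear (\<lambda>v. \<psi> (us @ v # ws))"
        using \<psi> by (simp add: symmetric_multilinear_def)
      from this[rule_format, of "[]" "replicate m x @ us"] show ?thesis using Suc.prems by simp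
    qed
    have "\<psi> (replicate (Suc m) x @ us) = \<psi> ((\<Sum>b\<in>Basis. (x \<bullet> b) *\<^sub>R b) # replicate m x @ us)"
      by (simp add: euclidean_representation)
    also have "\<dots> = (\<Sum>b\<in>Basis. (x \<bullet> b) *\<^sub>R \<psi> (b # replicate m x @ us))"
      using linear_sum[OF l, of "\<lambda>b. (x \<bullet> b) *\<^sub>R b" Basis] linear_cmul[OF l] by simp
    also have "\<dots> = (\<Sum>b\<in>Basis. (x \<bullet> b) *\<^sub>R \<psi> (replicate m x @ b # us))"
    proof (intro sum.cong refl arg_cong2[of _ _ _ _ "(*\<^sub>R)"])
      fix b
      have "length (b # replicate m x @ us) = M"
        "mset (b # replicate m x @ us) = mset (replicate m x @ b # us)"
        using Suc.prems by auto
      then show "\<psi> (b # replicate m x @ us) = \<psi> (replicate m x @ b # us)"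
        using \<psi> unfolding symmetric_multilinear_def by blast
    qed
    finally show ?thesis .
  qed
  then show ?case using Suc by (simp add: poly_fun_sum poly_fun_inner_scaleR)
qed

lemma polynomial_imp_poly_fun:
  fixes P :: "'a::euclidean_space \<Rightarrow> 'b::real_normed_vector"
  assumes "polynomial_of_degree_le k P"
  shows "poly_fun k P"
proof -
  obtain \<psi> where \<psi>: "\<And>m. m \<le> k \<Longrightarrow> symmetric_multilinear m (\<psi> m)"
    "P = (\<lambda>x. \<Sum>m\<le>k. \<psi> m (replicate m x))"
    using assms unfolding polynomial_of_degree_le_def by blast
  show ?thesis unfolding \<psi>(2)
    using poly_fun_mono[OF poly_fun_symmetric_multilinear[OF \<psi>(1), of _ _ "[]"]]
    by (auto intro!: poly_fun_sum)
qed

lemma constant_if_derivative_0: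
  assumes f: "smooth f" and 0: "\<And>v. iter_deriv f (v # vs) = (\<lambda>_. 0)"
  shows "iter_deriv f vs x = iter_deriv f vs y"
  using has_derivative_zero_unique[of UNIV "iter_deriv f vs" x y] smooth_has_derivative[OF f, of vs]
  by (simp add: 0)

text \<open>By induction on the degree the directional derivatives vanish, so \<open>f\<close> is constant. Hence a
  polynomial is determined by its jet at one point.\<close>

lemma poly_fun_eq_0:
  assumes "poly_fun k f" and "\<And>vs. length vs \<le> k \<Longrightarrow> iter_deriv f vs a = 0"
  shows "f x = 0"
  using assms
proof (induction k arbitrary: f x)
  case 0
  have "f x = f a"
    using constant_if_derivative_0[OF poly_fun_smooth[OF 0(1)], of "[]" x a] 0(1)
    by (simp add: poly_fun_def)
  then show ?case using 0(2)[of "[]"] by simp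
next
  case (Suc k)
  have "iter_deriv f [v] x = 0" for v x
    by (rule Suc.IH[OF poly_fun_iter_deriv[OF Suc.prems(1)]])
      (simp add: Suc.prems(2) iter_deriv_append[symmetric])
  then have "f x = f a"
    using constant_if_derivative_0[OF poly_fun_smooth[OF Suc.prems(1)], of "[]" x a]
    by (simp add: fun_eq_iff)
  then show ?case using Suc.prems(2)[of "[]"] by simp
qed

section \<open>A reproducing kernel\<close>

lemma smooth_mult:
  fixes f g :: "'a::euclidean_space \<Rightarrow> real"
  shows "smooth f \<Longrightarrow> smooth g \<Longrightarrow> smooth (\<lambda>x. f x * g x)"
  using smooth_product[of f g] by simp

lemma smooth_inner: "smooth (\<lambda>x. x \<bullet> v)"
  using poly_fun_smooth[OF poly_fun_inner_scaleR[OF poly_fun_const[of 0 "1::real"], of v]] by simp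

text \<open>The functions \<open>t\<^sup>-\<^sup>j exp (- 1/t)\<close>, extended by zero; their derivatives are combinations of
  functions of the same family.\<close>

definition flat :: "nat \<Rightarrow> real \<Rightarrow> real" where
  "flat j t = (if t \<le> 0 then 0 else exp (- inverse t) * inverse t ^ j)"

lemma flat_tendsto_0: "(flat j \<longlongrightarrow> 0) (at_right 0)"
proof -
  have "((\<lambda>t. inverse t ^ j / exp (inverse t)) \<longlongrightarrow> (0::real)) (at_right 0)"
    by (rule filterlim_compose[OF tendsto_power_div_exp_0 filterlim_inverse_at_top_right])
  moreover have "eventually (\<lambda>t. inverse t ^ j / exp (inverse t) = flat j t) (at_right 0)"
    by (intro eventually_at_right_less[of 0, THEN eventually_mono])
      (simp add: flat_def exp_minus divide_inverse mult.commute)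
  ultimately show ?thesis by (rule Lim_transform_eventually)
qed

lemma DERIV_flat: "(flat j has_field_derivative (flat (j + 2) t - j * flat (j + 1) t)) (at t)"
proof (cases "t = 0")
  case False
  show ?thesis
  proof (cases "0 < t")
    case True
    have "((\<lambda>t. exp (- inverse t) * inverse t ^ j) has_field_derivative
        flat (j + 2) t - j * flat (j + 1) t) (at t)"
      using True
    proof -
      have "((\<lambda>t. exp (- inverse t) * inverse t ^ j) has_field_derivative
          (exp (- inverse t) * (inverse t)\<^sup>2) * inverse t ^ j
          + (j * inverse t ^ (j - 1) * (- (inverse t)\<^sup>2)) * exp (- inverse t)) (at t)"
        using True by (auto intro!: derivative_eq_intros simp: power2_eq_square algebra_simps)
      moreover have "(exp (- inverse t) * (inverse t)\<^sup>2) * inverse t ^ j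
          + (j * inverse t ^ (j - 1) * (- (inverse t)\<^sup>2)) * exp (- inverse t)
          = flat (j + 2) t - j * flat (j + 1) t"
        using True by (cases j) (simp_all add: flat_def algebra_simps power2_eq_square)
      ultimately show ?thesis by simp
    qed
    then show ?thesis
      by (rule DERIV_cong_ev[THEN iffD1, rotated -1, OF _ refl _ refl])
        (use True in \<open>auto simp: flat_def eventually_nhds intro!: exI[of _ "{0<..}"]\<close>)
  next
    case False
    then have "t < 0" using \<open>t \<noteq> 0\<close> by simp
    have "((\<lambda>t. 0) has_field_derivative flat (j + 2) t - j * flat (j + 1) t) (at t)"
      using \<open>t < 0\<close> by (simp add: flat_def)
    then show ?thesis
      by (rule DERIV_cong_ev[THEN iffD1, rotated -1, OF _ refl _ refl])
        (use \<open>t < 0\<close> in \<open>auto simp: flat_def eventually_nhds intro!: exI[of _ "{..<0}"]\<close>)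
  qed
next
  case True
  have "((\<lambda>h. (flat j (0 + h) - flat j 0) / h) \<longlongrightarrow> 0) (at 0)"
    unfolding filterlim_at_split
  proof
    show "((\<lambda>h. (flat j (0 + h) - flat j 0) / h) \<longlongrightarrow> 0) (at_left 0)"
      by (rule tendsto_eventually)
        (intro eventually_at_left_real[of "-1" 0, THEN eventually_mono], auto simp: flat_def)
    show "((\<lambda>h. (flat j (0 + h) - flat j 0) / h) \<longlongrightarrow> 0) (at_right 0)"
      by (rule Lim_transform_eventually[OF flat_tendsto_0[of "Suc j"]])
        (intro eventually_at_right_less[of 0, THEN eventually_mono], auto simp: flat_def divide_inverse)
  qed
  then show ?thesis using True by (simp add: DERIV_def flat_def)
qed

lemma smooth_flat:
  fixes q :: "'a::euclidean_space \<Rightarrow> real"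
  assumes "smooth q"
  shows "smooth (\<lambda>x. q x * flat j (1 - x \<bullet> x))"
proof (rule smooth_by_finite_sums[of _ "{(\<lambda>x. q x * flat j (1 - x \<bullet> x)) | q j. smooth q}"])
  let ?F = "{(\<lambda>x::'a. q x * flat j (1 - x \<bullet> x)) | q j. smooth q}"
  fix p assume "p \<in> ?F"
  then obtain q j where p: "p = (\<lambda>x. q x * flat j (1 - x \<bullet> x))" and q: "smooth q" by blast
  let ?D = "\<lambda>x v. (iter_deriv q [v] x * flat j (1 - x \<bullet> x)
      + (q x *\<^sub>R ((- 2) *\<^sub>R (x \<bullet> v))) * flat (j + 2) (1 - x \<bullet> x))
      + (q x *\<^sub>R ((2 * real j) *\<^sub>R (x \<bullet> v))) * flat (j + 1) (1 - x \<bullet> x)"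
  have "(p has_derivative ?D x) (at x)" for x
  proof -
    have "((\<lambda>x. flat j (1 - x \<bullet> x)) has_derivative
        (\<lambda>v. (flat (j + 2) (1 - x \<bullet> x) - j * flat (j + 1) (1 - x \<bullet> x)) * (- 2 * (x \<bullet> v)))) (at x)"
      by (rule has_derivative_compose[OF _ DERIV_flat[of j, unfolded has_field_derivative_def]])
        (auto intro!: derivative_eq_intros simp: inner_commute)
    from has_derivative_mult[OF smooth_has_derivative[OF q, of "[]" x, unfolded iter_deriv.simps(1)] this] show ?thesis
      unfolding p by (rule has_derivative_eq_rhs) (auto simp: fun_eq_iff algebra_simps)
  qed
  moreover have "(\<lambda>x. ?D x v) \<in> finite_sums ?F" for v
  proof -
    have mem: "(\<lambda>x. p x * flat i (1 - x \<bullet> x)) \<in> ?F" if "smooth p" for p :: "'a \<Rightarrow> real" and i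
      using that by blast
    have "smooth (\<lambda>x. q x *\<^sub>R (c *\<^sub>R (x \<bullet> v)))" for c
      by (intro smooth_product q smooth_scaleR smooth_inner)
    then show ?thesis
      by (intro finite_sums.add finite_sums.base mem smooth_iter_deriv q)
  qed
  ultimately show "\<exists>D. (\<forall>x. (p has_derivative D x) (at x)) \<and> (\<forall>v. (\<lambda>x. D x v) \<in> finite_sums ?F)"
    by (intro exI[of _ ?D]) blast
qed (use assms in blast)

lemma integrable_compact_support:
  fixes f :: "'a::euclidean_space \<Rightarrow> 'b::{banach, second_countable_topology}"
  assumes "continuous_on UNIV f" "\<And>x. x \<notin> cball a r \<Longrightarrow> f x = 0"
  shows "integrable lborel f"
proof -
  have "integrable lborel (\<lambda>x. indicator (cball a r) x *\<^sub>R f x)"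
    by (intro borel_integrable_compact continuous_on_subset[OF assms(1)]) auto
  moreover have "(\<lambda>x. indicator (cball a r) x *\<^sub>R f x) = f"
    using assms(2) by (auto simp: fun_eq_iff indicator_def)
  ultimately show ?thesis by simp
qed

lemma lborel_integral_affine:
  fixes f :: "'a::euclidean_space \<Rightarrow> real"
  assumes [measurable]: "f \<in> borel_measurable borel" and "c \<noteq> 0"
  shows "(LINT x|lborel. f x) = \<bar>c\<bar> ^ DIM('a) * (LINT x|lborel. f (c *\<^sub>R x + t))"
proof -
  have "(LINT x|lborel. f x) = (LINT x|density (distr lborel borel (\<lambda>x. t + c *\<^sub>R x)) (\<lambda>_. ennreal (\<bar>c\<bar>^DIM('a))). f x)"
    using lborel_affine[OF \<open>c \<noteq> 0\<close>, of t] by simp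
  also have "\<dots> = (LINT x|distr lborel borel (\<lambda>x. t + c *\<^sub>R x). \<bar>c\<bar>^DIM('a) *\<^sub>R f x)"
    by (rule integral_density) auto
  also have "\<dots> = (LINT x|lborel. \<bar>c\<bar>^DIM('a) *\<^sub>R f (t + c *\<^sub>R x))"
    by (rule integral_distr) auto
  finally show ?thesis by (simp add: add.commute)
qed

lemma bump_exists:
  "\<exists>\<rho> :: 'a::euclidean_space \<Rightarrow> real. smooth \<rho> \<and> (\<forall>x. 0 \<le> \<rho> x) \<and> (\<forall>x. x \<notin> cball 0 1 \<longrightarrow> \<rho> x = 0) \<and>
    (LINT x|lborel. \<rho> x) = 1"
proof -
  define \<rho> :: "'a \<Rightarrow> real" where "\<rho> x = flat 0 (1 - x \<bullet> x)" for x
  have s: "smooth \<rho>"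
    using smooth_flat[OF smooth_const[of 1], of 0] unfolding \<rho>_def by simp
  have n: "0 \<le> \<rho> x" for x by (simp add: \<rho>_def flat_def)
  have o: "\<rho> x = 0" if "x \<notin> cball 0 1" for x
    using that unfolding \<rho>_def flat_def by (auto simp: dot_square_norm power2_eq_square)
      (meson mult_le_one norm_ge_zero not_le less_imp_le mult_mono' less_1_mult)
  have int: "integrable lborel \<rho>"
    by (rule integrable_compact_support[OF smooth_continuous_on[OF s] o])
  have "0 < (LINT x|lborel. \<rho> x)"
  proof -
    have "measure lborel (ball (0::'a) (1/2)) * exp (- 2) = (LINT x|lborel. indicator (ball (0::'a) (1/2)) x * exp (-2))"
      by (simp add: emeasure_lborel_ball_finite)
    also have "\<dots> \<le> (LINT x|lborel. \<rho> x)"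
    proof (intro integral_mono int)
      show "integrable lborel (\<lambda>x. indicator (ball (0::'a) (1/2)) x * exp (-2) :: real)"
        by (intro integrable_mult_left integrable_real_indicator emeasure_lborel_ball_finite) auto
      fix x :: 'a
      show "indicator (ball (0::'a) (1/2)) x * exp (-2) \<le> \<rho> x"
      proof (cases "x \<in> ball 0 (1/2)")
        case True
        then have "x \<bullet> x \<le> (1/2) * (1/2)"
          unfolding dot_square_norm power2_eq_square by (intro mult_mono) auto
        then have "1 / 2 \<le> 1 - x \<bullet> x" by simp
        then have "inverse (1 - x \<bullet> x) \<le> 2"
          by (simp add: divide_simps)
        then show ?thesis using \<open>1 / 2 \<le> 1 - x \<bullet> x\<close> True by (simp add: \<rho>_def flat_def indicator_def)
      qed (use n in auto)
    qed
    finally have "measure lborel (ball (0::'a) (1/2)) * exp (- 2) \<le> (LINT x|lborel. \<rho> x)" .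
    moreover have "0 < measure lborel (ball (0::'a) (1/2))"
      by (simp add: content_ball_pos)
    ultimately show ?thesis by (smt (verit, best) exp_gt_zero mult_pos_pos)
  qed
  then show ?thesis
    using s n o smooth_scaleR[OF s, of "inverse (LINT x|lborel. \<rho> x)"]
    by (intro exI[of _ "\<lambda>x. inverse (LINT x|lborel. \<rho> x) * \<rho> x"]) auto
qed

text \<open>Richardson extrapolation. If \<open>\<phi>\<close> reproduces degree \<open>k\<close>, the combination
  \<open>(2\<^sup>k\<^sup>+\<^sup>1 \<cdot> 2\<^sup>n \<phi>(2 x) - \<phi>(x)) / (2\<^sup>k\<^sup>+\<^sup>1 - 1)\<close> tests a polynomial \<open>q\<close> of degree \<open>k + 1\<close> as \<open>\<phi>\<close> tests
  \<open>(2\<^sup>k\<^sup>+\<^sup>1 q(x/2) - q(x)) / (2\<^sup>k\<^sup>+\<^sup>1 - 1)\<close>, where the terms of degree \<open>k + 1\<close> cancel and the value at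
  \<open>0\<close> is kept.\<close>

lemma reproducing_kernel_exists:
  "\<exists>\<phi> :: 'a::euclidean_space \<Rightarrow> real. smooth \<phi> \<and> (\<forall>x. x \<notin> cball 0 1 \<longrightarrow> \<phi> x = 0) \<and>
    (\<forall>q. poly_fun k q \<longrightarrow> (LINT x|lborel. \<phi> x * q x) = q 0)"
proof (induction k)
  case 0
  obtain \<rho> :: "'a \<Rightarrow> real" where \<rho>: "smooth \<rho>" "\<forall>x. x \<notin> cball 0 1 \<longrightarrow> \<rho> x = 0" "(LINT x|lborel. \<rho> x) = 1"
    using bump_exists by blast
  have "(LINT x|lborel. \<rho> x * q x) = q 0" if q: "poly_fun 0 q" for q
  proof -
    have "q x = q 0" for x
      using constant_if_derivative_0[OF poly_fun_smooth[OF q], of "[]" x 0] q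
      by (simp add: poly_fun_def)
    then have "(LINT x|lborel. \<rho> x * q x) = (LINT x|lborel. \<rho> x * q 0)" by metis
    then show ?thesis using \<rho>(3) by simp
  qed
  then show ?case using \<rho> by blast
next
  case (Suc k)
  then obtain \<phi> :: "'a \<Rightarrow> real" where \<phi>: "smooth \<phi>" "\<And>x. x \<notin> cball 0 1 \<Longrightarrow> \<phi> x = 0"
    "\<And>q. poly_fun k q \<Longrightarrow> (LINT x|lborel. \<phi> x * q x) = q 0" by blast
  let ?c = "2 ^ Suc k :: real" and ?n = "DIM('a)"
  define \<eta> :: "'a \<Rightarrow> real" where "\<eta> x = inverse (?c - 1) *\<^sub>R (?c *\<^sub>R (2 ^ ?n *\<^sub>R \<phi> (2 *\<^sub>R x + 0)) - \<phi> x)" for x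
  have c: "?c - 1 > 0"
    using one_less_power[of "2::real" "Suc k"] by simp
  have "smooth \<eta>"
    unfolding \<eta>_def by (intro smooth_scaleR smooth_diff smooth_affine \<phi>)
  moreover have "\<eta> x = 0" if "x \<notin> cball 0 1" for x
    using that by (simp add: \<eta>_def \<phi>(2))
  moreover have "(LINT x|lborel. \<eta> x * q x) = q 0" if q: "poly_fun (Suc k) q" for q
  proof -
    let ?q = "\<lambda>x. inverse (?c - 1) *\<^sub>R (?c *\<^sub>R q ((1/2) *\<^sub>R x + 0) - q x)"
    have sq: "smooth q" "smooth ?q"
      by (intro smooth_scaleR smooth_diff smooth_affine poly_fun_smooth[OF q])+
    have pq: "poly_fun k ?q"
      unfolding poly_fun_def
    proof (intro conjI allI impI sq ext)
      fix vs :: "'a list" and x assume vs: "k < length vs"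
      have "iter_deriv ?q vs x = inverse (?c - 1) *\<^sub>R (?c *\<^sub>R ((1/2) ^ length vs *\<^sub>R iter_deriv q vs ((1/2) *\<^sub>R x + 0)) - iter_deriv q vs x)"
        using sq by (simp only: iter_deriv_scaleR iter_deriv_diff iter_deriv_affine smooth_scaleR smooth_diff smooth_affine)
      also have "\<dots> = 0"
      proof (cases "length vs = Suc k")
        case True
        have "iter_deriv q vs ((1/2) *\<^sub>R x + 0) = iter_deriv q vs x"
          by (rule constant_if_derivative_0[OF sq(1)]) (use q True in \<open>auto simp: poly_fun_def\<close>)
        then show ?thesis using True by (simp add: power_one_over)
      next
        case False
        then show ?thesis using q vs by (simp add: poly_fun_def)
      qed
      finally show "iter_deriv ?q vs x = 0" .
    qed
    have i1: "integrable lborel (\<lambda>x. \<phi> (2 *\<^sub>R x + 0) * q x)"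
      by (rule integrable_compact_support[where a=0 and r=1],
          intro smooth_continuous_on smooth_mult smooth_affine \<phi> sq) (simp add: \<phi>)
    have i2: "integrable lborel (\<lambda>x. \<phi> x * q x)"
      by (rule integrable_compact_support[where a=0 and r=1],
          intro smooth_continuous_on smooth_mult \<phi> sq) (simp add: \<phi>)
    have i3: "integrable lborel (\<lambda>x. \<phi> x * q ((1/2) *\<^sub>R x + 0))"
      by (rule integrable_compact_support[where a=0 and r=1],
          intro smooth_continuous_on smooth_mult smooth_affine \<phi> sq) (simp add: \<phi>)
    have "(LINT x|lborel. \<phi> (2 *\<^sub>R x + 0) * q x) = (1/2) ^ ?n * (LINT x|lborel. \<phi> x * q ((1/2) *\<^sub>R x + 0))"
      using lborel_integral_affine[of "\<lambda>x. \<phi> (2 *\<^sub>R x + 0) * q x" "1/2" 0] i1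
      by (simp add: borel_measurable_integrable)
    then have e: "2 ^ ?n * (LINT x|lborel. \<phi> (2 *\<^sub>R x + 0) * q x) = (LINT x|lborel. \<phi> x * q ((1/2) *\<^sub>R x + 0))"
      by (simp add: power_one_over)
    have "(LINT x|lborel. \<eta> x * q x)
        = (LINT x|lborel. inverse (?c - 1) * (?c * (2 ^ ?n * (\<phi> (2 *\<^sub>R x + 0) * q x)) - \<phi> x * q x))"
      unfolding \<eta>_def by (intro Bochner_Integration.integral_cong) (auto simp: algebra_simps)
    also have "\<dots> = inverse (?c - 1) * (?c * (2 ^ ?n * (LINT x|lborel. \<phi> (2 *\<^sub>R x + 0) * q x)) - (LINT x|lborel. \<phi> x * q x))"
      using i1 i2 by simp
    also have "\<dots> = (LINT x|lborel. inverse (?c - 1) * (?c * (\<phi> x * q ((1/2) *\<^sub>R x + 0)) - \<phi> x * q x))"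
      unfolding e using i2 i3 by simp
    also have "\<dots> = (LINT x|lborel. \<phi> x * ?q x)"
      by (intro Bochner_Integration.integral_cong) (auto simp: algebra_simps)
    also have "\<dots> = ?q 0" by (rule \<phi>(3)[OF pq])
    also have "\<dots> = q 0" using c by (simp add: field_simps)
    finally show ?thesis .
  qed
  ultimately show ?case by blast
qed

section \<open>Test functions and continuous functionals\<close>

text \<open>A supremum-free form of the norm of class \<open>i\<close>.\<close>

definition C_bound :: "nat \<Rightarrow> ('a::euclidean_space \<Rightarrow> 'b::real_normed_vector) \<Rightarrow> real \<Rightarrow> bool" where
  "C_bound i f M \<longleftrightarrow>
    (\<forall>vs x. length vs \<le> i \<longrightarrow> (\<forall>v\<in>set vs. norm v \<le> 1) \<longrightarrow> norm (iter_deriv f vs x) \<le> M)"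

lemma C_boundD:
  "C_bound i f M \<Longrightarrow> length vs \<le> i \<Longrightarrow> \<forall>v\<in>set vs. norm v \<le> 1 \<Longrightarrow> norm (iter_deriv f vs x) \<le> M"
  by (simp add: C_bound_def)

lemma C_bound_mono: "C_bound i f M \<Longrightarrow> j \<le> i \<Longrightarrow> M \<le> N \<Longrightarrow> C_bound j f N"
  unfolding C_bound_def by (meson order_trans)

lemma C_bound_norm_le: "C_bound i f M \<Longrightarrow> norm (f x) \<le> M"
  using C_boundD[of i f M "[]"] by simp

lemma C_bound_nonneg: "C_bound i f M \<Longrightarrow> 0 \<le> M"
  using C_bound_norm_le norm_ge_zero order_trans by blast

lemma C_bound_add: "smooth f \<Longrightarrow> smooth g \<Longrightarrow> C_bound i f M \<Longrightarrow> C_bound i g N \<Longrightarrow> C_bound i (\<lambda>x. f x + g x) (M + N)"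
  unfolding C_bound_def by (simp add: iter_deriv_add) (meson add_mono norm_triangle_le)

lemma C_bound_scaleR: "smooth f \<Longrightarrow> C_bound i f M \<Longrightarrow> C_bound i (\<lambda>x. c *\<^sub>R f x) (\<bar>c\<bar> * M)"
  unfolding C_bound_def by (simp add: iter_deriv_scaleR mult_left_mono)

lemma C_bound_scaleR_left:
  "smooth f \<Longrightarrow> C_bound i f M \<Longrightarrow> C_bound i (\<lambda>x. f x *\<^sub>R y) (M * norm y)"
  unfolding C_bound_def by (simp add: iter_deriv_scaleR_left mult_right_mono)

lemma C_bound_affine:
  assumes "smooth f" "C_bound i f M"
  shows "C_bound i (\<lambda>x. f (c *\<^sub>R x + b)) (max 1 \<bar>c\<bar> ^ i * M)"
  unfolding C_bound_def
proof (intro allI impI)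
  fix vs :: "'a list" and x assume vs: "length vs \<le> i" "\<forall>v\<in>set vs. norm v \<le> 1"
  have "\<bar>c\<bar> ^ length vs \<le> max 1 \<bar>c\<bar> ^ length vs" by (intro power_mono) auto
  also have "\<dots> \<le> max 1 \<bar>c\<bar> ^ i" by (intro power_increasing vs) auto
  finally show "norm (iter_deriv (\<lambda>x. f (c *\<^sub>R x + b)) vs x) \<le> max 1 \<bar>c\<bar> ^ i * M"
    unfolding iter_deriv_affine[OF assms(1)] norm_scaleR power_abs
    by (intro mult_mono C_boundD[OF assms(2)] vs) auto
qed

lemma supp_subset_cball_iff: "supp f \<subseteq> cball a r \<longleftrightarrow> (\<forall>x. x \<notin> cball a r \<longrightarrow> f x = 0)"
  for a :: "'a::euclidean_space"
proof
  assume "supp f \<subseteq> cball a r"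
  then show "\<forall>x. x \<notin> cball a r \<longrightarrow> f x = 0"
    unfolding supp_def using closure_subset[of "{x. f x \<noteq> 0}"] by blast
next
  assume "\<forall>x. x \<notin> cball a r \<longrightarrow> f x = 0"
  then show "supp f \<subseteq> cball a r"
    unfolding supp_def by (intro closure_minimal) auto
qed

lemma test_functions_in_cball_iff:
  "\<theta> \<in> test_functions_in (cball a r) \<longleftrightarrow> smooth \<theta> \<and> (\<forall>x. x \<notin> cball a r \<longrightarrow> \<theta> x = 0)"
proof -
  have "supp \<theta> \<subseteq> cball a r \<Longrightarrow> compact (supp \<theta>)"
    using compact_cball compact_Int_closed[of "cball a r" "supp \<theta>"] unfolding supp_def
    by (metis closed_closure inf.absorb2)
  then show ?thesis
    unfolding test_functions_in_def test_functions_def using supp_subset_cball_iff[of \<theta> a r] by auto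
qed

lemma test_functions_in_subset: "\<theta> \<in> test_functions_in K \<Longrightarrow> \<theta> \<in> test_functions"
  by (simp add: test_functions_in_def)

lemma test_functionE:
  assumes "\<theta> \<in> test_functions"
  obtains r where "0 < r" "\<theta> \<in> test_functions_in (cball 0 r)"
proof -
  have "bounded (supp \<theta>)" using assms by (auto simp: test_functions_def compact_imp_bounded)
  then obtain r where "0 < r" "\<And>x. x \<in> supp \<theta> \<Longrightarrow> norm x \<le> r" by (auto simp: bounded_pos)
  then show ?thesis using that assms by (force simp: test_functions_in_def)
qed

lemma test_functions_smooth: "\<theta> \<in> test_functions \<Longrightarrow> smooth \<theta>"
  by (simp add: test_functions_def)

lemma test_functions_in_cball_translate:
  assumes "\<theta> \<in> test_functions_in (cball 0 R)"
  shows "(\<lambda>z. \<theta> (z - x)) \<in> test_functions_in (cball x R)"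
  using assms smooth_affine[of \<theta> 1 "- x"]
  by (auto simp: test_functions_in_cball_iff dist_norm norm_minus_commute)

lemma C_bound_test_function:
  assumes "\<theta> \<in> test_functions"
  shows "\<exists>M\<ge>0. C_bound i \<theta> M"
proof -
  obtain r where r: "\<theta> \<in> test_functions_in (cball 0 r)" using assms by (rule test_functionE)
  then have \<theta>: "smooth \<theta>" "\<And>x. x \<notin> cball 0 r \<Longrightarrow> \<theta> x = 0" by (auto simp: test_functions_in_cball_iff)
  obtain M where M: "0 \<le> M" "\<And>x vs. x \<in> cball 0 r \<Longrightarrow> length vs \<le> i \<Longrightarrow> \<forall>v\<in>set vs. norm v \<le> 1 \<Longrightarrow> norm (iter_deriv \<theta> vs x) \<le> M"
    using iter_deriv_bounded_on_compact[OF \<theta>(1) compact_cball] by metis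
  moreover have "iter_deriv \<theta> vs x = 0" if "x \<notin> cball 0 r" for vs x
    by (rule iter_deriv_eq_0_outside[OF \<theta>(1) closed_cball[of 0 r] \<theta>(2) that])
  ultimately show ?thesis unfolding C_bound_def by (metis norm_zero)
qed

text \<open>Distributions, with continuity expressed by bounds instead of topologies. Differences
  such as \<open>T - P\<close> are of this kind as well.\<close>

definition test_functional :: "(('a::euclidean_space \<Rightarrow> 'b::real_normed_vector) \<Rightarrow> real) \<Rightarrow> bool" where
  "test_functional T \<longleftrightarrow>
    (\<forall>\<theta>\<in>test_functions. \<forall>\<phi>\<in>test_functions. T (\<lambda>x. \<theta> x + \<phi> x) = T \<theta> + T \<phi>) \<and>
    (\<forall>c. \<forall>\<theta>\<in>test_functions. T (\<lambda>x. c *\<^sub>R \<theta> x) = c * T \<theta>) \<and>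
    (\<forall>r. \<exists>i C. 0 \<le> C \<and> (\<forall>\<theta>\<in>test_functions_in (cball 0 r). \<forall>M. C_bound i \<theta> M \<longrightarrow> \<bar>T \<theta>\<bar> \<le> C * M))"

lemma
  assumes "test_functional T"
  shows test_functional_add: "\<theta> \<in> test_functions \<Longrightarrow> \<phi> \<in> test_functions \<Longrightarrow> T (\<lambda>x. \<theta> x + \<phi> x) = T \<theta> + T \<phi>"
    and test_functional_scaleR: "\<theta> \<in> test_functions \<Longrightarrow> T (\<lambda>x. c *\<^sub>R \<theta> x) = c * T \<theta>"
    and test_functional_bound: "\<exists>i C. 0 \<le> C \<and> (\<forall>\<theta>\<in>test_functions_in (cball 0 r). \<forall>M. C_bound i \<theta> M \<longrightarrow> \<bar>T \<theta>\<bar> \<le> C * M)"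
  using assms unfolding test_functional_def by blast+

lemma test_functions_in_cball_closed:
  assumes "\<theta> \<in> test_functions_in (cball a r)"
  shows "\<phi> \<in> test_functions_in (cball a r) \<Longrightarrow> (\<lambda>x. \<theta> x + \<phi> x) \<in> test_functions_in (cball a r)"
    and "\<phi> \<in> test_functions_in (cball a r) \<Longrightarrow> (\<lambda>x. \<theta> x - \<phi> x) \<in> test_functions_in (cball a r)"
    and "(\<lambda>x. c *\<^sub>R \<theta> x) \<in> test_functions_in (cball a r)"
  using assms by (auto simp: test_functions_in_cball_iff intro: smooth_add smooth_diff smooth_scaleR)

lemma test_functional_diff:
  assumes T: "test_functional T" and S: "test_functional S"
  shows "test_functional (\<lambda>\<theta>. T \<theta> - S \<theta>)"
  unfolding test_functional_def
proof (intro conjI ballI allI)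
  fix r
  obtain i C j D where "0 \<le> C" "0 \<le> D"
    and C: "\<And>\<theta> M. \<theta> \<in> test_functions_in (cball 0 r) \<Longrightarrow> C_bound i \<theta> M \<Longrightarrow> \<bar>T \<theta>\<bar> \<le> C * M"
    and D: "\<And>\<theta> M. \<theta> \<in> test_functions_in (cball 0 r) \<Longrightarrow> C_bound j \<theta> M \<Longrightarrow> \<bar>S \<theta>\<bar> \<le> D * M"
    using test_functional_bound[OF T, of r] test_functional_bound[OF S, of r] by blast
  have "\<bar>T \<theta> - S \<theta>\<bar> \<le> (C + D) * M" if "\<theta> \<in> test_functions_in (cball 0 r)" "C_bound (max i j) \<theta> M" for \<theta> M
    using C[OF that(1) C_bound_mono[OF that(2) max.cobounded1 order_refl]]
      D[OF that(1) C_bound_mono[OF that(2) max.cobounded2 order_refl]]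
    by (simp add: algebra_simps)
  then show "\<exists>i C. 0 \<le> C \<and> (\<forall>\<theta>\<in>test_functions_in (cball 0 r). \<forall>M. C_bound i \<theta> M \<longrightarrow> \<bar>T \<theta> - S \<theta>\<bar> \<le> C * M)"
    using \<open>0 \<le> C\<close> \<open>0 \<le> D\<close> by (intro exI[of _ "max i j"] exI[of _ "C + D"]) auto
qed (simp_all add: test_functional_add[OF T] test_functional_add[OF S] test_functional_scaleR[OF T]
      test_functional_scaleR[OF S] algebra_simps)

text \<open>The suprema in \<open>deriv_sup\<close> behave as seminorms only because they are finite, which holds as
  \<open>\<phi>\<close> is a test function.\<close>

lemma deriv_sup_triangle:
  assumes \<phi>: "\<phi> \<in> test_functions" and \<theta>: "smooth \<theta>" and K: "compact K" "K \<noteq> {}"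
    and s: "C_bound j \<theta> s"
  shows "deriv_sup K j (\<lambda>x. \<theta> x - \<phi> x) \<le> s + deriv_sup K j (\<lambda>x. 0 - \<phi> x)"
proof -
  let ?U = "{vs :: 'a list. length vs = j \<and> (\<forall>v\<in>set vs. norm v \<le> 1)}"
  have U: "?U \<noteq> {}" by (auto intro!: exI[of _ "replicate j 0"])
  have s\<phi>: "smooth \<phi>" using \<phi> by (rule test_functions_smooth)
  let ?m = "\<lambda>x. multilinear_norm j (nth_deriv j (\<lambda>x. 0 - \<phi> x) x)"
  obtain M where M: "C_bound j \<phi> M" using C_bound_test_function[OF \<phi>] by blast
  have n: "norm (nth_deriv j (\<lambda>x. 0 - \<phi> x) x vs) = norm (iter_deriv \<phi> vs x)" if "vs \<in> ?U" for vs x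
    using that by (simp add: nth_deriv_def
        iter_deriv_bounded_linear[OF bounded_linear_minus[OF bounded_linear_ident] s\<phi>])
  have b1: "norm (iter_deriv \<phi> vs x) \<le> ?m x" if "vs \<in> ?U" for vs x
    unfolding multilinear_norm_def n[OF that, of x, symmetric]
    by (rule cSUP_upper[OF that]) (auto intro!: bdd_aboveI2[where M=M] simp: n C_boundD[OF M] simp del: diff_0)
  have m: "?m x \<le> M" for x
    unfolding multilinear_norm_def by (intro cSUP_least U) (use n C_boundD[OF M] in auto)
  have b2: "?m x \<le> deriv_sup K j (\<lambda>x. 0 - \<phi> x)" if "x \<in> K" for x
    unfolding deriv_sup_def by (rule cSUP_upper[OF that]) (auto intro!: bdd_aboveI2[where M=M] m simp del: diff_0)
  show ?thesis
    unfolding deriv_sup_def[of _ _ "\<lambda>x. \<theta> x - \<phi> x"] multilinear_norm_def[of _ "nth_deriv _ (\<lambda>x. \<theta> x - \<phi> x) _"]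
  proof (intro cSUP_least K U)
    fix x vs assume x: "x \<in> K" and vs: "vs \<in> ?U"
    have "norm (nth_deriv j (\<lambda>x. \<theta> x - \<phi> x) x vs) = norm (iter_deriv \<theta> vs x - iter_deriv \<phi> vs x)"
      using vs by (simp add: nth_deriv_def iter_deriv_diff[OF \<theta> s\<phi>])
    also have "\<dots> \<le> s + norm (iter_deriv \<phi> vs x)"
      using norm_triangle_ineq4[of "iter_deriv \<theta> vs x" "iter_deriv \<phi> vs x"] C_boundD[OF s, of vs x] vs
      by simp
    also have "\<dots> \<le> s + deriv_sup K j (\<lambda>x. 0 - \<phi> x)"
      using b1[OF vs, of x] b2[OF x] by simp
    finally show "norm (nth_deriv j (\<lambda>x. \<theta> x - \<phi> x) x vs) \<le> s + deriv_sup K j (\<lambda>x. 0 - \<phi> x)" .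
  qed
qed

text \<open>The generating sets of the topology have arbitrary centres. One that contains \<open>0\<close> also
  contains a ball about \<open>0\<close> for the same seminorm, by the triangle inequality.\<close>

lemma test_topology_nhd_0:
  assumes K: "compact K" "K \<noteq> {}" and "openin (test_topology K) U" "(\<lambda>_. 0) \<in> U"
  shows "\<exists>i s. 0 < s \<and> (\<forall>\<theta>\<in>test_functions_in K. C_bound i \<theta> s \<longrightarrow> \<theta> \<in> U)"
proof -
  have "generate_topology_on {{\<theta> \<in> test_functions_in K. deriv_sup K j (\<lambda>x. \<theta> x - \<phi> x) < e} | j \<phi> e.
       \<phi> \<in> test_functions_in K \<and> 0 < e} U"
    using assms(3) unfolding test_topology_def by (rule openin_topology_generated_by)
  then show ?thesis using assms(4)
  proof induction
    case (Int a b)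
    then obtain i s j t where "0 < s" "\<And>\<theta>. \<theta> \<in> test_functions_in K \<Longrightarrow> C_bound i \<theta> s \<Longrightarrow> \<theta> \<in> a"
      "0 < t" "\<And>\<theta>. \<theta> \<in> test_functions_in K \<Longrightarrow> C_bound j \<theta> t \<Longrightarrow> \<theta> \<in> b" by blast
    then show ?case
      using C_bound_mono[where i="max i j" and M="min s t", OF _ max.cobounded1 min.cobounded1]
        C_bound_mono[where i="max i j" and M="min s t", OF _ max.cobounded2 min.cobounded2]
      by (intro exI[of _ "max i j"] exI[of _ "min s t"]) auto
  next
    case (UN \<U>)
    then show ?case by blast
  next
    case (Basis B)
    then obtain j \<phi> e where B: "B = {\<theta> \<in> test_functions_in K. deriv_sup K j (\<lambda>x. \<theta> x - \<phi> x) < e}"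
      and \<phi>: "\<phi> \<in> test_functions_in K" by blast
    let ?d = "e - deriv_sup K j (\<lambda>x. 0 - \<phi> x)"
    have d: "0 < ?d" using Basis B by simp
    have "\<theta> \<in> B" if \<theta>: "\<theta> \<in> test_functions_in K" "C_bound j \<theta> (?d / 2)" for \<theta>
      using deriv_sup_triangle[OF test_functions_in_subset[OF \<phi>] _ K \<theta>(2)] d \<theta>(1)
      by (simp add: B test_functions_smooth test_functions_in_subset field_simps)
    then show ?case using d by (intro exI[of _ j] exI[of _ "?d / 2"]) auto
  qed simp
qed

text \<open>The preimage of \<open>(-1, 1)\<close> contains a ball of a norm of class \<open>i\<close>, and the bound follows by
  scaling.\<close>

lemma distribution_imp_test_functional:
  fixes T :: "('a::euclidean_space \<Rightarrow> 'b::real_normed_vector) \<Rightarrow> real"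
  assumes T: "distribution T"
  shows "test_functional T"
  unfolding test_functional_def
proof (intro conjI allI)
  have sc: "T (\<lambda>x. c *\<^sub>R \<theta> x) = c * T \<theta>" if "\<theta> \<in> test_functions" for c \<theta>
    using T that unfolding distribution_def by blast
  fix r :: real
  \<comment> \<open>For negative \<open>r\<close> the ball of radius \<open>r\<close> is empty, and \<open>deriv_sup\<close> would be unspecified.\<close>
  let ?K = "cball (0::'a) (max r 0)"
  have z: "(\<lambda>_. 0) \<in> (test_functions :: ('a \<Rightarrow> 'b) set)" "(\<lambda>_. 0) \<in> (test_functions_in ?K :: ('a \<Rightarrow> 'b) set)"
    by (auto simp: test_functions_in_cball_iff intro!: test_functions_in_subset[of _ "cball 0 1"])
  have T0: "T (\<lambda>_. 0) = 0" using sc[OF z(1), of 0] by simp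
  have cm: "continuous_map (test_topology ?K) euclideanreal T"
    using T unfolding distribution_def by auto
  let ?U = "{\<theta> \<in> topspace (test_topology ?K). T \<theta> \<in> {-1<..<1}}"
  have "\<exists>e>0. deriv_sup ?K 0 (\<lambda>x. (0::'b) - 0) < e" by (meson less_add_one less_le_trans not_le linear lt_ex gt_ex)
  then have "(\<lambda>_. 0) \<in> topspace (test_topology ?K :: ('a \<Rightarrow> 'b) topology)"
    unfolding test_topology_def topology_generated_by_topspace using z(2) by blast
  then have "(\<lambda>_. 0) \<in> ?U" using T0 by simp
  moreover have "openin (test_topology ?K) ?U"
    by (rule openin_continuous_map_preimage[OF cm]) auto
  moreover have "compact ?K" "?K \<noteq> {}" by auto
  ultimately obtain i s where s: "0 < s" "\<And>\<theta>. \<theta> \<in> test_functions_in ?K \<Longrightarrow> C_bound i \<theta> s \<Longrightarrow> \<theta> \<in> ?U"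
    using test_topology_nhd_0[of ?K ?U] by blast
  have "\<bar>T \<theta>\<bar> \<le> inverse s * M" if \<theta>: "\<theta> \<in> test_functions_in (cball 0 r)" and M: "C_bound i \<theta> M" for \<theta> M
  proof -
    have \<theta>': "\<theta> \<in> test_functions_in ?K" "smooth \<theta>" "\<theta> \<in> test_functions"
      using \<theta> test_functions_in_subset[OF \<theta>] by (auto simp: test_functions_in_cball_iff)
    \<comment> \<open>Scaling by \<open>s / N\<close> with \<open>N > M\<close> covers the case \<open>M = 0\<close>.\<close>
    have "\<bar>T \<theta>\<bar> \<le> inverse s * N" if "M < N" for N
    proof -
      have N: "0 < N" using C_bound_nonneg[OF M] that by simp
      have "C_bound i (\<lambda>x. (s / N) *\<^sub>R \<theta> x) (\<bar>s / N\<bar> * N)"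
        using \<theta>'(2) M that by (intro C_bound_scaleR C_bound_mono[OF M]) auto
      then have "C_bound i (\<lambda>x. (s / N) *\<^sub>R \<theta> x) s" using N s(1) by simp
      then have "\<bar>T (\<lambda>x. (s / N) *\<^sub>R \<theta> x)\<bar> < 1"
        using s(2)[OF test_functions_in_cball_closed(3)[OF \<theta>'(1)]] by fastforce
      then have "(s / N) * \<bar>T \<theta>\<bar> < 1" using s(1) N by (simp add: sc[OF \<theta>'(3)] abs_mult)
      then show ?thesis using s(1) N by (simp add: field_simps)
    qed
    then have "\<bar>T \<theta>\<bar> \<le> inverse s * M + e" if "0 < e" for e
    proof -
      assume *: "\<And>N. M < N \<Longrightarrow> \<bar>T \<theta>\<bar> \<le> inverse s * N"
      have "\<bar>T \<theta>\<bar> \<le> inverse s * (M + s * e)" by (rule *) (use s(1) that in simp)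
      then show ?thesis using s(1) by (simp add: field_simps)
    qed
    then show ?thesis by (rule field_le_epsilon)
  qed
  then show "\<exists>i C. 0 \<le> C \<and> (\<forall>\<theta>\<in>test_functions_in (cball 0 r). \<forall>M. C_bound i \<theta> M \<longrightarrow> \<bar>T \<theta>\<bar> \<le> C * M)"
    using s(1) by (intro exI[of _ i] exI[of _ "inverse s"]) auto
qed (use T in \<open>auto simp: distribution_def\<close>)

lemma test_functional_function_distribution:
  fixes P :: "'a::euclidean_space \<Rightarrow> 'b::real_normed_vector \<Rightarrow>\<^sub>L real"
  assumes int: "\<And>\<theta>. \<theta> \<in> test_functions \<Longrightarrow> integrable lborel (\<lambda>x. P x (\<theta> x))"
    and bd: "\<And>r. \<exists>c. \<forall>x\<in>cball 0 r. norm (P x) \<le> c"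
  shows "test_functional (function_distribution P)"
  unfolding test_functional_def
proof (intro conjI allI ballI)
  fix r
  obtain c where c: "\<And>x. x \<in> cball 0 r \<Longrightarrow> norm (P x) \<le> c" using bd by metis
  let ?c = "\<bar>c\<bar>" and ?B = "cball (0::'a) r"
  have "\<bar>function_distribution P \<theta>\<bar> \<le> (?c * measure lborel ?B) * M"
    if \<theta>: "\<theta> \<in> test_functions_in ?B" and M: "C_bound 0 \<theta> M" for \<theta> M
  proof -
    have "\<bar>function_distribution P \<theta>\<bar> \<le> (LINT x|lborel. norm (P x (\<theta> x)))"
      unfolding function_distribution_def using integral_norm_bound[of lborel "\<lambda>x. P x (\<theta> x)"] by simp
    also have "\<dots> \<le> (LINT x|lborel. indicator ?B x * (?c * M))"
    proof (intro integral_mono integrable_norm int test_functions_in_subset[OF \<theta>])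
      show "integrable lborel (\<lambda>x. indicator ?B x * (?c * M))"
        by (intro integrable_mult_left integrable_real_indicator emeasure_lborel_cball_finite) auto
      fix x
      show "norm (P x (\<theta> x)) \<le> indicator ?B x * (?c * M)"
      proof (cases "x \<in> ?B")
        case True
        have "norm (P x (\<theta> x)) \<le> norm (P x) * norm (\<theta> x)" by (rule norm_blinfun)
        also have "\<dots> \<le> ?c * M"
          using c[OF True] C_bound_norm_le[OF M, of x] by (intro mult_mono) auto
        finally show ?thesis using True by simp
      next
        case False
        then have "\<theta> x = 0" using \<theta> by (simp add: test_functions_in_cball_iff)
        then show ?thesis using False by simp
      qed
    qed
    also have "\<dots> = (?c * measure lborel ?B) * M"
      by simp
    finally show ?thesis .
  qed
  then show "\<exists>i C. 0 \<le> C \<and> (\<forall>\<theta>\<in>test_functions_in ?B. \<forall>M. C_bound i \<theta> M \<longrightarrow> \<bar>function_distribution P \<theta>\<bar> \<le> C * M)"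
    by (intro exI[of _ 0] exI[of _ "?c * measure lborel ?B"]) auto
qed (simp_all add: function_distribution_def blinfun.add_right blinfun.scaleR_right int)

lemma test_functional_continuous:
  fixes P :: "'a::euclidean_space \<Rightarrow> 'b::real_normed_vector \<Rightarrow>\<^sub>L real"
  assumes P: "continuous_on UNIV P"
  shows "test_functional (function_distribution P)"
proof (rule test_functional_function_distribution)
  fix \<theta> :: "'a \<Rightarrow> 'b" assume \<theta>: "\<theta> \<in> test_functions"
  obtain r where r: "\<theta> \<in> test_functions_in (cball 0 r)" using \<theta> by (rule test_functionE)
  show "integrable lborel (\<lambda>x. P x (\<theta> x))"
    by (rule integrable_compact_support[of _ 0 r])
      (use r in \<open>auto intro!: blinfun.continuous_on[OF P] smooth_continuous_on[OF test_functions_smooth[OF \<theta>]]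
          simp: test_functions_in_cball_iff\<close>)
next
  fix r
  have "bounded (P ` cball 0 r)"
    by (intro compact_imp_bounded compact_continuous_image continuous_on_subset[OF P]) auto
  then show "\<exists>c. \<forall>x\<in>cball 0 r. norm (P x) \<le> c" by (auto simp: bounded_iff)
qed

section \<open>Mollification of functionals\<close>

text \<open>Convolution with the reflection of \<open>\<psi>\<close>: for an integrable function \<open>f\<close> in place of \<open>T\<close>, the value
  is \<open>\<integral> \<psi>(z - x) f(z) dz\<close>.\<close>

definition mollify ::
    "(('a::euclidean_space \<Rightarrow> 'b::real_normed_vector) \<Rightarrow> real) \<Rightarrow> ('a \<Rightarrow> real) \<Rightarrow> 'a \<Rightarrow> 'b \<Rightarrow>\<^sub>L real" where
  "mollify T \<psi> x = Blinfun (\<lambda>y. T (\<lambda>z. \<psi> (z - x) *\<^sub>R y))"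

lemma test_functions_in_cball_mono:
  "\<theta> \<in> test_functions_in (cball a R) \<Longrightarrow> dist a b + R \<le> S \<Longrightarrow> \<theta> \<in> test_functions_in (cball b S)"
  unfolding test_functions_in_cball_iff
  by (auto simp: not_le) (smt (verit, best) dist_commute dist_triangle)

lemma test_functions_in_cball_test_function:
  fixes \<theta> :: "'a::euclidean_space \<Rightarrow> 'b::real_normed_vector"
  shows "smooth \<theta> \<Longrightarrow> (\<And>x. x \<notin> cball a r \<Longrightarrow> \<theta> x = 0) \<Longrightarrow> \<theta> \<in> test_functions"
  by (rule test_functions_in_subset[of _ "cball a r"]) (auto simp: test_functions_in_cball_iff)

lemma translate_scaleR_test_function:
  assumes "\<psi> \<in> test_functions_in (cball 0 R)" "norm x + R \<le> S"
  shows "(\<lambda>z. \<psi> (z - x) *\<^sub>R y) \<in> test_functions_in (cball 0 S)"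
proof -
  have "(\<lambda>z. \<psi> (z - x)) \<in> test_functions_in (cball x R)"
    by (rule test_functions_in_cball_translate) fact
  then have "(\<lambda>z. \<psi> (z - x)) \<in> test_functions_in (cball 0 S)"
    by (rule test_functions_in_cball_mono) (use assms in auto)
  then show ?thesis by (auto simp: test_functions_in_cball_iff intro: smooth_scaleR_left)
qed

lemma C_bound_translate_scaleR:
  assumes "smooth \<psi>" "C_bound i \<psi> M"
  shows "C_bound i (\<lambda>z. \<psi> (z - x) *\<^sub>R y) (M * norm y)"
  using C_bound_scaleR_left[OF smooth_affine[OF assms(1), of 1 "- x"] C_bound_affine[OF assms, of 1 "- x"]]
  by simp

lemma bounded_linear_mollify:
  fixes T :: "('a::euclidean_space \<Rightarrow> 'b::real_normed_vector) \<Rightarrow> real"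
  assumes T: "test_functional T" and \<psi>: "\<psi> \<in> test_functions"
  shows "bounded_linear (\<lambda>y. T (\<lambda>z. \<psi> (z - x) *\<^sub>R y))"
proof -
  obtain R where R: "\<psi> \<in> test_functions_in (cball 0 R)" using \<psi> by (rule test_functionE)
  have mem: "(\<lambda>z. \<psi> (z - x) *\<^sub>R y) \<in> test_functions_in (cball 0 (norm x + R))" for y
    by (rule translate_scaleR_test_function[OF R]) simp
  note mem' = test_functions_in_subset[OF mem]
  obtain i C where C: "0 \<le> C" "\<And>\<theta> M. \<theta> \<in> test_functions_in (cball 0 (norm x + R)) \<Longrightarrow> C_bound i \<theta> M \<Longrightarrow> \<bar>T \<theta>\<bar> \<le> C * M"
    using test_functional_bound[OF T] by metis
  obtain M where M: "C_bound i \<psi> M" using C_bound_test_function[OF \<psi>] by blast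
  show ?thesis
  proof (rule bounded_linear_intro[where K = "C * M"])
    show "T (\<lambda>z. \<psi> (z - x) *\<^sub>R (y + y')) = T (\<lambda>z. \<psi> (z - x) *\<^sub>R y) + T (\<lambda>z. \<psi> (z - x) *\<^sub>R y')" for y y'
      using test_functional_add[OF T mem' mem'] by (simp add: scaleR_add_right)
    show "T (\<lambda>z. \<psi> (z - x) *\<^sub>R (c *\<^sub>R y)) = c *\<^sub>R T (\<lambda>z. \<psi> (z - x) *\<^sub>R y)" for c y
      using test_functional_scaleR[OF T mem', of c y] by (simp add: mult.commute)
    show "norm (T (\<lambda>z. \<psi> (z - x) *\<^sub>R y)) \<le> norm y * (C * M)" for y
      using C(2)[OF mem C_bound_translate_scaleR[OF test_functions_smooth[OF \<psi>] M]]
      by (simp add: mult_ac)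
  qed
qed

lemma mollify_apply:
  "test_functional T \<Longrightarrow> \<psi> \<in> test_functions \<Longrightarrow> mollify T \<psi> x y = T (\<lambda>z. \<psi> (z - x) *\<^sub>R y)"
  unfolding mollify_def by (simp add: bounded_linear_Blinfun_apply bounded_linear_mollify)

lemma mollify_bound:
  assumes T: "test_functional T"
  shows "\<exists>i C. 0 \<le> C \<and> (\<forall>\<psi> x R M. \<psi> \<in> test_functions_in (cball 0 R) \<longrightarrow> norm x + R \<le> S \<longrightarrow>
    C_bound i \<psi> M \<longrightarrow> norm (mollify T \<psi> x) \<le> C * M)"
proof -
  obtain i C where C: "0 \<le> C" "\<And>\<theta> M. \<theta> \<in> test_functions_in (cball 0 S) \<Longrightarrow> C_bound i \<theta> M \<Longrightarrow> \<bar>T \<theta>\<bar> \<le> C * M"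
    using test_functional_bound[OF T] by metis
  have "norm (mollify T \<psi> x) \<le> C * M"
    if \<psi>: "\<psi> \<in> test_functions_in (cball 0 R)" and S: "norm x + R \<le> S" and M: "C_bound i \<psi> M" for \<psi> x R M
  proof (rule norm_blinfun_bound)
    have \<psi>': "\<psi> \<in> test_functions" by (rule test_functions_in_subset[OF \<psi>])
    show "0 \<le> C * M" using C(1) C_bound_nonneg[OF M] by simp
    show "norm (mollify T \<psi> x y) \<le> C * M * norm y" for y
      using C(2)[OF translate_scaleR_test_function[OF \<psi> S] C_bound_translate_scaleR[OF test_functions_smooth[OF \<psi>'] M]]
      by (simp add: mollify_apply[OF T \<psi>'] mult_ac)
  qed
  then show ?thesis using C(1) by blast
qed

lemma mollify_add:
  assumes T: "test_functional T" and \<psi>: "\<psi> \<in> test_functions_in (cball 0 R)" and \<eta>: "\<eta> \<in> test_functions_in (cball 0 R)"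
  shows "mollify T (\<lambda>z. \<psi> z + \<eta> z) x = mollify T \<psi> x + mollify T \<eta> x"
proof (rule blinfun_eqI)
  fix y
  note mem = translate_scaleR_test_function[OF _ order_refl, THEN test_functions_in_subset, of _ R x y]
  show "mollify T (\<lambda>z. \<psi> z + \<eta> z) x y = (mollify T \<psi> x + mollify T \<eta> x) y"
    using test_functional_add[OF T mem[OF \<psi>] mem[OF \<eta>]] test_functions_in_cball_closed(1)[OF \<psi> \<eta>] \<psi> \<eta>
    by (simp add: mollify_apply[OF T] test_functions_in_subset blinfun.add_left scaleR_add_left)
qed

lemma mollify_scaleR:
  assumes T: "test_functional T" and \<psi>: "\<psi> \<in> test_functions_in (cball 0 R)"
  shows "mollify T (\<lambda>z. c *\<^sub>R \<psi> z) x = c *\<^sub>R mollify T \<psi> x"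
proof (rule blinfun_eqI)
  fix y
  note mem = translate_scaleR_test_function[OF _ order_refl, THEN test_functions_in_subset, of _ R x y]
  have "(\<lambda>z. c *\<^sub>R \<psi> z) \<in> test_functions"
    by (rule test_functions_in_subset[OF test_functions_in_cball_closed(3)[OF \<psi>]])
  then show "mollify T (\<lambda>z. c *\<^sub>R \<psi> z) x y = (c *\<^sub>R mollify T \<psi> x) y"
    using test_functional_scaleR[OF T mem[OF \<psi>], of c] test_functions_in_subset[OF \<psi>]
    by (simp add: mollify_apply[OF T] blinfun.scaleR_left)
qed

text \<open>The remainder bound is uniform in \<open>z\<close>; applied to all derivatives of a test function, it shows
  that the difference quotients of the translates converge as test functions.\<close>

lemma smooth_linear_remainder:
  fixes G :: "'a::euclidean_space \<Rightarrow> 'b::real_normed_vector"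
  assumes G: "smooth G" and M: "\<And>w u y. norm w \<le> 1 \<Longrightarrow> norm u \<le> 1 \<Longrightarrow> norm (iter_deriv G [w, u] y) \<le> M"
  shows "norm (G (z + h) - G z - iter_deriv G [h] z) \<le> M * (norm h)\<^sup>2"
proof -
  have M0: "0 \<le> M" using order_trans[OF norm_ge_zero M[of 0 0]] by simp
  have M': "norm (iter_deriv G [w, u] y) \<le> M * norm w * norm u" for w u y
  proof -
    have "norm (iter_deriv G us y) \<le> M" if "length us = length [w, u]" "\<forall>u\<in>set us. norm u \<le> 1" for us
    proof -
      obtain a b where "us = [a, b]" using \<open>length us = _\<close> by (auto simp: length_Suc_conv)
      then show ?thesis using that M by simp
    qed
    then have "norm (iter_deriv G [w, u] y) \<le> prod_list (map norm [w, u]) * M"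
      by (rule iter_deriv_norm_le[OF G])
    then show ?thesis by (simp add: mult_ac)
  qed
  let ?S = "closed_segment z (z + h)"
  have d1: "norm (iter_deriv G [u] y - iter_deriv G [u] z) \<le> (M * norm h) * norm u" if y: "y \<in> ?S" for u y
  proof -
    have "norm (iter_deriv G [u] y - iter_deriv G [u] z) \<le> (M * norm u) * norm (y - z)"
      by (rule differentiable_bound[where S=UNIV and f'="\<lambda>y w. iter_deriv G [w, u] y"])
        (use M' M0 in \<open>auto intro!: smooth_has_derivative[OF G, of "[u]"] onorm_bound simp: mult_ac\<close>)
    also have "\<dots> \<le> (M * norm u) * norm h"
      using segment_bound1[OF y] M0 by (intro mult_left_mono) (auto simp: norm_minus_commute)
    finally show ?thesis by (simp add: mult_ac)
  qed
  have l: "bounded_linear (\<lambda>u. iter_deriv G [u] z)"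
    by (rule has_derivative_bounded_linear[OF smooth_has_derivative[OF G, of "[]"]])
  have "norm ((G (z + h) - iter_deriv G [z + h] z) - (G z - iter_deriv G [z] z)) \<le> (M * norm h) * norm ((z + h) - z)"
  proof (rule differentiable_bound[where S="?S" and f'="\<lambda>y u. iter_deriv G [u] y - iter_deriv G [u] z"])
    fix y assume "y \<in> ?S"
    show "((\<lambda>y. G y - iter_deriv G [y] z) has_derivative (\<lambda>u. iter_deriv G [u] y - iter_deriv G [u] z)) (at y within ?S)"
      using has_derivative_at_withinI[OF has_derivative_diff[OF smooth_has_derivative[OF G, of "[]" y]
          bounded_linear_imp_has_derivative[OF l]]] by simp
    show "onorm (\<lambda>u. iter_deriv G [u] y - iter_deriv G [u] z) \<le> M * norm h"
      by (rule onorm_bound) (use d1[OF \<open>y \<in> ?S\<close>] M0 in auto)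
  qed auto
  moreover have "iter_deriv G [z + h] z = iter_deriv G [z] z + iter_deriv G [h] z"
    using linear_add[OF bounded_linear.linear[OF l]] by simp
  ultimately show ?thesis by (simp add: power2_eq_square algebra_simps)
qed

lemma iter_deriv_test_functions_in_cball:
  assumes "\<psi> \<in> test_functions_in (cball a R)"
  shows "iter_deriv \<psi> vs \<in> test_functions_in (cball a R)"
  using assms iter_deriv_eq_0_outside[of \<psi> "cball a R"]
  by (auto simp: test_functions_in_cball_iff intro: smooth_iter_deriv)

text \<open>The error of the linear approximation is the mollification with the remainder
  \<open>\<psi>(z - h) - \<psi>(z) + D\<^sub>h \<psi>(z)\<close>, all of whose derivatives are of order \<open>|h|\<^sup>2\<close>. That \<open>D\<^sup>v\<^sup>s\<close> of the
  remainder is the remainder of \<open>D\<^sup>v\<^sup>s \<psi>\<close> rests on the symmetry of derivatives.\<close>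

lemma mollify_has_derivative:
  fixes T :: "('a::euclidean_space \<Rightarrow> 'b::real_normed_vector) \<Rightarrow> real"
  assumes T: "test_functional T" and "\<psi> \<in> test_functions"
  shows "(mollify T \<psi> has_derivative (\<lambda>h. mollify T (\<lambda>z. - 1 *\<^sub>R iter_deriv \<psi> [h] z) x)) (at x)"
proof -
  obtain R where R: "\<psi> \<in> test_functions_in (cball 0 R)" using assms(2) by (rule test_functionE)
  let ?R = "R + 1" and ?S = "norm x + (R + 1)"
  have s: "smooth \<psi>" using assms(2) by (rule test_functions_smooth)
  obtain i C where C: "0 \<le> C" "\<And>\<eta> x R M. \<eta> \<in> test_functions_in (cball 0 R) \<Longrightarrow> norm x + R \<le> ?S \<Longrightarrow>
    C_bound i \<eta> M \<Longrightarrow> norm (mollify T \<eta> x) \<le> C * M"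
    using mollify_bound[OF T, of ?S] by metis
  obtain M where M: "0 \<le> M" "C_bound (i + 2) \<psi> M" using C_bound_test_function[OF assms(2)] by blast
  let ?D = "\<lambda>h z. - 1 *\<^sub>R iter_deriv \<psi> [h] z"
  have memD: "iter_deriv \<psi> [h] \<in> test_functions_in (cball 0 R)" for h
    by (rule iter_deriv_test_functions_in_cball[OF R])
  have memD1: "?D h \<in> test_functions_in (cball 0 R)" for h
    by (rule test_functions_in_cball_closed(3)[OF memD])
  have lin\<psi>: "linear (\<lambda>h. iter_deriv \<psi> [h] z)" for z
    by (rule has_derivative_linear[OF smooth_has_derivative[OF s, of "[]"]])
  have lin: "linear (\<lambda>h. mollify T (?D h) x)"
  proof (rule linearI)
    show "mollify T (?D (h + h')) x = mollify T (?D h) x + mollify T (?D h') x" for h h'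
      using mollify_add[OF T memD1 memD1] linear_add[OF lin\<psi>] by (simp add: algebra_simps)
    show "mollify T (?D (c *\<^sub>R h)) x = c *\<^sub>R mollify T (?D h) x" for c h
      using mollify_scaleR[OF T memD1, of c h x] linear_cmul[OF lin\<psi>] by simp
  qed
  have est: "norm (mollify T \<psi> (x + h) - mollify T \<psi> x - mollify T (?D h) x) \<le> C * M * (norm h)\<^sup>2"
    if h: "norm h \<le> 1" for h
  proof -
    let ?\<rho> = "\<lambda>z. \<psi> (1 *\<^sub>R z + - h) + - 1 *\<^sub>R \<psi> z + - 1 *\<^sub>R ?D h z"
    have m1: "(\<lambda>z. \<psi> (1 *\<^sub>R z + - h)) \<in> test_functions_in (cball 0 ?R)"
      using test_functions_in_cball_mono[OF test_functions_in_cball_translate[OF R, of h], of 0 ?R] h by simp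
    have m2: "\<psi> \<in> test_functions_in (cball 0 ?R)" "?D h \<in> test_functions_in (cball 0 ?R)"
      using test_functions_in_cball_mono[OF R, of 0 ?R] test_functions_in_cball_mono[OF memD1, of 0 ?R] by auto
    note m3 = test_functions_in_cball_closed(3)[OF m2(1), of "-1"] test_functions_in_cball_closed(3)[OF m2(2), of "-1"]
    have "mollify T ?\<rho> x = mollify T (\<lambda>z. \<psi> (1 *\<^sub>R z + - h)) x - mollify T \<psi> x - mollify T (?D h) x"
      unfolding mollify_add[OF T test_functions_in_cball_closed(1)[OF m1 m3(1)] m3(2)]
        mollify_add[OF T m1 m3(1)] mollify_scaleR[OF T m2(1)] mollify_scaleR[OF T m2(2)] by simp
    also have "mollify T (\<lambda>z. \<psi> (1 *\<^sub>R z + - h)) x = mollify T \<psi> (x + h)"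
      unfolding mollify_def by (simp add: algebra_simps)
    finally have "norm (mollify T \<psi> (x + h) - mollify T \<psi> x - mollify T (?D h) x) = norm (mollify T ?\<rho> x)"
      by simp
    also have "\<dots> \<le> C * (M * (norm h)\<^sup>2)"
    proof (rule C(2))
      show "?\<rho> \<in> test_functions_in (cball 0 ?R)"
        by (intro test_functions_in_cball_closed(1) m1 m3)
      show "C_bound i ?\<rho> (M * (norm h)\<^sup>2)"
        unfolding C_bound_def
      proof (intro allI impI)
        fix vs :: "'a list" and z assume vs: "length vs \<le> i" "\<forall>v\<in>set vs. norm v \<le> 1"
        have "iter_deriv ?\<rho> vs z = iter_deriv \<psi> vs (z + - h) - iter_deriv \<psi> vs z + iter_deriv \<psi> (vs @ [h]) z"
          using s unfolding iter_deriv_append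
          by (simp only: iter_deriv_add iter_deriv_scaleR iter_deriv_affine smooth_add smooth_scaleR
              smooth_affine smooth_iter_deriv) simp
        also have "iter_deriv \<psi> (vs @ [h]) z = iter_deriv (iter_deriv \<psi> vs) [h] z"
          using iter_deriv_rotate[OF s, of h vs] iter_deriv_append[of \<psi> "[h]" vs] by simp
        also have "\<dots> = - iter_deriv (iter_deriv \<psi> vs) [- h] z"
          using linear_neg[OF has_derivative_linear[OF smooth_has_derivative[OF smooth_iter_deriv[OF s], of vs "[]"]]]
          by simp
        finally have "norm (iter_deriv ?\<rho> vs z)
          = norm (iter_deriv \<psi> vs (z + - h) - iter_deriv \<psi> vs z - iter_deriv (iter_deriv \<psi> vs) [- h] z)" by simp
        also have "\<dots> \<le> M * (norm (- h))\<^sup>2"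
          by (intro smooth_linear_remainder smooth_iter_deriv s)
            (use vs C_boundD[OF M(2)] in \<open>auto simp: iter_deriv_append[symmetric]\<close>)
        finally show "norm (iter_deriv ?\<rho> vs z) \<le> M * (norm h)\<^sup>2" by simp
      qed
    qed simp
    finally show ?thesis by (simp add: mult.assoc)
  qed
  show ?thesis
    unfolding has_derivative_at_alt
  proof (intro conjI allI impI)
    show "bounded_linear (\<lambda>h. mollify T (?D h) x)" using lin by (simp add: linear_conv_bounded_linear)
    fix e :: real assume "0 < e"
    show "\<exists>d>0. \<forall>y. norm (y - x) < d \<longrightarrow>
        norm (mollify T \<psi> y - mollify T \<psi> x - mollify T (?D (y - x)) x) \<le> e * norm (y - x)"
    proof (intro exI[of _ "min 1 (e / (C * M + 1))"] conjI allI impI)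
      have p: "0 < C * M + 1" using C(1) M(1) by (simp add: add_nonneg_pos)
      show "0 < min 1 (e / (C * M + 1))" using p \<open>0 < e\<close> by simp
      fix y assume y: "norm (y - x) < min 1 (e / (C * M + 1))"
      have "C * M * norm (y - x) \<le> (C * M + 1) * (e / (C * M + 1))"
        using y p C(1) M(1) by (intro mult_mono) auto
      also have "\<dots> = e" using p by simp
      finally have "C * M * (norm (y - x))\<^sup>2 \<le> e * norm (y - x)"
        by (simp add: power2_eq_square mult_right_mono flip: mult.assoc)
      moreover have "norm (mollify T \<psi> (x + (y - x)) - mollify T \<psi> x - mollify T (?D (y - x)) x) \<le> C * M * (norm (y - x))\<^sup>2"
        by (rule est) (use y in simp)
      ultimately show "norm (mollify T \<psi> y - mollify T \<psi> x - mollify T (?D (y - x)) x) \<le> e * norm (y - x)"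
        by (simp add: algebra_simps)
    qed
  qed
qed

lemma
  assumes T: "test_functional T" and \<psi>: "\<psi> \<in> test_functions"
  shows iter_deriv_mollify:
      "iter_deriv (mollify T \<psi>) vs = mollify T (\<lambda>z. (- 1) ^ length vs *\<^sub>R iter_deriv \<psi> vs z)"
    and smooth_mollify: "smooth (mollify T \<psi>)"
proof -
  obtain R where R: "\<psi> \<in> test_functions_in (cball 0 R)" using \<psi> by (rule test_functionE)
  have s: "smooth \<psi>" using \<psi> by (rule test_functions_smooth)
  let ?\<psi> = "\<lambda>vs z. (- 1) ^ length vs *\<^sub>R iter_deriv \<psi> vs z"
  have mem: "?\<psi> vs \<in> test_functions" for vs
    by (rule test_functions_in_subset[OF test_functions_in_cball_closed(3)[OF iter_deriv_test_functions_in_cball[OF R]]])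
  have d: "(mollify T (?\<psi> vs) has_derivative (\<lambda>h. mollify T (?\<psi> (h # vs)) x)) (at x)" for vs x
  proof -
    have "iter_deriv (?\<psi> vs) [h] = (\<lambda>z. (- 1) ^ length vs *\<^sub>R iter_deriv \<psi> (h # vs) z)" for h
      using iter_deriv_append[of \<psi> "[h]" vs]
      by (subst iter_deriv_scaleR) (auto intro: smooth_iter_deriv s)
    then show ?thesis using mollify_has_derivative[OF T mem, of vs x] by simp
  qed
  show *: "iter_deriv (mollify T \<psi>) vs = mollify T (?\<psi> vs)" for vs
  proof (induction vs)
    case (Cons v vs)
    from iter_deriv_Cons_eq[OF Cons d] show ?case .
  qed simp
  show "smooth (mollify T \<psi>)"
    unfolding smooth_iff_differentiable * using differentiableI[OF d] by blast
qed

definition dilate :: "real \<Rightarrow> ('a::euclidean_space \<Rightarrow> real) \<Rightarrow> 'a \<Rightarrow> real" where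
  "dilate r \<phi> z = inverse (r ^ DIM('a)) * \<phi> (inverse r *\<^sub>R z)"

lemma dilate_test_function:
  assumes "\<phi> \<in> test_functions_in (cball 0 1)" "0 < r"
  shows "dilate r \<phi> \<in> test_functions_in (cball 0 r)"
proof -
  have s: "smooth \<phi>" and o: "\<And>x. x \<notin> cball 0 1 \<Longrightarrow> \<phi> x = 0"
    using assms by (auto simp: test_functions_in_cball_iff)
  have "dilate r \<phi> x = 0" if "x \<notin> cball 0 r" for x
    unfolding dilate_def using that assms(2) by (subst o) (auto simp: field_simps)
  then show ?thesis
    using smooth_scaleR[OF smooth_affine[OF s, of "inverse r" 0], of "inverse (r ^ DIM('a))"]
    by (simp add: test_functions_in_cball_iff dilate_def[abs_def])
qed

lemma iter_deriv_dilate: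
  assumes "smooth (\<phi> :: 'a::euclidean_space \<Rightarrow> real)"
  shows "iter_deriv (dilate r \<phi>) vs z
    = inverse (r ^ DIM('a)) * inverse (r ^ length vs) * iter_deriv \<phi> vs (inverse r *\<^sub>R z)"
  using iter_deriv_scaleR[OF smooth_affine[OF assms, of "inverse r" 0], of "inverse (r ^ DIM('a))" vs]
  by (simp add: dilate_def[abs_def] iter_deriv_affine[OF assms, of _ 0, simplified] power_inverse)

lemma mollify_poly_fun:
  fixes P :: "'a::euclidean_space \<Rightarrow> 'b::real_normed_vector \<Rightarrow>\<^sub>L real"
  assumes P: "poly_fun k P" and r: "0 < r" and \<phi>: "\<phi> \<in> test_functions_in (cball 0 1)"
    and repr: "\<And>q. poly_fun k q \<Longrightarrow> (LINT x|lborel. \<phi> x * q x) = q 0"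
  shows "mollify (function_distribution P) (dilate r \<phi>) = P"
proof (intro ext blinfun_eqI)
  fix x y
  have sP: "smooth P" and s\<phi>: "smooth \<phi>"
    using poly_fun_smooth[OF P] \<phi> by (auto simp: test_functions_in_cball_iff)
  note T = test_functional_continuous[OF smooth_continuous_on[OF sP]]
  have Py: "poly_fun k (\<lambda>z. P z y)"
    by (rule poly_fun_bounded_linear[OF blinfun.bounded_linear_left P])
  let ?f = "\<lambda>z. dilate r \<phi> (z - x) * P z y"
  have "continuous_on UNIV ?f"
    unfolding dilate_def
    by (intro continuous_intros continuous_on_compose2[OF smooth_continuous_on[OF s\<phi>, of UNIV]]
        smooth_continuous_on[OF sP]) auto
  then have "(LINT z|lborel. ?f z) = r ^ DIM('a) * (LINT z|lborel. ?f (r *\<^sub>R z + x))"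
    using lborel_integral_affine[of ?f r x] r by (simp add: borel_measurable_continuous_onI)
  also have "\<dots> = (LINT z|lborel. r ^ DIM('a) * ?f (r *\<^sub>R z + x))"
    by simp
  also have "\<dots> = (LINT z|lborel. \<phi> z * P (r *\<^sub>R z + x) y)"
    using r by (intro Bochner_Integration.integral_cong) (auto simp: dilate_def)
  also have "\<dots> = P x y"
    using repr[OF poly_fun_affine[OF Py, of r x]] by simp
  finally show "mollify (function_distribution P) (dilate r \<phi>) x y = P x y"
    using mollify_apply[OF T test_functions_in_subset[OF dilate_test_function[OF \<phi> r]]]
    by (simp add: function_distribution_def blinfun.scaleR_right)
qed

lemma mollify_minus:
  assumes T: "test_functional T" and S: "test_functional S" and \<psi>: "\<psi> \<in> test_functions"
  shows "mollify (\<lambda>\<theta>. T \<theta> - S \<theta>) \<psi> = (\<lambda>x. mollify T \<psi> x - mollify S \<psi> x)"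
  by (intro ext blinfun_eqI)
    (simp add: mollify_apply[OF _ \<psi>] T S test_functional_diff blinfun.diff_left)

text \<open>As the kernel reproduces \<open>P\<close>, the difference \<open>u - P\<close> is the mollification of \<open>T - P\<close>, and its
  derivative at \<open>x\<close> is \<open>T - P\<close> applied to a rescaled derivative of \<open>\<phi>\<close>. Seen from \<open>a\<close> at scale \<open>8 r\<close>,
  this test function is \<open>\<theta>\<close>; the factor \<open>8\<close> leaves room for points \<open>x\<close> at distance up to \<open>7 r\<close>.\<close>

lemma iter_deriv_mollify_error:
  fixes T :: "('a::euclidean_space \<Rightarrow> 'b::real_normed_vector) \<Rightarrow> real"
  assumes T: "test_functional T" and P: "poly_fun k P" and r: "0 < r"
    and \<phi>: "\<phi> \<in> test_functions_in (cball 0 1)"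
    and repr: "\<And>q. poly_fun k q \<Longrightarrow> (LINT x|lborel. \<phi> x * q x) = q 0"
    and vs: "length vs \<le> k"
    and \<theta>: "\<theta> = (\<lambda>w. iter_deriv \<phi> vs (8 *\<^sub>R w + inverse r *\<^sub>R (a - x)) *\<^sub>R y)"
  shows "blinfun_apply (iter_deriv (mollify T (dilate r \<phi>)) vs x - iter_deriv P vs x) y
      = (- 1) ^ length vs * 8 ^ (DIM('a) + k) * r ^ (k - length vs) * scaled_error T k a P (8 * r) \<theta>"
proof -
  let ?S = "\<lambda>\<theta>. T \<theta> - function_distribution P \<theta>" and ?\<psi> = "dilate r \<phi>"
  note FP = test_functional_continuous[OF smooth_continuous_on[OF poly_fun_smooth[OF P]]]
  note S = test_functional_diff[OF T FP]
  have s\<phi>: "smooth \<phi>" using \<phi> by (simp add: test_functions_in_cball_iff)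
  have \<psi>: "?\<psi> \<in> test_functions_in (cball 0 r)" by (rule dilate_test_function[OF \<phi> r])
  note \<psi>' = test_functions_in_subset[OF \<psi>]
  have "(\<lambda>x. mollify T ?\<psi> x - P x) = mollify ?S ?\<psi>"
    using mollify_minus[OF T FP \<psi>'] mollify_poly_fun[OF P r \<phi> repr] by simp
  then have "iter_deriv (mollify T ?\<psi>) vs x - iter_deriv P vs x = iter_deriv (mollify ?S ?\<psi>) vs x"
    using iter_deriv_diff[OF smooth_mollify[OF T \<psi>'] poly_fun_smooth[OF P], of vs] by metis
  also have "\<dots> = mollify ?S (\<lambda>z. (- 1) ^ length vs *\<^sub>R iter_deriv ?\<psi> vs z) x"
    by (simp add: iter_deriv_mollify[OF S \<psi>'])
  also have "\<dots> = (- 1) ^ length vs *\<^sub>R mollify ?S (iter_deriv ?\<psi> vs) x"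
    by (rule mollify_scaleR[OF S iter_deriv_test_functions_in_cball[OF \<psi>]])
  finally have 1: "blinfun_apply (iter_deriv (mollify T ?\<psi>) vs x - iter_deriv P vs x) y
      = (- 1) ^ length vs * ?S (\<lambda>z. iter_deriv ?\<psi> vs (z - x) *\<^sub>R y)"
    using mollify_apply[OF S test_functions_in_subset[OF iter_deriv_test_functions_in_cball[OF \<psi>]]]
    by (simp add: blinfun.scaleR_left)
  let ?g = "\<lambda>z. iter_deriv \<phi> vs (inverse r *\<^sub>R (z - x)) *\<^sub>R y"
  have g: "?g \<in> test_functions"
  proof (rule test_functions_in_cball_test_function[of _ x r])
    have "smooth (\<lambda>z. iter_deriv \<phi> vs (inverse r *\<^sub>R z + - inverse r *\<^sub>R x) *\<^sub>R y)"
      by (intro smooth_scaleR_left smooth_affine smooth_iter_deriv s\<phi>)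
    then show "smooth ?g" by (simp add: algebra_simps)
    show "?g z = 0" if "z \<notin> cball x r" for z
    proof -
      have "r < norm (z - x)" using that by (simp add: dist_norm norm_minus_commute)
      then have "1 < norm (z - x) / r" using r by simp
      then have "inverse r *\<^sub>R (z - x) \<notin> cball 0 1" using r by (simp add: divide_inverse mult.commute)
      then have "iter_deriv \<phi> vs (inverse r *\<^sub>R (z - x)) = 0"
        using iter_deriv_test_functions_in_cball[OF \<phi>, of vs] unfolding test_functions_in_cball_iff by blast
      then show ?thesis by simp
    qed
  qed
  have "(\<lambda>z. iter_deriv ?\<psi> vs (z - x) *\<^sub>R y)
     = (\<lambda>z. (inverse (r ^ DIM('a)) * inverse (r ^ length vs)) *\<^sub>R ?g z)"
    by (simp add: iter_deriv_dilate[OF s\<phi>])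
  then have 2: "?S (\<lambda>z. iter_deriv ?\<psi> vs (z - x) *\<^sub>R y)
      = inverse (r ^ DIM('a)) * inverse (r ^ length vs) * ?S ?g"
    using test_functional_scaleR[OF S g] by simp
  have "8 *\<^sub>R inverse (8 * r) *\<^sub>R (z - a) + inverse r *\<^sub>R (a - x) = inverse r *\<^sub>R (z - x)" for z
    using r by (simp add: algebra_simps)
  then have "(\<lambda>z. \<theta> (inverse (8 * r) *\<^sub>R (z - a))) = ?g"
    unfolding \<theta> by simp
  then have 3: "scaled_error T k a P (8 * r) \<theta> = inverse ((8 * r) ^ k) * (inverse ((8 * r) ^ DIM('a)) * ?S ?g)"
    by (simp add: scaled_error_def rescale_def)
  have "r ^ k = r ^ (k - length vs) * r ^ length vs" using vs by (simp add: power_add[symmetric])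
  then show ?thesis unfolding 1 2 3 using r by (simp add: field_simps power_add power_mult_distrib)
qed

section \<open>Uniform boundedness on the space of test functions\<close>

text \<open>The step of the nested ball argument: a ball of class \<open>i\<close> contains a ball of some class
  \<open>i'\<close> on which one of the functionals exceeds \<open>n\<close>.\<close>

lemma uniform_boundedness_step:
  fixes \<L> :: "(('a::euclidean_space \<Rightarrow> 'b::real_normed_vector) \<Rightarrow> real) set" and n :: nat
  assumes D_def: "D = test_functions_in (cball 0 1)"
    and \<L>: "\<And>L. L \<in> \<L> \<Longrightarrow> test_functional L"
    and pointwise: "\<And>L \<theta>. L \<in> \<L> \<Longrightarrow> \<theta> \<in> D \<Longrightarrow> \<bar>L \<theta>\<bar> \<le> \<nu> \<theta>"
    and unbounded: "\<And>i C. 0 \<le> C \<Longrightarrow> \<exists>L\<in>\<L>. \<exists>\<theta>\<in>D. \<exists>M. C_bound i \<theta> M \<and> C * M < \<bar>L \<theta>\<bar>"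
    and \<theta>: "\<theta> \<in> D" "0 < s"
  shows "\<exists>\<theta>'\<in>D. \<exists>i'\<ge>max i n. \<exists>s'. 0 < s' \<and> s' \<le> s / 2 \<and> C_bound i (\<lambda>x. \<theta>' x - \<theta> x) (s / 2) \<and>
    (\<forall>\<xi>\<in>D. C_bound i' (\<lambda>x. \<xi> x - \<theta>' x) s' \<longrightarrow> (\<exists>L\<in>\<L>. n < \<bar>L \<xi>\<bar>))"
proof -
  \<comment> \<open>Chosen so that a multiple of size \<open>s / 2\<close> of the witness \<open>\<eta>\<close> moves \<open>L\<close> by more than
    \<open>n + 1 + |L \<theta>|\<close>.\<close>
  let ?C = "(n + 1 + \<bar>\<nu> \<theta>\<bar>) / (s / 2)"
  have "0 \<le> ?C" using \<theta>(2) by simp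
  from unbounded[OF this, of i] obtain L \<eta> M where L: "L \<in> \<L>" and \<eta>: "\<eta> \<in> D" and M: "C_bound i \<eta> M" "?C * M < \<bar>L \<eta>\<bar>"
    by blast
  note tL = \<L>[OF L]
  have \<eta>': "\<eta> \<in> test_functions" "smooth \<eta>" and \<theta>': "\<theta> \<in> test_functions" "smooth \<theta>"
    using \<eta> \<theta>(1) unfolding D_def by (auto dest: test_functions_in_subset test_functions_smooth)
  have "M \<noteq> 0"
  proof
    assume "M = 0"
    then have "\<eta> x = 0" for x using C_bound_norm_le[OF M(1), of x] by simp
    then have "\<eta> = (\<lambda>x. 0 *\<^sub>R \<eta> x)" by auto
    then have "L \<eta> = 0" using test_functional_scaleR[OF tL \<eta>'(1), of 0] by simp
    then show False using M(2) \<open>M = 0\<close> by simp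
  qed
  then have M0: "0 < M" using C_bound_nonneg[OF M(1)] by simp
  let ?\<eta> = "\<lambda>x. (s / 2 / M) *\<^sub>R \<eta> x" and ?\<theta> = "\<lambda>x. \<theta> x + (s / 2 / M) *\<^sub>R \<eta> x"
  have m\<eta>: "?\<eta> \<in> D" using \<eta> unfolding D_def by (rule test_functions_in_cball_closed(3))
  have m\<theta>: "?\<theta> \<in> D" using \<theta>(1) m\<eta> unfolding D_def by (rule test_functions_in_cball_closed(1))
  have b: "C_bound i (\<lambda>x. ?\<theta> x - \<theta> x) (s / 2)"
    using C_bound_scaleR[OF \<eta>'(2) M(1), of "s / 2 / M"] M0 \<theta>(2) by simp
  have "L ?\<theta> = L \<theta> + s / 2 / M * L \<eta>"
    using test_functional_add[OF tL \<theta>'(1) test_functions_in_subset] m\<eta> test_functional_scaleR[OF tL \<eta>'(1)]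
    unfolding D_def by simp
  moreover have "n + 1 + \<bar>\<nu> \<theta>\<bar> < \<bar>s / 2 / M * L \<eta>\<bar>"
  proof -
    have "n + 1 + \<bar>\<nu> \<theta>\<bar> = s / 2 / M * (?C * M)" using M0 \<theta>(2) by simp
    also have "\<dots> < s / 2 / M * \<bar>L \<eta>\<bar>" using M(2) M0 \<theta>(2) by (intro mult_strict_left_mono) auto
    finally show ?thesis using M0 \<theta>(2) by (simp add: abs_mult)
  qed
  moreover have "\<bar>L \<theta>\<bar> \<le> \<bar>\<nu> \<theta>\<bar>" using pointwise[OF L \<theta>(1)] by simp
  ultimately have big: "n + 1 < \<bar>L ?\<theta>\<bar>" by linarith
  obtain j c where c: "0 \<le> c" "\<And>\<theta> M. \<theta> \<in> D \<Longrightarrow> C_bound j \<theta> M \<Longrightarrow> \<bar>L \<theta>\<bar> \<le> c * M"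
    using test_functional_bound[OF tL, of 1] unfolding D_def by blast
  let ?s = "min (s / 2) (1 / (c + 1))" and ?i = "max j (max i n)"
  have "\<exists>L\<in>\<L>. n < \<bar>L \<xi>\<bar>" if \<xi>: "\<xi> \<in> D" and d: "C_bound ?i (\<lambda>x. \<xi> x - ?\<theta> x) ?s" for \<xi>
  proof -
    have md: "(\<lambda>x. \<xi> x - ?\<theta> x) \<in> D" using \<xi> m\<theta> unfolding D_def by (rule test_functions_in_cball_closed(2))
    have "\<bar>L (\<lambda>x. \<xi> x - ?\<theta> x)\<bar> \<le> c * ?s" using c(2)[OF md C_bound_mono[OF d]] by simp
    also have "\<dots> \<le> c * (1 / (c + 1))" using c(1) by (intro mult_left_mono) auto
    also have "\<dots> \<le> 1" using c(1) by simp
    finally have "\<bar>L (\<lambda>x. \<xi> x - ?\<theta> x)\<bar> \<le> 1" .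
    moreover have "L \<xi> = L (\<lambda>x. \<xi> x - ?\<theta> x) + L ?\<theta>"
      using test_functional_add[OF tL, of "\<lambda>x. \<xi> x - ?\<theta> x" ?\<theta>] md m\<theta>
      unfolding D_def by (simp add: test_functions_in_subset)
    ultimately have "n < \<bar>L \<xi>\<bar>" using big by linarith
    then show ?thesis using L by blast
  qed
  moreover have "0 < ?s" using c(1) \<theta>(2) by simp
  ultimately show ?thesis
    using m\<theta> b by (intro bexI[of _ ?\<theta>] exI[of _ ?i] exI[of _ ?s] conjI) auto
qed

lemma C_bound_limit:
  fixes f :: "nat \<Rightarrow> 'a::euclidean_space \<Rightarrow> 'b::real_normed_vector"
  assumes "smooth g" "smooth h" "\<And>n. smooth (f n)"
    and lim: "\<And>vs x. (\<lambda>n. iter_deriv (f n) vs x) \<longlonglongrightarrow> iter_deriv g vs x"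
    and b: "\<And>n. N \<le> n \<Longrightarrow> C_bound i (\<lambda>x. f n x - h x) M"
  shows "C_bound i (\<lambda>x. g x - h x) M"
  unfolding C_bound_def
proof (intro allI impI)
  fix vs :: "'a list" and x assume vs: "length vs \<le> i" "\<forall>v\<in>set vs. norm v \<le> 1"
  have "norm (iter_deriv g vs x - iter_deriv h vs x) \<le> M"
  proof (rule Lim_norm_ubound[OF _ tendsto_diff[OF lim tendsto_const]])
    show "\<forall>\<^sub>F n in sequentially. norm (iter_deriv (f n) vs x - iter_deriv h vs x) \<le> M"
      using C_boundD[OF b vs, of _ x] assms(2,3)
      unfolding eventually_sequentially by (auto simp: iter_deriv_diff)
  qed simp
  then show "norm (iter_deriv (\<lambda>x. g x - h x) vs x) \<le> M"
    using assms(1,2) by (simp add: iter_deriv_diff)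
qed

text \<open>Completeness in the form needed for nested balls of radius \<open>S n\<close> in the norms of class
  \<open>I n\<close>: the limit lies in all of them.\<close>

lemma test_functions_complete:
  fixes \<Theta> :: "nat \<Rightarrow> 'a::euclidean_space \<Rightarrow> 'b::banach"
  assumes \<Theta>: "\<And>n. \<Theta> n \<in> test_functions_in (cball a r)"
    and I: "\<And>n. n \<le> I n" and S: "S \<longlonglongrightarrow> 0"
    and b: "\<And>n p. n \<le> p \<Longrightarrow> C_bound (I n) (\<lambda>x. \<Theta> p x - \<Theta> n x) (S n)"
  shows "\<exists>\<xi>\<in>test_functions_in (cball a r). \<forall>n. C_bound (I n) (\<lambda>x. \<xi> x - \<Theta> n x) (S n)"
proof -
  let ?\<xi> = "\<lambda>x. lim (\<lambda>n. \<Theta> n x)"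
  have sm: "smooth (\<Theta> n)" for n using \<Theta> by (auto simp: test_functions_in_cball_iff)
  have cauchy: "\<exists>N. \<forall>m\<ge>N. \<forall>n\<ge>N. \<forall>x\<in>ball 0 R. norm (iter_deriv (\<Theta> m) vs x - iter_deriv (\<Theta> n) vs x) \<le> e"
    if "0 < e" for vs R e
  proof -
    let ?p = "prod_list (map norm vs)"
    have "(\<lambda>n. ?p * S n + ?p * S n) \<longlonglongrightarrow> ?p * 0 + ?p * 0"
      by (intro tendsto_intros S)
    then have "\<forall>\<^sub>F n in sequentially. ?p * S n + ?p * S n < e"
      using \<open>0 < e\<close> by (intro order_tendstoD) auto
    then obtain N0 where N0: "\<And>n. N0 \<le> n \<Longrightarrow> ?p * S n + ?p * S n < e"
      unfolding eventually_sequentially by blast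
    let ?N = "max N0 (length vs)"
    have *: "norm (iter_deriv (\<Theta> m) vs x - iter_deriv (\<Theta> ?N) vs x) \<le> ?p * S ?N" if "?N \<le> m" for m x
    proof -
      have "length vs \<le> I ?N" using I[of ?N] by simp
      then have "norm (iter_deriv (\<lambda>x. \<Theta> m x - \<Theta> ?N x) vs x) \<le> ?p * S ?N"
        by (intro iter_deriv_norm_le smooth_diff sm C_boundD[OF b[OF that]]) auto
      then show ?thesis by (simp add: iter_deriv_diff[OF sm sm])
    qed
    show ?thesis
    proof (intro exI[of _ ?N] allI impI ballI)
      fix m n x assume mn: "?N \<le> m" "?N \<le> n"
      have "norm (iter_deriv (\<Theta> m) vs x - iter_deriv (\<Theta> n) vs x)
        \<le> norm (iter_deriv (\<Theta> m) vs x - iter_deriv (\<Theta> ?N) vs x) + norm (iter_deriv (\<Theta> n) vs x - iter_deriv (\<Theta> ?N) vs x)"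
        using norm_triangle_ineq4[of "iter_deriv (\<Theta> m) vs x - iter_deriv (\<Theta> ?N) vs x" "iter_deriv (\<Theta> n) vs x - iter_deriv (\<Theta> ?N) vs x"]
        by simp
      also have "\<dots> \<le> e" using *[OF mn(1), of x] *[OF mn(2), of x] N0[of ?N] by simp
      finally show "norm (iter_deriv (\<Theta> m) vs x - iter_deriv (\<Theta> n) vs x) \<le> e" .
    qed
  qed
  have lim: "(\<lambda>n. iter_deriv (\<Theta> n) vs x) \<longlonglongrightarrow> iter_deriv ?\<xi> vs x" for vs x
    using iter_deriv_limit[where k="length vs" and f=\<Theta>, OF sm cauchy] by simp
  have s\<xi>: "smooth ?\<xi>"
    unfolding smooth_def using of_class_limit[where f=\<Theta>, OF sm cauchy] by simp
  have "?\<xi> x = 0" if "x \<notin> cball a r" for x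
  proof -
    have "\<Theta> n x = 0" for n using \<Theta>[of n] that by (simp add: test_functions_in_cball_iff)
    then show ?thesis by simp
  qed
  then have "?\<xi> \<in> test_functions_in (cball a r)"
    using s\<xi> by (simp add: test_functions_in_cball_iff)
  moreover have "C_bound (I n) (\<lambda>x. ?\<xi> x - \<Theta> n x) (S n)" for n
    by (rule C_bound_limit[OF s\<xi> sm sm lim b])
  ultimately show ?thesis by (intro bexI[of _ ?\<xi>]) auto
qed

text \<open>Were the functionals unbounded with respect to every norm of class \<open>i\<close>, nested balls would
  close down on a test function at which they are unbounded, against the bound by \<open>\<nu>\<close>.\<close>

theorem uniform_boundedness_test_functions:
  fixes \<L> :: "(('a::euclidean_space \<Rightarrow> 'b::banach) \<Rightarrow> real) set"
  defines "D \<equiv> test_functions_in (cball 0 1)"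
  assumes \<L>: "\<And>L. L \<in> \<L> \<Longrightarrow> test_functional L"
    and pointwise: "\<And>L \<theta>. L \<in> \<L> \<Longrightarrow> \<theta> \<in> D \<Longrightarrow> \<bar>L \<theta>\<bar> \<le> \<nu> \<theta>"
  shows "\<exists>i C. 0 \<le> C \<and> (\<forall>L\<in>\<L>. \<forall>\<theta>\<in>D. \<forall>M. C_bound i \<theta> M \<longrightarrow> \<bar>L \<theta>\<bar> \<le> C * M)"
proof (rule ccontr)
  assume "\<not> ?thesis"
  then have unbounded: "\<exists>L\<in>\<L>. \<exists>\<theta>\<in>D. \<exists>M. C_bound i \<theta> M \<and> C * M < \<bar>L \<theta>\<bar>" if "0 \<le> C" for i C
    using that by (meson not_le)
  define V where "V = (\<lambda>(n::nat) (\<theta>, i, s). \<theta> \<in> D \<and> (0::real) < s \<and> n \<le> i + 1)"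
  define Q where "Q = (\<lambda>(n::nat) (\<theta>, i, s) (\<theta>', i', s'). i \<le> i' \<and> s' \<le> s / 2 \<and>
    C_bound i (\<lambda>x. \<theta>' x - \<theta> x) (s / 2) \<and>
    (\<forall>\<xi>\<in>D. C_bound i' (\<lambda>x. \<xi> x - \<theta>' x) s' \<longrightarrow> (\<exists>L\<in>\<L>. n < \<bar>L \<xi>\<bar>)))"
  \<comment> \<open>A state \<open>(\<theta>, i, s)\<close> is the ball of radius \<open>s\<close> about \<open>\<theta>\<close> in the norm of class \<open>i\<close>.\<close>
  have "\<exists>f. \<forall>n. V n (f n) \<and> Q n (f n) (f (Suc n))"
  proof (rule dependent_nat_choice)
    have "(\<lambda>_. 0) \<in> D" unfolding D_def by (simp add: test_functions_in_cball_iff)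
    then show "\<exists>x. V 0 x" unfolding V_def by (intro exI[of _ "(\<lambda>_. 0, 0, 1)"]) simp
    fix st n assume "V n st"
    obtain \<theta> i s where st: "st = (\<theta>, i, s)" by (cases st) auto
    have \<theta>: "\<theta> \<in> D" "0 < s" using \<open>V n st\<close> by (auto simp: st V_def)
    have "\<exists>\<theta>'\<in>D. \<exists>i'\<ge>max i n. \<exists>s'. 0 < s' \<and> s' \<le> s / 2 \<and> C_bound i (\<lambda>x. \<theta>' x - \<theta> x) (s / 2) \<and>
      (\<forall>\<xi>\<in>D. C_bound i' (\<lambda>x. \<xi> x - \<theta>' x) s' \<longrightarrow> (\<exists>L\<in>\<L>. n < \<bar>L \<xi>\<bar>))"
      by (rule uniform_boundedness_step[where \<nu>=\<nu> and D=D])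
        (fact D_def[THEN meta_eq_to_obj_eq] | fact \<L> | fact pointwise | fact unbounded | fact \<theta>)+
    then obtain \<theta>' i' s' where "\<theta>' \<in> D" "i' \<ge> max i n" "0 < s'" "s' \<le> s / 2" "C_bound i (\<lambda>x. \<theta>' x - \<theta> x) (s / 2)"
      "\<forall>\<xi>\<in>D. C_bound i' (\<lambda>x. \<xi> x - \<theta>' x) s' \<longrightarrow> (\<exists>L\<in>\<L>. n < \<bar>L \<xi>\<bar>)"
      by blast
    then show "\<exists>y. V (Suc n) y \<and> Q n st y"
      by (intro exI[of _ "(\<theta>', i', s')"]) (auto simp: V_def Q_def st)
  qed
  then obtain f where f: "\<And>n. V n (f n)" "\<And>n. Q n (f n) (f (Suc n))" by blast
  \<comment> \<open>The shift by one makes the class of the \<open>n\<close>-th ball at least \<open>n\<close>.\<close>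
  define \<Theta> I S where "\<Theta> n = fst (f (Suc n))" and "I n = fst (snd (f (Suc n)))" and "S n = snd (snd (f (Suc n)))" for n
  have fS: "f (Suc n) = (\<Theta> n, I n, S n)" for n by (simp add: \<Theta>_def I_def S_def)
  have \<Theta>: "\<Theta> n \<in> D" and S0: "0 < S n" and I: "n \<le> I n" for n
    using f(1)[of "Suc n"] by (auto simp: fS V_def)
  have I2: "I n \<le> I (Suc n)" and S2: "S (Suc n) \<le> S n / 2"
    and d: "C_bound (I n) (\<lambda>x. \<Theta> (Suc n) x - \<Theta> n x) (S n / 2)" for n
    using f(2)[of "Suc n"] by (auto simp: fS Q_def)
  have far: "\<exists>L\<in>\<L>. n < \<bar>L \<xi>\<bar>" if "\<xi> \<in> D" "C_bound (I n) (\<lambda>x. \<xi> x - \<Theta> n x) (S n)" for \<xi> n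
    using f(2)[of n] that by (cases "f n") (auto simp: fS Q_def)
  have sm: "smooth (\<Theta> n)" for n using \<Theta>[of n] by (simp add: D_def test_functions_in_cball_iff)
  have Im: "I n \<le> I (n + m)" for n m by (induction m) (auto intro: order_trans[OF _ I2])
  have Sm: "S (n + m) \<le> S n * (1/2) ^ m" for n m
  proof (induction m)
    case (Suc m)
    then show ?case using S2[of "n + m"] by simp
  qed simp
  have b: "C_bound (I n) (\<lambda>x. \<Theta> (n + m) x - \<Theta> n x) (S n * (1 - (1/2) ^ m))" for n m
  proof (induction m)
    case 0
    then show ?case by (simp add: C_bound_def iter_deriv_const)
  next
    case (Suc m)
    have "S (n + m) / 2 \<le> S n * (1/2) ^ Suc m" using Sm[of n m] by simp
    then have "C_bound (I n) (\<lambda>x. \<Theta> (Suc (n + m)) x - \<Theta> (n + m) x) (S n * (1/2) ^ Suc m)"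
      using C_bound_mono[OF d Im] by blast
    from C_bound_add[OF _ _ this Suc] show ?case
      by (simp add: smooth_diff sm algebra_simps)
  qed
  have b': "C_bound (I n) (\<lambda>x. \<Theta> p x - \<Theta> n x) (S n)" if "n \<le> p" for n p
  proof -
    have "S n * (1 - (1/2) ^ (p - n)) \<le> S n * 1" using S0[of n] by (intro mult_left_mono) auto
    then show ?thesis using C_bound_mono[OF b[of n "p - n"] order_refl] that by simp
  qed
  have "S \<longlonglongrightarrow> 0"
  proof (rule tendsto_sandwich[OF _ _ tendsto_const])
    show "(\<lambda>n. S 0 * (1/2) ^ n) \<longlonglongrightarrow> 0"
      by (intro tendsto_mult_right_zero LIMSEQ_power_zero) auto
    show "\<forall>\<^sub>F n in sequentially. S n \<le> S 0 * (1/2) ^ n" using Sm[of 0] by simp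
  qed (simp add: less_imp_le[OF S0])
  then obtain \<xi> where \<xi>: "\<xi> \<in> D" "\<And>n. C_bound (I n) (\<lambda>x. \<xi> x - \<Theta> n x) (S n)"
    using test_functions_complete[OF \<Theta>[unfolded D_def] I _ b'] unfolding D_def by blast
  obtain n :: nat where n: "\<nu> \<xi> < n" using reals_Archimedean2 by blast
  obtain L where "L \<in> \<L>" "real n < \<bar>L \<xi>\<bar>" using far[OF \<xi>] by blast
  then show False using pointwise[OF _ \<xi>(1)] n by fastforce
qed

section \<open>Pointwise differentiability and mollification\<close>

lemma test_functional_scaled_error:
  fixes T :: "('a::euclidean_space \<Rightarrow> 'b::real_normed_vector) \<Rightarrow> real"
  assumes T: "test_functional T" and P: "continuous_on UNIV P" and r: "0 < r"
  shows "test_functional (scaled_error T k a P r)"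
proof -
  let ?S = "\<lambda>\<theta>. T \<theta> - function_distribution P \<theta>"
  note S = test_functional_diff[OF T test_functional_continuous[OF P]]
  let ?t = "\<lambda>\<theta> x. \<theta> (inverse r *\<^sub>R (x - a))"
  have t: "?t \<theta> = (\<lambda>x. \<theta> (inverse r *\<^sub>R x + - inverse r *\<^sub>R a))" for \<theta> :: "'a \<Rightarrow> 'b"
    by (simp add: algebra_simps)
  have mem: "?t \<theta> \<in> test_functions_in (cball 0 (norm a + r * R))" if \<theta>: "\<theta> \<in> test_functions_in (cball 0 R)" for R and \<theta> :: "'a \<Rightarrow> 'b"
  proof -
    have "?t \<theta> x = 0" if x: "x \<notin> cball 0 (norm a + r * R)" for x
    proof -
      have "r * R < norm (x - a)" using x norm_triangle_sub[of x a] by simp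
      then have "R < norm (x - a) / r" using r by (simp add: pos_less_divide_eq mult.commute)
      then have "inverse r *\<^sub>R (x - a) \<notin> cball 0 R" using r by (simp add: divide_inverse mult.commute)
      then show ?thesis using \<theta> unfolding test_functions_in_cball_iff by blast
    qed
    moreover have "smooth (?t \<theta>)" unfolding t using \<theta> by (intro smooth_affine) (simp add: test_functions_in_cball_iff)
    ultimately show ?thesis by (simp add: test_functions_in_cball_iff)
  qed
  have mem': "?t \<theta> \<in> test_functions" if "\<theta> \<in> test_functions" for \<theta> :: "'a \<Rightarrow> 'b"
    using test_functionE[OF that] mem test_functions_in_subset by metis
  let ?c = "inverse (r ^ k) * inverse (r ^ DIM('a))"
  have eq: "scaled_error T k a P r \<theta> = ?c * ?S (?t \<theta>)" for \<theta>
    by (simp add: scaled_error_def rescale_def)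
  show ?thesis
    unfolding test_functional_def eq
  proof (intro conjI allI ballI)
    fix \<theta> \<phi> :: "'a \<Rightarrow> 'b" and c assume m: "\<theta> \<in> test_functions"
    show "?c * ?S (\<lambda>x. c *\<^sub>R \<theta> (inverse r *\<^sub>R (x - a))) = c * (?c * ?S (?t \<theta>))"
      using test_functional_scaleR[OF S mem'[OF m]] by simp
    assume m': "\<phi> \<in> test_functions"
    show "?c * ?S (\<lambda>x. \<theta> (inverse r *\<^sub>R (x - a)) + \<phi> (inverse r *\<^sub>R (x - a))) = ?c * ?S (?t \<theta>) + ?c * ?S (?t \<phi>)"
      using test_functional_add[OF S mem'[OF m] mem'[OF m']] by (simp add: distrib_left)
  next
    fix R
    obtain i C where C: "0 \<le> C" "\<And>\<theta> M. \<theta> \<in> test_functions_in (cball 0 (norm a + r * R)) \<Longrightarrow> C_bound i \<theta> M \<Longrightarrow> \<bar>?S \<theta>\<bar> \<le> C * M"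
      using test_functional_bound[OF S] by metis
    let ?m = "max 1 \<bar>inverse r\<bar> ^ i"
    have "\<bar>?c * ?S (?t \<theta>)\<bar> \<le> (?c * C * ?m) * M"
      if \<theta>: "\<theta> \<in> test_functions_in (cball 0 R)" and M: "C_bound i \<theta> M" for \<theta> M
    proof -
      have "C_bound i (?t \<theta>) (?m * M)"
        unfolding t by (rule C_bound_affine[OF test_functions_smooth[OF test_functions_in_subset[OF \<theta>]] M])
      then have "\<bar>?S (?t \<theta>)\<bar> \<le> C * (?m * M)" by (intro C(2) mem \<theta>)
      then have "?c * \<bar>?S (?t \<theta>)\<bar> \<le> ?c * (C * (?m * M))" using r by (intro mult_left_mono) auto
      then show ?thesis using r by (simp add: abs_mult mult.assoc)
    qed
    moreover have "0 \<le> ?c * C * ?m" using r C(1) by simp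
    ultimately show "\<exists>i C. 0 \<le> C \<and> (\<forall>\<theta>\<in>test_functions_in (cball 0 R). \<forall>M. C_bound i \<theta> M \<longrightarrow> \<bar>?c * ?S (?t \<theta>)\<bar> \<le> C * M)"
      by blast
  qed
qed

text \<open>Homogeneity turns the bound on the unit ball of \<open>\<nu>\<close> into a bound by \<open>e \<nu>\<close>. For \<open>\<nu> \<theta> = 0\<close> it says
  that the error vanishes, which follows from \<open>|E \<theta>| \<le> e t\<close> for all \<open>t > \<nu> \<theta>\<close>.\<close>

lemma scaled_error_seminorm_bound:
  fixes T :: "('a::euclidean_space \<Rightarrow> 'b::real_normed_vector) \<Rightarrow> real"
  assumes T: "test_functional T" and P: "continuous_on UNIV P" and \<nu>: "seminorm_on_test (cball 0 1) \<nu>"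
    and lim: "((\<lambda>r. SUP \<theta> \<in> {\<theta> \<in> test_functions_in (cball 0 1). \<nu> \<theta> \<le> 1}. ereal (scaled_error T k a P r \<theta>)) \<longlongrightarrow> 0) (at_right 0)"
    and e: "0 < e"
  shows "\<exists>\<delta>>0. \<forall>r. 0 < r \<and> r < \<delta> \<longrightarrow> (\<forall>\<theta>\<in>test_functions_in (cball 0 1). \<bar>scaled_error T k a P r \<theta>\<bar> \<le> e * \<nu> \<theta>)"
proof -
  let ?D = "test_functions_in (cball 0 1) :: ('a \<Rightarrow> 'b) set" and ?E = "scaled_error T k a P"
  have "\<forall>\<^sub>F r in at_right 0. (SUP \<theta> \<in> {\<theta> \<in> ?D. \<nu> \<theta> \<le> 1}. ereal (?E r \<theta>)) < ereal e"
    by (rule order_tendstoD(2)[OF lim]) (use e in simp)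
  then obtain \<delta> where \<delta>: "0 < \<delta>" "\<And>r. 0 < r \<Longrightarrow> r < \<delta> \<Longrightarrow> (SUP \<theta> \<in> {\<theta> \<in> ?D. \<nu> \<theta> \<le> 1}. ereal (?E r \<theta>)) < ereal e"
    unfolding eventually_at_right_field by blast
  have "\<bar>?E r \<theta>\<bar> \<le> e * \<nu> \<theta>" if r: "0 < r" "r < \<delta>" and \<theta>: "\<theta> \<in> ?D" for r \<theta>
  proof -
    note E = test_functional_scaled_error[OF T P r(1), of k a]
    have small: "?E r \<phi> \<le> e" if "\<phi> \<in> ?D" "\<nu> \<phi> \<le> 1" for \<phi>
    proof -
      have "ereal (?E r \<phi>) \<le> (SUP \<theta> \<in> {\<theta> \<in> ?D. \<nu> \<theta> \<le> 1}. ereal (?E r \<theta>))"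
        by (rule SUP_upper) (use that in simp)
      then have "ereal (?E r \<phi>) < ereal e" using \<delta>(2)[OF r] by (rule le_less_trans)
      then show ?thesis by simp
    qed
    have \<nu>s: "\<nu> (\<lambda>x. c *\<^sub>R \<theta> x) = \<bar>c\<bar> * \<nu> \<theta>" and \<nu>0: "0 \<le> \<nu> \<theta>" for c
      using \<nu> \<theta> by (auto simp: seminorm_on_test_def)
    have *: "\<bar>?E r \<theta>\<bar> \<le> e * t" if t: "\<nu> \<theta> < t" for t
    proof -
      have t0: "0 < t" using t \<nu>0 by simp
      then have t1: "inverse t * \<nu> \<theta> \<le> 1" using t by (simp add: field_simps)
      have "c * ?E r \<theta> \<le> e" if "\<bar>c\<bar> = inverse t" for c
      proof -
        have "?E r (\<lambda>x. c *\<^sub>R \<theta> x) \<le> e"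
          by (intro small test_functions_in_cball_closed(3) \<theta>) (simp add: \<nu>s that t1)
        then show ?thesis using test_functional_scaleR[OF E test_functions_in_subset[OF \<theta>]] by simp
      qed
      from this[of "inverse t"] this[of "- inverse t"] show ?thesis using t0 by (simp add: field_simps abs_le_iff)
    qed
    have "\<bar>?E r \<theta>\<bar> \<le> e * \<nu> \<theta> + d" if "0 < d" for d
    proof -
      have "\<bar>?E r \<theta>\<bar> \<le> e * (\<nu> \<theta> + d / e)" by (rule *) (use that e in simp)
      then show ?thesis using e by (simp add: distrib_left)
    qed
    then show ?thesis by (rule field_le_epsilon)
  qed
  then show ?thesis using \<delta>(1) by blast
qed

text \<open>The functionals \<open>e\<^sup>-\<^sup>1 r\<^sup>-\<^sup>k (T - P)\<^sup>a\<^sup>,\<^sup>r\<close> with \<open>r\<close> small all lie in the one family of continuous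
  functionals dominated by \<open>\<nu>\<close>. Hence \<open>i\<close> and \<open>C\<close> depend only on \<open>\<nu>\<close>, and only the
  threshold \<open>\<delta>\<close> varies with the point.\<close>

lemma scaled_error_uniform_bound:
  fixes T :: "('a::euclidean_space \<Rightarrow> 'b::banach) \<Rightarrow> real"
  assumes T: "test_functional T" and \<nu>: "seminorm_on_test (cball 0 1) \<nu>"
  shows "\<exists>i C. 0 \<le> C \<and> (\<forall>k a P e. continuous_on UNIV P \<longrightarrow>
    ((\<lambda>r. SUP \<theta> \<in> {\<theta> \<in> test_functions_in (cball 0 1). \<nu> \<theta> \<le> 1}. ereal (scaled_error T k a P r \<theta>)) \<longlongrightarrow> 0) (at_right 0) \<longrightarrow>
    0 < e \<longrightarrow> (\<exists>\<delta>>0. \<forall>r. 0 < r \<and> r < \<delta> \<longrightarrow> (\<forall>\<theta>\<in>test_functions_in (cball 0 1). \<forall>M. C_bound i \<theta> M \<longrightarrow>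
      \<bar>scaled_error T k a P r \<theta>\<bar> \<le> e * (C * M))))"
proof -
  let ?D = "test_functions_in (cball 0 1) :: ('a \<Rightarrow> 'b) set"
  let ?L = "{L. test_functional L \<and> (\<forall>\<theta>\<in>?D. \<bar>L \<theta>\<bar> \<le> \<nu> \<theta>)}"
  have "\<exists>i C. 0 \<le> C \<and> (\<forall>L\<in>?L. \<forall>\<theta>\<in>?D. \<forall>M. C_bound i \<theta> M \<longrightarrow> \<bar>L \<theta>\<bar> \<le> C * M)"
    by (rule uniform_boundedness_test_functions[where \<nu>=\<nu>]) simp_all
  then obtain i C where C0: "0 \<le> C" and C1: "\<forall>L\<in>?L. \<forall>\<theta>\<in>?D. \<forall>M. C_bound i \<theta> M \<longrightarrow> \<bar>L \<theta>\<bar> \<le> C * M"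
    by (elim exE conjE)
  note C = C0 C1[rule_format]
  have "\<exists>\<delta>>0. \<forall>r. 0 < r \<and> r < \<delta> \<longrightarrow> (\<forall>\<theta>\<in>?D. \<forall>M. C_bound i \<theta> M \<longrightarrow> \<bar>scaled_error T k a P r \<theta>\<bar> \<le> e * (C * M))"
    if P: "continuous_on UNIV P" and lim: "((\<lambda>r. SUP \<theta> \<in> {\<theta> \<in> ?D. \<nu> \<theta> \<le> 1}. ereal (scaled_error T k a P r \<theta>)) \<longlongrightarrow> 0) (at_right 0)"
      and e: "0 < e" for k a P e
  proof -
    obtain \<delta> where \<delta>: "0 < \<delta>" "\<And>r \<theta>. 0 < r \<Longrightarrow> r < \<delta> \<Longrightarrow> \<theta> \<in> ?D \<Longrightarrow> \<bar>scaled_error T k a P r \<theta>\<bar> \<le> e * \<nu> \<theta>"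
      using scaled_error_seminorm_bound[OF T P \<nu> lim e] by blast
    have "\<bar>scaled_error T k a P r \<theta>\<bar> \<le> e * (C * M)" if r: "0 < r" "r < \<delta>" and \<theta>: "\<theta> \<in> ?D" and M: "C_bound i \<theta> M" for r \<theta> M
    proof -
      let ?E = "\<lambda>\<theta>. inverse e * scaled_error T k a P r \<theta>"
      note E = test_functional_scaled_error[OF T P r(1), of k a]
      have "test_functional ?E"
        unfolding test_functional_def
      proof (intro conjI allI ballI)
        fix R
        obtain j c where c: "0 \<le> c" "\<And>\<theta> M. \<theta> \<in> test_functions_in (cball 0 R) \<Longrightarrow> C_bound j \<theta> M \<Longrightarrow> \<bar>scaled_error T k a P r \<theta>\<bar> \<le> c * M"
          using test_functional_bound[OF E] by metis
        have "\<bar>?E \<theta>\<bar> \<le> (inverse e * c) * M"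
          if "\<theta> \<in> test_functions_in (cball 0 R)" "C_bound j \<theta> M" for \<theta> M
        proof -
          have "\<bar>?E \<theta>\<bar> = inverse e * \<bar>scaled_error T k a P r \<theta>\<bar>" using e by (simp add: abs_mult)
          also have "\<dots> \<le> inverse e * (c * M)" using c(2)[OF that] e by (intro mult_left_mono) auto
          finally show ?thesis by simp
        qed
        moreover have "0 \<le> inverse e * c" using e c(1) by simp
        ultimately show "\<exists>i C. 0 \<le> C \<and> (\<forall>\<theta>\<in>test_functions_in (cball 0 R). \<forall>M. C_bound i \<theta> M \<longrightarrow> \<bar>?E \<theta>\<bar> \<le> C * M)"
          by blast
      qed (simp_all add: test_functional_add[OF E] test_functional_scaleR[OF E] distrib_left)
      moreover have "\<bar>?E \<phi>\<bar> \<le> \<nu> \<phi>" if "\<phi> \<in> ?D" for \<phi>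
        using \<delta>(2)[OF r that] e by (simp add: abs_mult field_simps)
      ultimately have "\<bar>?E \<theta>\<bar> \<le> C * M" by (intro C(2) \<theta> M) auto
      then show ?thesis using e by (simp add: abs_mult field_simps)
    qed
    then show ?thesis using \<delta>(1) by blast
  qed
  then show ?thesis using C(1) by (intro exI[of _ i] exI[of _ C]) blast
qed

lemma mollified_error_test_function:
  fixes \<phi> :: "'a::euclidean_space \<Rightarrow> real" and y :: "'b::real_normed_vector"
  assumes \<phi>: "\<phi> \<in> test_functions_in (cball 0 1)" and r: "0 < r" and x: "dist a x \<le> 7 * r"
  shows "(\<lambda>w. iter_deriv \<phi> vs (8 *\<^sub>R w + inverse r *\<^sub>R (a - x)) *\<^sub>R y) \<in> test_functions_in (cball 0 1)"
proof -
  have s: "smooth \<phi>" using \<phi> by (simp add: test_functions_in_cball_iff)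
  have "iter_deriv \<phi> vs (8 *\<^sub>R w + inverse r *\<^sub>R (a - x)) = 0" if "w \<notin> cball 0 1" for w
  proof -
    have "norm (inverse r *\<^sub>R (a - x)) \<le> 7"
      using x r by (simp only: norm_scaleR dist_norm) (simp add: field_simps)
    moreover have "8 < norm (8 *\<^sub>R w)" using that by simp
    ultimately have "1 < norm (8 *\<^sub>R w + inverse r *\<^sub>R (a - x))"
      using norm_diff_ineq[of "8 *\<^sub>R w" "inverse r *\<^sub>R (a - x)"] by linarith
    then show ?thesis
      using iter_deriv_test_functions_in_cball[OF \<phi>, of vs] by (simp add: test_functions_in_cball_iff)
  qed
  moreover have "smooth (\<lambda>w. iter_deriv \<phi> vs (8 *\<^sub>R w + inverse r *\<^sub>R (a - x)) *\<^sub>R y)"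
    by (intro smooth_scaleR_left smooth_affine smooth_iter_deriv s)
  ultimately show ?thesis by (simp add: test_functions_in_cball_iff)
qed

text \<open>The test functions \<open>\<theta>\<close> in \<open>iter_deriv_mollify_error\<close> are translated derivatives of \<open>\<phi>\<close>, multiplied
  by \<open>y\<close>. Their norms of class \<open>i\<close> are at most a constant times \<open>|y|\<close>, so the estimate holds in the norm
  of the dual and uniformly in \<open>x\<close>.\<close>

lemma mollification_rate:
  fixes T :: "('a::euclidean_space \<Rightarrow> 'b::real_normed_vector) \<Rightarrow> real"
  assumes T: "test_functional T" and P: "poly_fun k P" and C: "0 \<le> C"
    and \<phi>: "\<phi> \<in> test_functions_in (cball 0 1)"
    and repr: "\<And>q. poly_fun k q \<Longrightarrow> (LINT x|lborel. \<phi> x * q x) = q 0"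
    and err: "\<And>e. 0 < e \<Longrightarrow> \<exists>\<delta>>0. \<forall>r. 0 < r \<and> r < \<delta> \<longrightarrow> (\<forall>\<theta>\<in>test_functions_in (cball 0 1). \<forall>M. C_bound i \<theta> M \<longrightarrow>
      \<bar>scaled_error T k a P r \<theta>\<bar> \<le> e * (C * M))"
    and e: "0 < e"
  shows "\<exists>l. \<forall>j\<ge>l. \<forall>x. dist a x \<le> 7 * (1/2) ^ j \<longrightarrow> (\<forall>vs. length vs \<le> k \<longrightarrow> (\<forall>v\<in>set vs. norm v \<le> 1) \<longrightarrow>
    norm (iter_deriv (mollify T (dilate ((1/2) ^ j) \<phi>)) vs x - iter_deriv P vs x) \<le> e * ((1/2) ^ j) ^ (k - length vs))"
proof -
  have s: "smooth \<phi>" using \<phi> by (simp add: test_functions_in_cball_iff)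
  obtain M where M: "0 \<le> M" "C_bound (i + k) \<phi> M" using C_bound_test_function[OF test_functions_in_subset[OF \<phi>]] by blast
  let ?c = "8 ^ (DIM('a) + k) * (C * (8 ^ i * M))" and ?n = "8 ^ (DIM('a) + k) :: real"
  have c: "0 \<le> ?c" using C M(1) by simp
  let ?e = "e / (?c + 1)"
  have e': "0 < ?e" using e c by simp
  obtain \<delta> where \<delta>: "0 < \<delta>" "\<And>r \<theta> M. 0 < r \<Longrightarrow> r < \<delta> \<Longrightarrow> \<theta> \<in> test_functions_in (cball 0 1) \<Longrightarrow> C_bound i \<theta> M \<Longrightarrow>
      \<bar>scaled_error T k a P r \<theta>\<bar> \<le> ?e * (C * M)"
    using err[OF e'] by blast
  obtain l where l: "(1/2::real) ^ l < \<delta> / 8"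
    using real_arch_pow_inv[of "\<delta> / 8" "1/2"] \<delta>(1) by auto
  show ?thesis
  proof (intro exI[of _ l] allI impI)
    fix j x and vs :: "'a list"
    assume j: "l \<le> j" and x: "dist a x \<le> 7 * (1/2) ^ j" and vs: "length vs \<le> k" "\<forall>v\<in>set vs. norm v \<le> 1"
    let ?r = "(1/2::real) ^ j"
    have r: "0 < ?r" by simp
    have r\<delta>: "8 * ?r < \<delta>" using power_decreasing[OF j, of "1/2::real"] l by linarith
    show "norm (iter_deriv (mollify T (dilate ?r \<phi>)) vs x - iter_deriv P vs x) \<le> e * ?r ^ (k - length vs)"
    proof (rule norm_blinfun_bound)
      fix y :: 'b
      let ?\<theta> = "\<lambda>w. iter_deriv \<phi> vs (8 *\<^sub>R w + inverse ?r *\<^sub>R (a - x)) *\<^sub>R y"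
      have "C_bound i (iter_deriv \<phi> vs) M"
        unfolding C_bound_def
      proof (intro allI impI)
        fix us :: "'a list" and x assume "length us \<le> i" "\<forall>v\<in>set us. norm v \<le> 1"
        then show "norm (iter_deriv (iter_deriv \<phi> vs) us x) \<le> M"
          unfolding iter_deriv_append[symmetric] using vs by (intro C_boundD[OF M(2)]) auto
      qed
      from C_bound_affine[OF smooth_iter_deriv[OF s] this, of 8 "inverse ?r *\<^sub>R (a - x)"]
      have "C_bound i (\<lambda>w. iter_deriv \<phi> vs (8 *\<^sub>R w + inverse ?r *\<^sub>R (a - x))) (8 ^ i * M)" by simp
      then have "C_bound i ?\<theta> ((8 ^ i * M) * norm y)"
        by (rule C_bound_scaleR_left[OF smooth_affine[OF smooth_iter_deriv[OF s]]])
      then have b: "\<bar>scaled_error T k a P (8 * ?r) ?\<theta>\<bar> \<le> ?e * (C * ((8 ^ i * M) * norm y))"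
        using r r\<delta> by (intro \<delta>(2) mollified_error_test_function[OF \<phi> r x]) auto
      have eq: "blinfun_apply (iter_deriv (mollify T (dilate ?r \<phi>)) vs x - iter_deriv P vs x) y
        = (- 1) ^ length vs * ?n * ?r ^ (k - length vs) * scaled_error T k a P (8 * ?r) ?\<theta>"
        by (rule iter_deriv_mollify_error[OF T P r \<phi> repr vs(1) refl])
      have "norm (blinfun_apply (iter_deriv (mollify T (dilate ?r \<phi>)) vs x - iter_deriv P vs x) y)
        = ?n * ?r ^ (k - length vs) * \<bar>scaled_error T k a P (8 * ?r) ?\<theta>\<bar>"
        unfolding eq by (simp add: abs_mult power_abs)
      also have "\<dots> \<le> ?n * ?r ^ (k - length vs) * (?e * (C * ((8 ^ i * M) * norm y)))"
        by (intro mult_left_mono b) auto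
      also have "\<dots> = (?c * ?e) * (?r ^ (k - length vs) * norm y)" by (simp add: mult_ac)
      also have "\<dots> \<le> e * (?r ^ (k - length vs) * norm y)"
      proof (rule mult_right_mono)
        have "?c * ?e \<le> (?c + 1) * ?e" using e' by (intro mult_right_mono) auto
        also have "\<dots> = e" using c by simp
        finally show "?c * ?e \<le> e" .
      qed auto
      finally show "norm (blinfun_apply (iter_deriv (mollify T (dilate ?r \<phi>)) vs x - iter_deriv P vs x) y)
        \<le> e * ?r ^ (k - length vs) * norm y" by (simp add: mult.assoc)
    qed (use e in simp)
  qed
qed

text \<open>At \<open>x = a\<close> the test function \<open>\<theta>\<close> does not depend on the scale, so convergence of the error on
  each single test function is enough.\<close>

lemma pt_approximation_jet_limit:
  fixes T :: "('a::euclidean_space \<Rightarrow> 'b::real_normed_vector) \<Rightarrow> real"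
  assumes T: "test_functional T" and P: "pt_approximation T k a P"
    and \<phi>: "\<phi> \<in> test_functions_in (cball 0 1)"
    and repr: "\<And>q. poly_fun k q \<Longrightarrow> (LINT x|lborel. \<phi> x * q x) = q 0"
    and vs: "length vs \<le> k"
  shows "(\<lambda>j. blinfun_apply (iter_deriv (mollify T (dilate ((1/2) ^ j) \<phi>)) vs a) y) \<longlonglongrightarrow> iter_deriv P vs a y"
proof -
  let ?\<theta> = "\<lambda>w. iter_deriv \<phi> vs (8 *\<^sub>R w) *\<^sub>R y" and ?r = "\<lambda>j. (1/2::real) ^ j"
  have Pk: "poly_fun k P" using P by (simp add: pt_approximation_def polynomial_imp_poly_fun)
  have \<theta>: "?\<theta> \<in> test_functions_in (cball 0 1)"
    using mollified_error_test_function[OF \<phi> zero_less_one, of 0 0 vs y] by simp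
  have lim: "((\<lambda>r. scaled_error T k a P r ?\<theta>) \<longlongrightarrow> 0) (at_right 0)"
    using P \<theta> by (simp add: pt_approximation_def)
  have r0: "filterlim (\<lambda>j. 8 * ?r j) (at_right 0) sequentially"
    unfolding filterlim_at
  proof (intro conjI)
    show "(\<lambda>j. 8 * ?r j) \<longlonglongrightarrow> 0" by (intro tendsto_mult_right_zero LIMSEQ_power_zero) auto
  qed auto
  have *: "blinfun_apply (iter_deriv (mollify T (dilate (?r j) \<phi>)) vs a) y - iter_deriv P vs a y
      = (- 1) ^ length vs * 8 ^ (DIM('a) + k) * ?r j ^ (k - length vs) * scaled_error T k a P (8 * ?r j) ?\<theta>" for j
    using iter_deriv_mollify_error[OF T Pk _ \<phi> repr vs refl, where r="?r j" and a=a and x=a and y=y] by (simp add: blinfun.diff_left)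
  have "(\<lambda>j. blinfun_apply (iter_deriv (mollify T (dilate (?r j) \<phi>)) vs a) y - iter_deriv P vs a y) \<longlonglongrightarrow> 0"
  proof (rule Lim_null_comparison)
    show "\<forall>\<^sub>F j in sequentially. norm (blinfun_apply (iter_deriv (mollify T (dilate (?r j) \<phi>)) vs a) y - iter_deriv P vs a y)
      \<le> 8 ^ (DIM('a) + k) * \<bar>scaled_error T k a P (8 * ?r j) ?\<theta>\<bar>"
    proof (intro always_eventually allI)
      fix j
      have "?r j ^ (k - length vs) \<le> 1" by (intro power_le_one) (auto simp: power_le_one)
      then have "?r j ^ (k - length vs) * \<bar>scaled_error T k a P (8 * ?r j) ?\<theta>\<bar> \<le> 1 * \<bar>scaled_error T k a P (8 * ?r j) ?\<theta>\<bar>"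
        by (intro mult_right_mono) auto
      then show "norm (blinfun_apply (iter_deriv (mollify T (dilate (?r j) \<phi>)) vs a) y - iter_deriv P vs a y)
        \<le> 8 ^ (DIM('a) + k) * \<bar>scaled_error T k a P (8 * ?r j) ?\<theta>\<bar>"
        unfolding * by (simp add: abs_mult power_abs mult.assoc)
    qed
    show "(\<lambda>j. 8 ^ (DIM('a) + k) * \<bar>scaled_error T k a P (8 * ?r j) ?\<theta>\<bar>) \<longlonglongrightarrow> 0"
      by (intro tendsto_mult_right_zero tendsto_rabs_zero filterlim_compose[OF lim r0])
  qed
  then show ?thesis by (simp add: LIM_zero_iff)
qed

lemma pt_approximation_unique:
  fixes T :: "('a::euclidean_space \<Rightarrow> 'b::real_normed_vector) \<Rightarrow> real"
  assumes T: "test_functional T" and P: "pt_approximation T k a P" and Q: "pt_approximation T k a Q"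
  shows "P = Q"
proof -
  obtain \<phi> :: "'a \<Rightarrow> real" where "smooth \<phi>" "\<forall>x. x \<notin> cball 0 1 \<longrightarrow> \<phi> x = 0"
    "\<And>q. poly_fun k q \<Longrightarrow> (LINT x|lborel. \<phi> x * q x) = q 0"
    using reproducing_kernel_exists[of k] by blast
  then have \<phi>: "\<phi> \<in> test_functions_in (cball 0 1)" "\<And>q. poly_fun k q \<Longrightarrow> (LINT x|lborel. \<phi> x * q x) = q 0"
    by (auto simp: test_functions_in_cball_iff)
  have pP: "poly_fun k P" and pQ: "poly_fun k Q"
    using P Q by (auto simp: pt_approximation_def polynomial_imp_poly_fun)
  have "P x - Q x = 0" for x
  proof (rule poly_fun_eq_0[OF poly_fun_diff[OF pP pQ]])
    fix vs :: "'a list" assume "length vs \<le> k"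
    then have "iter_deriv P vs a y = iter_deriv Q vs a y" for y
      using LIMSEQ_unique[OF pt_approximation_jet_limit[OF T P \<phi>] pt_approximation_jet_limit[OF T Q \<phi>]] by blast
    then show "iter_deriv (\<lambda>x. P x - Q x) vs a = 0"
      by (simp add: iter_deriv_diff[OF poly_fun_smooth[OF pP] poly_fun_smooth[OF pQ]] blinfun_eqI)
  qed
  then show ?thesis by auto
qed

section \<open>Gluing\<close>

text \<open>The indicator function of \<open>B\<close>, mollified at unit scale. The derivatives fall on the bump, so
  that their bounds do not depend on \<open>B\<close>.\<close>

lemma unit_cutoff_exists:
  fixes k :: nat
  shows "\<exists>K\<ge>0. \<forall>B \<in> sets lborel. \<exists>\<eta> :: 'a::euclidean_space \<Rightarrow> real. smooth \<eta> \<and>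
    (\<forall>x. cball x 1 \<subseteq> B \<longrightarrow> \<eta> x = 1) \<and> (\<forall>x. cball x 1 \<inter> B = {} \<longrightarrow> \<eta> x = 0) \<and> C_bound k \<eta> K"
proof -
  obtain \<rho> :: "'a \<Rightarrow> real" where \<rho>: "smooth \<rho>" "\<forall>x. x \<notin> cball 0 1 \<longrightarrow> \<rho> x = 0" "(LINT x|lborel. \<rho> x) = 1"
    using bump_exists by blast
  have t\<rho>: "\<rho> \<in> test_functions_in (cball 0 1)" using \<rho> by (simp add: test_functions_in_cball_iff)
  note t\<rho>' = test_functions_in_subset[OF t\<rho>]
  obtain M where M: "0 \<le> M" "C_bound k \<rho> M" using C_bound_test_function[OF t\<rho>'] by blast
  let ?K = "M * measure lborel (cball (0::'a) 1)"
  have "\<exists>\<eta> :: 'a \<Rightarrow> real. smooth \<eta> \<and> (\<forall>x. cball x 1 \<subseteq> B \<longrightarrow> \<eta> x = 1) \<and> (\<forall>x. cball x 1 \<inter> B = {} \<longrightarrow> \<eta> x = 0) \<and>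
    C_bound k \<eta> ?K" if B: "B \<in> sets lborel" for B
  proof -
    define P :: "'a \<Rightarrow> real \<Rightarrow>\<^sub>L real" where "P x = indicator B x *\<^sub>R id_blinfun" for x
    have P: "P x y = indicator B x * y" for x y by (simp add: P_def blinfun.scaleR_left)
    have int\<theta>: "integrable lborel \<theta>" if t: "\<theta> \<in> test_functions" for \<theta> :: "'a \<Rightarrow> real"
    proof -
      obtain r where "\<theta> \<in> test_functions_in (cball 0 r)" by (rule test_functionE[OF t])
      then show ?thesis
        by (intro integrable_compact_support[of _ 0 r] smooth_continuous_on) (auto simp: test_functions_in_cball_iff)
    qed
    have int: "integrable lborel (\<lambda>x. P x (\<theta> x))" if "\<theta> \<in> test_functions" for \<theta>
      unfolding P using integrable_mult_indicator[OF B int\<theta>[OF that]] by simp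
    have T: "test_functional (function_distribution P)"
    proof (rule test_functional_function_distribution[OF int])
      fix r
      have "norm (P x) \<le> 1" for x
        by (rule norm_blinfun_bound) (auto simp: P abs_mult indicator_def)
      then show "\<exists>c. \<forall>x\<in>cball 0 r. norm (P x) \<le> c" by blast
    qed
    define \<eta> where "\<eta> x = mollify (function_distribution P) \<rho> x 1" for x
    have eval: "mollify (function_distribution P) \<psi> x 1 = (LINT z|lborel. indicator B z * \<psi> (z - x))"
      if "\<psi> \<in> test_functions" for \<psi> x
      by (simp add: mollify_apply[OF T that] function_distribution_def P)
    have s: "smooth \<eta>"
      unfolding \<eta>_def by (rule smooth_bounded_linear[OF blinfun.bounded_linear_left smooth_mollify[OF T t\<rho>']])
    have "\<eta> x = 1" if "cball x 1 \<subseteq> B" for x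
    proof -
      have "indicator B z * \<rho> (z - x) = \<rho> (1 *\<^sub>R z + - x)" for z
        using that \<rho>(2) by (cases "z \<in> cball x 1") (auto simp: dist_norm norm_minus_commute)
      then have "\<eta> x = (LINT z|lborel. \<rho> (1 *\<^sub>R z + - x))"
        unfolding \<eta>_def eval[OF t\<rho>'] by metis
      also have "\<dots> = 1"
        using lborel_integral_affine[of \<rho> 1 "- x"] \<rho>(3)
          borel_measurable_continuous_onI[OF smooth_continuous_on[OF \<rho>(1)]] by simp
      finally show ?thesis .
    qed
    moreover have "\<eta> x = 0" if "cball x 1 \<inter> B = {}" for x
    proof -
      have z0: "indicator B z * \<rho> (z - x) = 0" for z
      proof (cases "z \<in> cball x 1")
        case True
        then have "z \<notin> B" using that by blast
        then show ?thesis by simp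
      next
        case False
        then show ?thesis using \<rho>(2) by (simp add: dist_norm norm_minus_commute)
      qed
      show ?thesis unfolding \<eta>_def eval[OF t\<rho>'] z0 by simp
    qed
    moreover have "C_bound k \<eta> ?K"
      unfolding C_bound_def
    proof (intro allI impI)
      fix vs :: "'a list" and x assume vs: "length vs \<le> k" "\<forall>v\<in>set vs. norm v \<le> 1"
      let ?\<psi> = "\<lambda>z. (- 1) ^ length vs *\<^sub>R iter_deriv \<rho> vs z"
      have t\<psi>: "?\<psi> \<in> test_functions_in (cball 0 1)"
        by (intro test_functions_in_cball_closed(3) iter_deriv_test_functions_in_cball t\<rho>)
      note t\<psi>' = test_functions_in_subset[OF t\<psi>]
      have "iter_deriv \<eta> vs x = mollify (function_distribution P) ?\<psi> x 1"
        unfolding \<eta>_def iter_deriv_bounded_linear[OF blinfun.bounded_linear_left smooth_mollify[OF T t\<rho>']]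
          iter_deriv_mollify[OF T t\<rho>'] ..
      then have eq: "iter_deriv \<eta> vs x = (LINT z|lborel. indicator B z * ?\<psi> (z - x))"
        unfolding eval[OF t\<psi>'] .
      have t: "(\<lambda>z. ?\<psi> (z - x)) \<in> test_functions"
        by (rule test_functions_in_subset[OF test_functions_in_cball_translate[OF t\<psi>]])
      have "norm (iter_deriv \<eta> vs x) \<le> (LINT z|lborel. norm (indicator B z * ?\<psi> (z - x)))"
        unfolding eq by (rule integral_norm_bound)
      also have "\<dots> \<le> (LINT z|lborel. M * indicator (cball x 1) z)"
      proof (rule integral_mono)
        show "integrable lborel (\<lambda>z. norm (indicator B z * ?\<psi> (z - x)))"
          using integrable_norm[OF int[OF t]] unfolding P .
        show "integrable lborel (\<lambda>z. M * indicator (cball x 1) z)"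
          by (intro integrable_mult_right integrable_real_indicator emeasure_lborel_cball_finite) auto
        fix z
        show "norm (indicator B z * ?\<psi> (z - x)) \<le> M * indicator (cball x 1) z"
        proof (cases "z \<in> cball x 1")
          case True
          have "norm (?\<psi> (z - x)) \<le> M" using C_boundD[OF M(2) vs, of "z - x"] by (simp add: abs_mult power_abs)
          then show ?thesis using True M(1) by (auto simp: indicator_def)
        next
          case False
          then have "z - x \<notin> cball 0 1" by (simp add: dist_norm norm_minus_commute)
          then have "?\<psi> (z - x) = 0" using t\<psi> unfolding test_functions_in_cball_iff by blast
          then show ?thesis using M(1) by simp
        qed
      qed
      also have "\<dots> = M * measure lborel (cball x 1)" by simp
      also have "measure lborel (cball x 1) = measure lborel (cball (0::'a) 1)"
        by (simp add: content_cball)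
      finally show "norm (iter_deriv \<eta> vs x) \<le> ?K" .
    qed
    ultimately show ?thesis using s by blast
  qed
  then show ?thesis using M(1) by (intro exI[of _ ?K] conjI) auto
qed

lemma cutoff_exists:
  fixes k :: nat
  shows "\<exists>K\<ge>0. \<forall>B r. open B \<longrightarrow> 0 < r \<longrightarrow> (\<exists>\<eta> :: 'a::euclidean_space \<Rightarrow> real. smooth \<eta> \<and>
    (\<forall>x. cball x r \<subseteq> B \<longrightarrow> \<eta> x = 1) \<and> (\<forall>x. cball x r \<inter> B = {} \<longrightarrow> \<eta> x = 0) \<and>
    (\<forall>vs x. length vs \<le> k \<longrightarrow> (\<forall>v\<in>set vs. norm v \<le> 1) \<longrightarrow> norm (iter_deriv \<eta> vs x) \<le> K * inverse r ^ length vs))"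
proof -
  obtain K where K: "0 \<le> K" "\<And>B. B \<in> sets lborel \<Longrightarrow> \<exists>\<eta> :: 'a \<Rightarrow> real. smooth \<eta> \<and>
    (\<forall>x. cball x 1 \<subseteq> B \<longrightarrow> \<eta> x = 1) \<and> (\<forall>x. cball x 1 \<inter> B = {} \<longrightarrow> \<eta> x = 0) \<and> C_bound k \<eta> K"
    using unit_cutoff_exists[of k, where 'a='a] by blast
  have "\<exists>\<eta> :: 'a \<Rightarrow> real. smooth \<eta> \<and>
    (\<forall>x. cball x r \<subseteq> B \<longrightarrow> \<eta> x = 1) \<and> (\<forall>x. cball x r \<inter> B = {} \<longrightarrow> \<eta> x = 0) \<and>
    (\<forall>vs x. length vs \<le> k \<longrightarrow> (\<forall>v\<in>set vs. norm v \<le> 1) \<longrightarrow> norm (iter_deriv \<eta> vs x) \<le> K * inverse r ^ length vs)"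
    if B: "open B" and r: "0 < r" for B and r :: real
  proof -
    let ?B = "(\<lambda>w. r *\<^sub>R w) -` B"
    have "open ?B" by (intro open_vimage B continuous_intros)
    then have "?B \<in> sets lborel" by simp
    then obtain \<eta> :: "'a \<Rightarrow> real" where \<eta>: "smooth \<eta>" "\<And>x. cball x 1 \<subseteq> ?B \<Longrightarrow> \<eta> x = 1"
      "\<And>x. cball x 1 \<inter> ?B = {} \<Longrightarrow> \<eta> x = 0" "C_bound k \<eta> K" using K(2) by blast
    have d: "dist x (r *\<^sub>R w) = r * dist (inverse r *\<^sub>R x) w" for x w :: 'a
      using r norm_scaleR[of r "inverse r *\<^sub>R x - w"] by (simp add: dist_norm algebra_simps)
    let ?\<eta> = "\<lambda>x. \<eta> (inverse r *\<^sub>R x + 0)"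
    have w: "r *\<^sub>R w \<in> cball x r" if "w \<in> cball (inverse r *\<^sub>R x + 0) 1" for w x :: 'a
      using that r by (simp add: d)
    show ?thesis
    proof (intro exI[of _ ?\<eta>] conjI allI impI)
      show "smooth ?\<eta>" by (rule smooth_affine[OF \<eta>(1)])
      show "?\<eta> x = 1" if "cball x r \<subseteq> B" for x using that w[of _ x] by (intro \<eta>(2)) blast
      show "?\<eta> x = 0" if "cball x r \<inter> B = {}" for x using that w[of _ x] by (intro \<eta>(3)) blast
      fix vs :: "'a list" and x assume vs: "length vs \<le> k" "\<forall>v\<in>set vs. norm v \<le> 1"
      show "norm (iter_deriv ?\<eta> vs x) \<le> K * inverse r ^ length vs"
        using mult_left_mono[OF C_boundD[OF \<eta>(4) vs, of "inverse r *\<^sub>R x + 0"], of "inverse r ^ length vs"] r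
        unfolding iter_deriv_affine[OF \<eta>(1)] by (simp add: mult.commute abs_mult power_abs)
    qed
  qed
  then show ?thesis using K(1) by blast
qed

text \<open>The conclusion of \<open>mollification_rate\<close> for the error \<open>e\<close>, from scale \<open>2\<^sup>-\<^sup>l\<close> on.\<close>

definition jets_close ::
    "(nat \<Rightarrow> 'a::euclidean_space \<Rightarrow> 'b::real_normed_vector) \<Rightarrow> ('a \<Rightarrow> 'a \<Rightarrow> 'b) \<Rightarrow> nat \<Rightarrow> real \<Rightarrow> nat \<Rightarrow> 'a \<Rightarrow> bool" where
  "jets_close u P k e l a \<longleftrightarrow> (\<forall>j\<ge>l. \<forall>x. dist a x \<le> 7 * (1/2) ^ j \<longrightarrow>
    (\<forall>vs. length vs \<le> k \<longrightarrow> (\<forall>v\<in>set vs. norm v \<le> 1) \<longrightarrow>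
      norm (iter_deriv (u j) vs x - iter_deriv (P a) vs x) \<le> e * ((1/2) ^ j) ^ (k - length vs)))"

lemma jets_close_mono: "jets_close u P k e l a \<Longrightarrow> l \<le> m \<Longrightarrow> e \<le> d \<Longrightarrow> jets_close u P k d m a"
  unfolding jets_close_def by (smt (verit, best) order_trans mult_right_mono zero_le_power divide_nonneg_nonneg)

abbreviation nhd :: "'a::metric_space set \<Rightarrow> real \<Rightarrow> 'a set" where
  "nhd C s \<equiv> (\<Union>c\<in>C. ball c s)"

lemma nhd_mono: "s \<le> t \<Longrightarrow> nhd C s \<subseteq> nhd C t"
  by (force intro: less_le_trans)

lemma nhd_triangle: "x \<in> nhd C s \<Longrightarrow> dist x y \<le> t \<Longrightarrow> y \<in> nhd C (s + t)"
proof -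
  assume "x \<in> nhd C s" and y: "dist x y \<le> t"
  then obtain c where c: "c \<in> C" "dist c x < s" by auto
  have "dist c y < s + t" using dist_triangle[of c y x] c(2) y by simp
  then show ?thesis using c(1) by auto
qed

text \<open>The polynomials disappear here: at a point \<open>x\<close> near \<open>C\<close>, the two mollifications are both
  compared with the polynomial of one good point \<open>a\<close>. The points of \<open>C\<close> need only be limits of
  good points with the same \<open>e\<close> and \<open>l\<close>; with \<open>x\<close> at distance below \<open>13/2 \<cdot> 2\<^sup>-\<^sup>q\<close> from \<open>C\<close>, the margin
  \<open>1/2 \<cdot> 2\<^sup>-\<^sup>q\<close> is left for passing to such an \<open>a\<close>.\<close>

lemma jets_close_imp_close_scales:
  fixes u :: "nat \<Rightarrow> 'a::euclidean_space \<Rightarrow> 'b::real_normed_vector"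
  assumes C: "\<And>R e. 0 < e \<Longrightarrow> \<exists>l. \<forall>c\<in>C. norm c < R \<longrightarrow> c \<in> closure {a \<in> A. jets_close u P k e l a}"
    and e: "0 < e"
  shows "\<exists>l. \<forall>i\<ge>l. \<forall>q\<ge>i. \<forall>x \<in> ball 0 R \<inter> nhd C (13/2 * (1/2) ^ q). \<forall>vs. length vs \<le> k \<longrightarrow> (\<forall>v\<in>set vs. norm v \<le> 1) \<longrightarrow>
    norm (iter_deriv (u q) vs x - iter_deriv (u i) vs x) \<le> e * ((1/2) ^ i) ^ (k - length vs)"
proof -
  obtain l where l: "\<And>c. c \<in> C \<Longrightarrow> norm c < R + 7 \<Longrightarrow> c \<in> closure {a \<in> A. jets_close u P k (e/2) l a}"
    using C[of "e/2" "R + 7"] e by auto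
  show ?thesis
  proof (intro exI[of _ l] allI impI ballI)
    fix i q x and vs :: "'a list"
    assume i: "l \<le> i" and q: "i \<le> q" and x: "x \<in> ball 0 R \<inter> nhd C (13/2 * (1/2) ^ q)"
      and vs: "length vs \<le> k" "\<forall>v\<in>set vs. norm v \<le> 1"
    let ?r = "\<lambda>j. (1/2::real) ^ j"
    have rq: "?r q \<le> ?r i" by (intro power_decreasing q) auto
    have r1: "?r q \<le> 1" by (intro power_le_one) auto
    obtain c where c: "c \<in> C" "dist c x < 13/2 * ?r q" using x by auto
    have "norm c < R + 7"
      using c(2) x r1 norm_triangle_sub[of c x] by (simp add: dist_norm)
    then have "c \<in> closure {a \<in> A. jets_close u P k (e/2) l a}" using l c(1) by blast
    then obtain a where a: "jets_close u P k (e/2) l a" "dist a c < ?r q / 2"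
      unfolding closure_approachable by (metis (no_types, lifting) half_gt_zero mem_Collect_eq zero_less_power zero_less_divide_1_iff zero_less_numeral)
    have ax: "dist a x \<le> 7 * ?r q" using dist_triangle[of a x c] a(2) c(2) by simp
    have "norm (iter_deriv (u q) vs x - iter_deriv (P a) vs x) \<le> e/2 * ?r q ^ (k - length vs)"
      using a(1) i q ax vs unfolding jets_close_def by (meson order_trans)
    also have "\<dots> \<le> e/2 * ?r i ^ (k - length vs)"
      using rq e by (intro mult_left_mono power_mono) auto
    finally have 1: "norm (iter_deriv (u q) vs x - iter_deriv (P a) vs x) \<le> e/2 * ?r i ^ (k - length vs)" .
    have "dist a x \<le> 7 * ?r i" using ax rq by linarith
    then have 2: "norm (iter_deriv (u i) vs x - iter_deriv (P a) vs x) \<le> e/2 * ?r i ^ (k - length vs)"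
      using a(1) i vs unfolding jets_close_def by blast
    have "norm (iter_deriv (u q) vs x - iter_deriv (u i) vs x) \<le> e/2 * ?r i ^ (k - length vs) + e/2 * ?r i ^ (k - length vs)"
      using norm_triangle_ineq4[of "iter_deriv (u q) vs x - iter_deriv (P a) vs x" "iter_deriv (u i) vs x - iter_deriv (P a) vs x"] 1 2
      by simp
    then show "norm (iter_deriv (u q) vs x - iter_deriv (u i) vs x) \<le> e * ?r i ^ (k - length vs)"
      by (simp add: field_simps)
  qed
qed

lemma cutoff_sequence_exists:
  fixes C :: "'a::euclidean_space set" and k :: nat
  shows "\<exists>K\<ge>0. \<exists>\<eta> :: nat \<Rightarrow> 'a \<Rightarrow> real. (\<forall>j. smooth (\<eta> j)) \<and>
    (\<forall>j. \<forall>x\<in>nhd C (2 * (1/2) ^ j). \<eta> j x = 1) \<and> (\<forall>j. \<forall>x. x \<notin> nhd C (3 * (1/2) ^ j) \<longrightarrow> \<eta> j x = 0) \<and>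
    (\<forall>j vs x. length vs \<le> k \<longrightarrow> (\<forall>v\<in>set vs. norm v \<le> 1) \<longrightarrow> norm (iter_deriv (\<eta> j) vs x) \<le> K * (2 ^ j) ^ length vs)"
proof -
  obtain K where K: "0 \<le> K" "\<forall>B r. open B \<longrightarrow> 0 < r \<longrightarrow> (\<exists>\<eta> :: 'a \<Rightarrow> real. smooth \<eta> \<and>
    (\<forall>x. cball x r \<subseteq> B \<longrightarrow> \<eta> x = 1) \<and> (\<forall>x. cball x r \<inter> B = {} \<longrightarrow> \<eta> x = 0) \<and>
    (\<forall>vs x. length vs \<le> k \<longrightarrow> (\<forall>v\<in>set vs. norm v \<le> 1) \<longrightarrow> norm (iter_deriv \<eta> vs x) \<le> K * inverse r ^ length vs))"
    using cutoff_exists[of k, where 'a='a] by (elim exE conjE)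
  let ?r = "\<lambda>j. (1/2::real) ^ j" and ?B = "\<lambda>j. nhd C (5/2 * (1/2) ^ j)"
  have "\<exists>\<eta> :: 'a \<Rightarrow> real. smooth \<eta> \<and>
    (\<forall>x. cball x (?r j / 2) \<subseteq> ?B j \<longrightarrow> \<eta> x = 1) \<and> (\<forall>x. cball x (?r j / 2) \<inter> ?B j = {} \<longrightarrow> \<eta> x = 0) \<and>
    (\<forall>vs x. length vs \<le> k \<longrightarrow> (\<forall>v\<in>set vs. norm v \<le> 1) \<longrightarrow> norm (iter_deriv \<eta> vs x) \<le> K * inverse (?r j / 2) ^ length vs)" for j
    by (rule K(2)[rule_format]) auto
  then obtain \<eta> :: "nat \<Rightarrow> 'a \<Rightarrow> real" where \<eta>: "\<And>j. smooth (\<eta> j)"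
    "\<And>j x. cball x (?r j / 2) \<subseteq> ?B j \<Longrightarrow> \<eta> j x = 1" "\<And>j x. cball x (?r j / 2) \<inter> ?B j = {} \<Longrightarrow> \<eta> j x = 0"
    "\<And>j vs x. length vs \<le> k \<Longrightarrow> \<forall>v\<in>set vs. norm v \<le> 1 \<Longrightarrow> norm (iter_deriv (\<eta> j) vs x) \<le> K * inverse (?r j / 2) ^ length vs"
    by metis
  have one: "\<eta> j x = 1" if "x \<in> nhd C (2 * ?r j)" for j x
  proof (rule \<eta>(2), rule subsetI)
    fix y assume "y \<in> cball x (?r j / 2)"
    then show "y \<in> ?B j" using nhd_triangle[OF that, of y "?r j / 2"] by simp
  qed
  have zero: "\<eta> j x = 0" if x: "x \<notin> nhd C (3 * ?r j)" for j x
  proof (rule \<eta>(3), rule ccontr)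
    assume "cball x (?r j / 2) \<inter> ?B j \<noteq> {}"
    then obtain y where "y \<in> cball x (?r j / 2)" and y2: "y \<in> ?B j" by blast
    then have y: "dist x y \<le> ?r j / 2" by simp
    from nhd_triangle[OF y2, of x "?r j / 2"] y x show False by (simp add: dist_commute del: UN_iff)
  qed
  have bound: "norm (iter_deriv (\<eta> j) vs x) \<le> (K * 2 ^ k) * (2 ^ j) ^ length vs"
    if vs: "length vs \<le> k" "\<forall>v\<in>set vs. norm v \<le> 1" for j vs x
  proof -
    have "inverse (?r j / 2) = 2 * 2 ^ j" by (simp add: power_divide)
    then have "norm (iter_deriv (\<eta> j) vs x) \<le> K * (2 ^ length vs * (2 ^ j) ^ length vs)"
      using \<eta>(4)[OF vs, of j x] by (simp add: power_mult_distrib)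
    also have "\<dots> \<le> K * (2 ^ k * (2 ^ j) ^ length vs)"
      using K(1) vs by (intro mult_left_mono mult_right_mono power_increasing) auto
    finally show ?thesis by (simp add: mult.assoc)
  qed
  have "0 \<le> K * 2 ^ k" using K(1) by simp
  moreover have "\<forall>j. smooth (\<eta> j)" using \<eta>(1) by (rule allI)
  moreover have "\<forall>j. \<forall>x\<in>nhd C (2 * ?r j). \<eta> j x = 1" by (intro allI ballI one)
  moreover have "\<forall>j x. x \<notin> nhd C (3 * ?r j) \<longrightarrow> \<eta> j x = 0" by (intro allI impI zero)
  moreover have "\<forall>j vs x. length vs \<le> k \<longrightarrow> (\<forall>v\<in>set vs. norm v \<le> 1) \<longrightarrow>
      norm (iter_deriv (\<eta> j) vs x) \<le> (K * 2 ^ k) * (2 ^ j) ^ length vs"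
    using bound by (intro allI impI)
  ultimately show ?thesis by (intro exI[of _ "K * 2 ^ k"] exI[of _ \<eta>] conjI)
qed

text \<open>Fix \<open>x\<close> and let \<open>q\<close> be the first scale at which \<open>x\<close> has distance at least \<open>2 \<cdot> 2\<^sup>-\<^sup>q\<close> from
  \<open>C\<close>. Near \<open>x\<close> the cutoffs before \<open>q\<close> are \<open>1\<close> and those after \<open>q\<close> are \<open>0\<close>, as
  \<open>3 \<cdot> 2\<^sup>-\<^sup>j \<le> 3/2 \<cdot> 2\<^sup>-\<^sup>q\<close> for \<open>j > q\<close>. What remains of the sum is \<open>u\<^sub>q - u\<^sub>J\<close> and the transitional
  term \<open>\<eta>\<^sub>q (u\<^sub>q\<^sub>+\<^sub>1 - u\<^sub>q)\<close>; in the latter, the powers \<open>2\<^sup>q\<^sup>m\<close> from the cutoff are compensated by the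
  rate \<open>2\<^sup>-\<^sup>q\<^sup>(\<^sup>k\<^sup>-\<^sup>m\<^sup>)\<close>. For derivatives of order \<open>k\<close> no sum over scales would converge
  absolutely, which is why the telescoping is essential.\<close>

lemma glue_approximations:
  fixes u :: "nat \<Rightarrow> 'a::euclidean_space \<Rightarrow> 'b::banach" and C :: "'a set"
  assumes u: "\<And>j. smooth (u j)"
    and close: "\<And>R e. 0 < e \<Longrightarrow> \<exists>l. \<forall>i\<ge>l. \<forall>q\<ge>i. \<forall>x \<in> ball 0 R \<inter> nhd C (13/2 * (1/2) ^ q). \<forall>vs. length vs \<le> k \<longrightarrow>
      (\<forall>v\<in>set vs. norm v \<le> 1) \<longrightarrow> norm (iter_deriv (u q) vs x - iter_deriv (u i) vs x) \<le> e * ((1/2) ^ i) ^ (k - length vs)"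
  shows "\<exists>g. of_class k g \<and> (\<forall>c\<in>C. \<forall>vs. length vs \<le> k \<longrightarrow> (\<lambda>j. iter_deriv (u j) vs c) \<longlonglongrightarrow> iter_deriv g vs c)"
proof -
  let ?r = "\<lambda>j. (1/2::real) ^ j"
  obtain K and \<eta> :: "nat \<Rightarrow> 'a \<Rightarrow> real" where K: "0 \<le> K" and \<eta>: "\<And>j. smooth (\<eta> j)"
    "\<And>j x. x \<in> nhd C (2 * ?r j) \<Longrightarrow> \<eta> j x = 1" "\<And>j x. x \<notin> nhd C (3 * ?r j) \<Longrightarrow> \<eta> j x = 0"
    "\<And>j vs x. length vs \<le> k \<Longrightarrow> \<forall>v\<in>set vs. norm v \<le> 1 \<Longrightarrow> norm (iter_deriv (\<eta> j) vs x) \<le> K * (2 ^ j) ^ length vs"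
    using cutoff_sequence_exists[of C k] by metis
  define w where "w j x = u (Suc j) x - u j x" for j x
  define g where "g J x = u 0 x + (\<Sum>j<J. \<eta> j x *\<^sub>R w j x)" for J x
  have sw: "smooth (w j)" for j unfolding w_def by (intro smooth_diff u)
  have s\<eta>w: "smooth (\<lambda>x. \<eta> j x *\<^sub>R w j x)" for j by (intro smooth_product \<eta>(1) sw)
  have sg: "smooth (g J)" for J unfolding g_def by (intro smooth_add u smooth_sum s\<eta>w)
  have est: "\<exists>l. \<forall>J\<ge>l. \<forall>J'\<ge>J. \<forall>x\<in>ball 0 R. \<forall>vs. length vs \<le> k \<longrightarrow> (\<forall>v\<in>set vs. norm v \<le> 1) \<longrightarrow>
      norm (iter_deriv (g J') vs x - iter_deriv (g J) vs x) \<le> e" if "0 < e" for R e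
  proof -
    let ?d = "e / (1 + 2 ^ k * K)"
    have d0: "0 < 1 + 2 ^ k * K" using K by (simp add: add_pos_nonneg)
    have d: "0 < ?d" using \<open>0 < e\<close> d0 by simp
    obtain l where l: "\<And>i q x vs. l \<le> i \<Longrightarrow> i \<le> q \<Longrightarrow> x \<in> ball 0 R \<Longrightarrow> x \<in> nhd C (13/2 * ?r q) \<Longrightarrow> length vs \<le> k \<Longrightarrow>
      \<forall>v\<in>set vs. norm v \<le> 1 \<Longrightarrow> norm (iter_deriv (u q) vs x - iter_deriv (u i) vs x) \<le> ?d * ?r i ^ (k - length vs)"
      using close[OF d, of R] by blast
    show ?thesis
    proof (intro exI[of _ l] allI impI ballI)
      fix J J' and x :: 'a and vs :: "'a list"
      assume J: "l \<le> J" "J \<le> J'" and x: "x \<in> ball 0 R" and vs: "length vs \<le> k" "\<forall>v\<in>set vs. norm v \<le> 1"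
      define stop where "stop q \<longleftrightarrow> J \<le> q \<and> (q = J' \<or> x \<notin> nhd C (2 * ?r q))" for q
      define q where "q = (LEAST q. stop q)"
      have J': "stop J'" using J by (simp add: stop_def)
      have "stop q" unfolding q_def using J' by (rule LeastI)
      then have q: "J \<le> q" "q = J' \<or> x \<notin> nhd C (2 * ?r q)" unfolding stop_def by blast+
      have q3: "q \<le> J'" unfolding q_def using J' by (rule Least_le)
      have q_least: "x \<in> nhd C (2 * ?r j)" if "J \<le> j" "j < q" for j
      proof (rule ccontr)
        assume "x \<notin> nhd C (2 * ?r j)"
        with that(1) have "stop j" unfolding stop_def by (intro conjI disjI2)
        moreover have "\<not> stop j" using that(2) unfolding q_def by (rule not_less_Least)
        ultimately show False by contradiction
      qed
      let ?h = "\<lambda>x. if q < J' then \<eta> q x *\<^sub>R w q x else 0"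
      let ?O = "(\<Inter>j\<in>{J..<q}. nhd C (2 * ?r j)) \<inter> ball x (?r q / 2)"
      have O: "open ?O" "x \<in> ?O"
        using q_least by (auto intro!: open_INT simp del: UN_iff)
      have sh: "smooth ?h" using s\<eta>w by (cases "q < J'") auto
      have eq: "u q y - u J y + ?h y = g J' y - g J y" if y: "y \<in> ?O" for y
      proof -
        have zero: "\<eta> j y = 0" if j: "q < j" "j < J'" for j
        proof (rule \<eta>(3), rule notI)
          assume "y \<in> nhd C (3 * ?r j)"
          moreover have "3 * ?r j \<le> 3/2 * ?r q"
            using power_decreasing[of "Suc q" j "1/2::real"] j by simp
          ultimately have "y \<in> nhd C (3/2 * ?r q)" using nhd_mono by blast
          then have "x \<in> nhd C (3/2 * ?r q + ?r q / 2)"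
            by (rule nhd_triangle) (use y in \<open>simp add: dist_commute less_imp_le\<close>)
          then show False using q(2) j by simp
        qed
        have "g J' y - g J y = (\<Sum>j\<in>{J..<J'}. \<eta> j y *\<^sub>R w j y)"
          unfolding g_def using sum.atLeastLessThan_concat[of 0 J J' "\<lambda>j. \<eta> j y *\<^sub>R w j y"] J(2)
          by (simp add: lessThan_atLeast0 algebra_simps)
        also have "\<dots> = (\<Sum>j\<in>{J..<q}. \<eta> j y *\<^sub>R w j y) + (\<Sum>j\<in>{q..<J'}. \<eta> j y *\<^sub>R w j y)"
          by (rule sum.atLeastLessThan_concat[OF q(1) q3, symmetric])
        also have "(\<Sum>j\<in>{J..<q}. \<eta> j y *\<^sub>R w j y) = (\<Sum>j\<in>{J..<q}. u (Suc j) y - u j y)"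
        proof (intro sum.cong refl)
          fix j assume "j \<in> {J..<q}"
          then have "y \<in> nhd C (2 * ?r j)" using y by blast
          then show "\<eta> j y *\<^sub>R w j y = u (Suc j) y - u j y" by (simp add: \<eta>(2) w_def del: UN_iff)
        qed
        also have "\<dots> = u q y - u J y" by (rule sum_Suc_diff'[OF q(1)])
        also have "(\<Sum>j\<in>{q..<J'}. \<eta> j y *\<^sub>R w j y) = ?h y"
        proof (cases "q < J'")
          case True
          have "(\<Sum>j\<in>{q..<J'}. \<eta> j y *\<^sub>R w j y) = \<eta> q y *\<^sub>R w q y + (\<Sum>j\<in>{Suc q..<J'}. \<eta> j y *\<^sub>R w j y)"
            by (rule sum.atLeast_Suc_lessThan[OF True])
          also have "(\<Sum>j\<in>{Suc q..<J'}. \<eta> j y *\<^sub>R w j y) = 0" by (intro sum.neutral ballI) (simp add: zero)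
          finally show ?thesis using True by simp
        qed simp
        finally show ?thesis by simp
      qed
      \<comment> \<open>If \<open>q > J\<close>, the scale before \<open>q\<close> still sees \<open>C\<close>.\<close>
      have e1: "norm (iter_deriv (u q) vs x - iter_deriv (u J) vs x) \<le> ?d"
      proof (cases "q = J")
        case True
        then show ?thesis using d by simp
      next
        case False
        then have "x \<in> nhd C (2 * ?r (q - 1))" using q(1) by (intro q_least) auto
        moreover have "2 * ?r (q - 1) = 4 * ?r q" using False q(1) by (cases q) auto
        ultimately have "x \<in> nhd C (4 * ?r q)" by simp
        moreover have "nhd C (4 * ?r q) \<subseteq> nhd C (13/2 * ?r q)" by (rule nhd_mono) simp
        ultimately have "x \<in> nhd C (13/2 * ?r q)" by (rule subsetD[rotated])
        then have "norm (iter_deriv (u q) vs x - iter_deriv (u J) vs x) \<le> ?d * ?r J ^ (k - length vs)"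
          by (rule l[OF J(1) q(1) x _ vs])
        also have "\<dots> \<le> ?d * 1" using d by (intro mult_left_mono power_le_one) (auto simp: power_le_one)
        finally show ?thesis by simp
      qed
      have e2: "norm (iter_deriv ?h vs x) \<le> 2 ^ k * K * ?d"
      \<comment> \<open>A radius above \<open>3 \<cdot> 2\<^sup>-\<^sup>q\<close> separates the cases, so that the cutoff vanishes on a whole
        neighbourhood of \<open>x\<close> in the second; it is \<open>13/2\<close> in units of the scale \<open>q + 1\<close>.\<close>
      proof (cases "q < J' \<and> x \<in> nhd C (13/4 * ?r q)")
        case True
        then have x': "x \<in> nhd C (13/2 * ?r (Suc q))" by simp
        have pw: "?r q ^ (k - length us) = ?r q ^ k * (2 ^ q) ^ length us" if "length us \<le> k" for us :: "'a list"
        proof -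
          have "?r q ^ k = ?r q ^ (k - length us) * ?r q ^ length us" using that by (simp add: power_add[symmetric])
          moreover have "?r q ^ length us * (2 ^ q) ^ length us = 1"
            by (simp add: power_mult_distrib[symmetric])
          ultimately show ?thesis by simp
        qed
        have "norm (iter_deriv (\<lambda>x. \<eta> q x *\<^sub>R w q x) vs x) \<le> 2 ^ length vs * K * (?d * ?r q ^ k) * (2 ^ q) ^ length vs"
        proof (rule iter_deriv_product_bound[OF \<eta>(1) sw K _ _ _ _ vs(2)])
          show "0 \<le> ?d * ?r q ^ k" by (intro mult_nonneg_nonneg less_imp_le[OF d]) auto
          fix us :: "'a list" assume us: "length us \<le> length vs" "\<forall>u\<in>set us. norm u \<le> 1"
          show "norm (iter_deriv (\<eta> q) us x) \<le> K * (2 ^ q) ^ length us" using us vs by (intro \<eta>(4)) auto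
          have "norm (iter_deriv (w q) us x) = norm (iter_deriv (u (Suc q)) us x - iter_deriv (u q) us x)"
            unfolding w_def by (simp add: iter_deriv_diff[OF u u])
          also have "\<dots> \<le> ?d * ?r q ^ (k - length us)"
            using us vs J q(1) by (intro l x x') auto
          also have "\<dots> = ?d * ?r q ^ k * (2 ^ q) ^ length us" using us vs by (subst pw) auto
          finally show "norm (iter_deriv (w q) us x) \<le> ?d * ?r q ^ k * (2 ^ q) ^ length us" .
        qed simp
        also have "\<dots> = 2 ^ length vs * K * (?d * ?r q ^ (k - length vs))" by (simp add: pw[OF vs(1)])
        also have "\<dots> \<le> 2 ^ k * K * (?d * 1)"
        proof (rule mult_mono)
          show "2 ^ length vs * K \<le> 2 ^ k * K"
            using vs(1) K by (intro mult_right_mono power_increasing) auto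
          show "?d * ?r q ^ (k - length vs) \<le> ?d * 1"
            by (intro mult_left_mono power_le_one less_imp_le[OF d]) (auto simp: power_le_one)
          show "0 \<le> ?d * ?r q ^ (k - length vs)"
            by (intro mult_nonneg_nonneg less_imp_le[OF d]) auto
        qed (use K in simp)
        finally show ?thesis using True by simp
      next
        case False
        have "?h y = 0" if y: "y \<in> ball x (?r q / 4)" for y
        proof (cases "q < J'")
          case True
          have "y \<notin> nhd C (3 * ?r q)"
          proof
            assume "y \<in> nhd C (3 * ?r q)"
            then have "x \<in> nhd C (3 * ?r q + ?r q / 4)"
              by (rule nhd_triangle) (use y in \<open>simp add: dist_commute less_imp_le\<close>)
            then show False using False True by simp
          qed
          then show ?thesis by (simp add: \<eta>(3))
        qed simp
        then have "iter_deriv ?h vs x = iter_deriv (\<lambda>_. 0) vs x"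
          by (intro iter_deriv_cong_open[of "ball x (?r q / 4)"] sh) auto
        moreover have "0 \<le> 2 ^ k * K * ?d" by (intro mult_nonneg_nonneg K less_imp_le[OF d]) auto
        ultimately show ?thesis by (simp only: iter_deriv_const norm_zero if_cancel)
      qed
      have "iter_deriv (g J') vs x - iter_deriv (g J) vs x = iter_deriv (\<lambda>x. g J' x - g J x) vs x"
        by (simp add: iter_deriv_diff[OF sg sg])
      also have "\<dots> = iter_deriv (\<lambda>x. u q x - u J x + ?h x) vs x"
        by (rule iter_deriv_cong_open[OF O(1) eq O(2) smooth_add[OF smooth_diff[OF u u] sh], symmetric])
      also have "\<dots> = (iter_deriv (u q) vs x - iter_deriv (u J) vs x) + iter_deriv ?h vs x"
        by (simp only: iter_deriv_add[OF smooth_diff[OF u u] sh] iter_deriv_diff[OF u u])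
      finally have "norm (iter_deriv (g J') vs x - iter_deriv (g J) vs x) \<le> ?d + 2 ^ k * K * ?d"
        using norm_triangle_mono[OF e1 e2] by simp
      also have "\<dots> = (1 + 2 ^ k * K) * ?d" by (simp only: distrib_right mult_1)
      also have "\<dots> = e" using d0 by simp
      finally show "norm (iter_deriv (g J') vs x - iter_deriv (g J) vs x) \<le> e" .
    qed
  qed
  have cauchy: "\<exists>N. \<forall>m\<ge>N. \<forall>n\<ge>N. \<forall>x\<in>ball 0 R. norm (iter_deriv (g m) vs x - iter_deriv (g n) vs x) \<le> e"
    if vs: "length vs \<le> k" and e: "0 < e" for vs R e
  proof -
    let ?p = "prod_list (map norm vs)"
    have p: "0 \<le> ?p" by (auto intro!: prod_list_nonneg)
    have e': "0 < e / (?p + 1)" using e p by simp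
    obtain l where l: "\<And>J J' x us. l \<le> J \<Longrightarrow> J \<le> J' \<Longrightarrow> x \<in> ball 0 R \<Longrightarrow> length us \<le> k \<Longrightarrow> \<forall>v\<in>set us. norm v \<le> 1 \<Longrightarrow>
      norm (iter_deriv (g J') us x - iter_deriv (g J) us x) \<le> e / (?p + 1)"
      using est[OF e', of R] by blast
    have *: "norm (iter_deriv (g m) vs x - iter_deriv (g n) vs x) \<le> e" if "l \<le> n" "n \<le> m" "x \<in> ball 0 R" for m n x
    proof -
      have "norm (iter_deriv (\<lambda>x. g m x - g n x) vs x) \<le> ?p * (e / (?p + 1))"
        using l[OF that] vs by (intro iter_deriv_norm_le smooth_diff sg) (auto simp: iter_deriv_diff[OF sg sg])
      also have "\<dots> \<le> (?p + 1) * (e / (?p + 1))" using e' by (intro mult_right_mono) auto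
      also have "\<dots> = e" using p by simp
      finally show ?thesis by (simp add: iter_deriv_diff[OF sg sg])
    qed
    show ?thesis
    proof (intro exI[of _ l] allI impI ballI)
      fix m n and x :: 'a assume "l \<le> m" "l \<le> n" "x \<in> ball 0 R"
      then show "norm (iter_deriv (g m) vs x - iter_deriv (g n) vs x) \<le> e"
        using *[of n m x] *[of m n x] by (cases "n \<le> m") (auto simp: norm_minus_commute)
    qed
  qed
  have "iter_deriv (g J) vs c = iter_deriv (u J) vs c" if c: "c \<in> C" for c J vs
  proof (rule iter_deriv_cong_open[OF open_ball _ _ sg])
    show "c \<in> ball c (2 * ?r J)" by simp
    fix x assume x: "x \<in> ball c (2 * ?r J)"
    have "\<eta> j x *\<^sub>R w j x = u (Suc j) x - u j x" if "j < J" for j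
    proof -
      have "?r J \<le> ?r j" using that by (intro power_decreasing) auto
      moreover have "dist c x < 2 * ?r J" using x by simp
      ultimately have "dist c x < 2 * ?r j" by linarith
      then have "x \<in> nhd C (2 * ?r j)" using c by (auto simp del: mult_less_cancel_left)
      then show ?thesis by (simp add: \<eta>(2) w_def del: UN_iff)
    qed
    then have "g J x = u 0 x + (\<Sum>j<J. u (Suc j) x - u j x)" unfolding g_def by simp
    then show "g J x = u J x" using sum_lessThan_telescope[of "\<lambda>j. u j x" J] by simp
  qed
  then have "(\<lambda>j. iter_deriv (u j) vs c) \<longlonglongrightarrow> iter_deriv (\<lambda>x. lim (\<lambda>n. g n x)) vs c"
    if "c \<in> C" "length vs \<le> k" for c vs
    using iter_deriv_limit[where f=g, OF sg cauchy that(2), of c] that(1) by simp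
  then show ?thesis using of_class_limit[where f=g, OF sg cauchy] by blast
qed

text \<open>The sets \<open>F j l\<close> increase to a cover of the possibly non-measurable set \<open>A\<close>. As they are
  closed, continuity of the measure from above applies to \<open>(\<Union>l. F j l) - F j l\<close>. Splitting into shells
  makes the measures finite and lets the index \<open>l\<close> depend on the distance from the origin, which
  is why the uniformity obtained is local.\<close>

lemma egorov_closed_sets:
  fixes F :: "nat \<Rightarrow> nat \<Rightarrow> 'a::euclidean_space set"
  assumes F: "\<And>j l. closed (F j l)" "\<And>j l m. l \<le> m \<Longrightarrow> F j l \<subseteq> F j m" and A: "\<And>j. A \<subseteq> (\<Union>l. F j l)"
    and \<epsilon>: "0 < \<epsilon>"
  shows "\<exists>C. (\<forall>j R. \<exists>l. \<forall>c\<in>C. norm c < R \<longrightarrow> c \<in> F j l) \<and> outer_measure_of lebesgue (A - C) < ennreal \<epsilon>"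
proof -
  define Q where "Q q = {x :: 'a. real q \<le> norm x \<and> norm x < real q + 1}" for q
  have Q: "Q q \<in> lmeasurable" for q
  proof (rule bounded_set_imp_lmeasurable)
    show "bounded (Q q)" by (rule bounded_subset[OF bounded_ball[of 0 "real q + 1"]]) (auto simp: Q_def)
    have "Q q = ball 0 (real q + 1) - ball 0 (real q)" by (auto simp: Q_def)
    then show "Q q \<in> sets lebesgue" by simp
  qed
  have Fm: "F j l \<in> sets lebesgue" for j l using F(1) by (simp add: borel_closed)
  define X where "X j q l = (\<Union>m. F j m) \<inter> Q q - F j l" for j q l
  have Xm: "X j q l \<in> lmeasurable" for j q l
    unfolding X_def by (intro fmeasurable_Diff fmeasurable_Int_fmeasurable[of "Q q", OF Q, simplified Int_commute] Fm sets.countable_UN) (auto simp: Fm)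
  have "\<exists>l. emeasure lebesgue (X j q l) < ennreal (\<epsilon> / 2 * (1/2) ^ Suc (prod_encode (j, q)))" for j q
  proof -
    have "(\<lambda>l. emeasure lebesgue (X j q l)) \<longlonglongrightarrow> emeasure lebesgue (\<Inter>l. X j q l)"
    proof (rule Lim_emeasure_decseq)
      show "decseq (X j q)" using F(2) by (fastforce simp: decseq_def X_def)
      show "range (X j q) \<subseteq> sets lebesgue" using Xm by (auto simp: fmeasurableD)
      show "emeasure lebesgue (X j q l) \<noteq> \<infinity>" for l using Xm[of j q l] by (auto simp: fmeasurable_def)
    qed
    moreover have "(\<Inter>l. X j q l) = {}" by (auto simp: X_def)
    ultimately have "(\<lambda>l. emeasure lebesgue (X j q l)) \<longlonglongrightarrow> 0" by simp
    then have "\<forall>\<^sub>F l in sequentially. emeasure lebesgue (X j q l) < ennreal (\<epsilon> / 2 * (1/2) ^ Suc (prod_encode (j, q)))"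
      by (rule order_tendstoD) (use \<epsilon> in simp)
    then show ?thesis by (rule eventually_happens'[OF sequentially_bot])
  qed
  then obtain l where l: "\<And>j q. emeasure lebesgue (X j q (l j q)) < ennreal (\<epsilon> / 2 * (1/2) ^ Suc (prod_encode (j, q)))"
    by metis
  define C where "C = {x. \<forall>j. x \<in> F j (l j (nat \<lfloor>norm x\<rfloor>))}"
  have "\<exists>m. \<forall>c\<in>C. norm c < R \<longrightarrow> c \<in> F j m" for j R
  proof (intro exI[of _ "Max (l j ` {..nat \<lfloor>R\<rfloor>})"] ballI impI)
    fix c assume c: "c \<in> C" "norm c < R"
    then have "nat \<lfloor>norm c\<rfloor> \<in> {..nat \<lfloor>R\<rfloor>}" by (auto intro!: nat_mono floor_mono)
    then have "l j (nat \<lfloor>norm c\<rfloor>) \<le> Max (l j ` {..nat \<lfloor>R\<rfloor>})" by (intro Max_ge) auto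
    then show "c \<in> F j (Max (l j ` {..nat \<lfloor>R\<rfloor>}))" using c(1) F(2) unfolding C_def by blast
  qed
  moreover have "outer_measure_of lebesgue (A - C) < ennreal \<epsilon>"
  proof -
    \<comment> \<open>The exceptional sets of all pairs \<open>(j, q)\<close>, as one sequence.\<close>
    let ?Y = "\<lambda>n. case prod_decode n of (j, q) \<Rightarrow> X j q (l j q)"
    have Ym: "?Y n \<in> sets lebesgue" for n using Xm by (auto split: prod.split simp: fmeasurableD)
    have "A - C \<subseteq> (\<Union>n. ?Y n)"
    proof
      fix x assume x: "x \<in> A - C"
      let ?q = "nat \<lfloor>norm x\<rfloor>"
      obtain j where j: "x \<notin> F j (l j ?q)" using x by (auto simp: C_def)
      have "x \<in> Q ?q" unfolding Q_def by (auto intro: of_int_floor_le)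
      then have "x \<in> X j ?q (l j ?q)" using j x A unfolding X_def by blast
      then show "x \<in> (\<Union>n. ?Y n)" by (intro UN_I[of "prod_encode (j, ?q)"]) auto
    qed
    then have "outer_measure_of lebesgue (A - C) \<le> outer_measure_of lebesgue (\<Union>n. ?Y n)"
      by (rule outer_measure_of_mono)
    also have "\<dots> = emeasure lebesgue (\<Union>n. ?Y n)" using Ym by (intro outer_measure_of_eq sets.countable_UN) auto
    also have "\<dots> \<le> (\<Sum>n. emeasure lebesgue (?Y n))" using Ym by (intro emeasure_subadditive_countably) auto
    also have "\<dots> \<le> (\<Sum>n. ennreal (\<epsilon> / 2 * (1/2) ^ Suc n))"
    proof (intro suminf_le allI summableI)
      fix n
      obtain j q where n: "prod_decode n = (j, q)" by (cases "prod_decode n") auto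
      then have "n = prod_encode (j, q)" by (metis prod_decode_inverse)
      then show "emeasure lebesgue (?Y n) \<le> ennreal (\<epsilon> / 2 * (1/2) ^ Suc n)"
        using l[of j q] n by simp
    qed
    also have "\<dots> = ennreal (\<epsilon> / 2)"
    proof (rule suminf_ennreal_eq)
      show "(\<lambda>n. \<epsilon> / 2 * (1/2) ^ Suc n) sums (\<epsilon> / 2)"
        using sums_mult[OF power_half_series, of "\<epsilon> / 2"] by simp
    qed (use \<epsilon> in simp)
    also have "\<dots> < ennreal \<epsilon>" using \<epsilon> by (simp add: ennreal_lessI)
    finally show ?thesis .
  qed
  ultimately show ?thesis by blast
qed

theorem theorem4:
  fixes T :: "(real ^ 'n \<Rightarrow> 'y::banach) \<Rightarrow> real"
    and \<nu> :: "(real ^ 'n \<Rightarrow> 'y) \<Rightarrow> real"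
    and k :: nat
    and A :: "(real ^ 'n) set"
    and \<epsilon> :: real
  assumes "separable_space (euclidean :: ('y \<Rightarrow>\<^sub>L real) topology)"
    and "seminorm_on_test (cball 0 1) \<nu>"
    and "distribution T"
    and "A = {a. nu_pt_differentiable \<nu> T k a}"
    and "0 < \<epsilon>"
  shows "\<exists>g :: real ^ 'n \<Rightarrow> ('y \<Rightarrow>\<^sub>L real). of_class k g \<and>
    outer_measure_of lebesgue (A - {a. \<forall>m\<le>k. pt_deriv k T m a = nth_deriv m g a}) < ennreal \<epsilon>"
proof -
  note \<nu> = assms(2)
  have T: "test_functional T" by (rule distribution_imp_test_functional) fact
  have "\<forall>a\<in>A. \<exists>P. polynomial_of_degree_le k P \<and>
      ((\<lambda>r. SUP \<theta> \<in> {\<theta> \<in> test_functions_in (cball 0 1). \<nu> \<theta> \<le> 1}. ereal (scaled_error T k a P r \<theta>)) \<longlongrightarrow> 0) (at_right 0)"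
    unfolding assms(4) nu_pt_differentiable_def by simp
  from bchoice[OF this] obtain P where P: "\<And>a. a \<in> A \<Longrightarrow> polynomial_of_degree_le k (P a)"
    "\<And>a. a \<in> A \<Longrightarrow> ((\<lambda>r. SUP \<theta> \<in> {\<theta> \<in> test_functions_in (cball 0 1). \<nu> \<theta> \<le> 1}. ereal (scaled_error T k a (P a) r \<theta>)) \<longlongrightarrow> 0) (at_right 0)"
    by blast
  have Pk: "poly_fun k (P a)" if "a \<in> A" for a using P(1)[OF that] by (rule polynomial_imp_poly_fun)
  have Pc: "continuous_on UNIV (P a)" if "a \<in> A" for a
    by (rule smooth_continuous_on[OF poly_fun_smooth[OF Pk[OF that]]])
  obtain \<phi> :: "real ^ 'n \<Rightarrow> real" where "smooth \<phi>" "\<forall>x. x \<notin> cball 0 1 \<longrightarrow> \<phi> x = 0"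
    and repr: "\<And>q. poly_fun k q \<Longrightarrow> (LINT x|lborel. \<phi> x * q x) = q 0"
    using reproducing_kernel_exists[of k] by blast
  then have \<phi>: "\<phi> \<in> test_functions_in (cball 0 1)" by (simp add: test_functions_in_cball_iff)
  define u where "u j = mollify T (dilate ((1/2) ^ j) \<phi>)" for j
  have u: "smooth (u j)" for j
    unfolding u_def by (intro smooth_mollify T test_functions_in_subset[OF dilate_test_function[OF \<phi>]]) simp
  obtain i C where C: "0 \<le> C"
    and err: "\<And>k a P e. continuous_on UNIV P \<Longrightarrow>
      ((\<lambda>r. SUP \<theta> \<in> {\<theta> \<in> test_functions_in (cball 0 1). \<nu> \<theta> \<le> 1}. ereal (scaled_error T k a P r \<theta>)) \<longlongrightarrow> 0) (at_right 0) \<Longrightarrow>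
      0 < e \<Longrightarrow> \<exists>\<delta>>0. \<forall>r. 0 < r \<and> r < \<delta> \<longrightarrow> (\<forall>\<theta>\<in>test_functions_in (cball 0 1). \<forall>M. C_bound i \<theta> M \<longrightarrow>
        \<bar>scaled_error T k a P r \<theta>\<bar> \<le> e * (C * M))"
    using scaled_error_uniform_bound[OF T \<nu>] by blast
  have close: "\<exists>l. jets_close u P k e l a" if "a \<in> A" "0 < e" for a e
    unfolding jets_close_def u_def
    by (rule mollification_rate[OF T Pk[OF that(1)] C \<phi> repr err[OF Pc[OF that(1)] P(2)[OF that(1)]] that(2)])
  have pt: "pt_approximation T k a (P a)" if "a \<in> A" for a
    unfolding pt_approximation_def
  proof (intro conjI ballI P(1)[OF that])
    fix \<theta> :: "real ^ 'n \<Rightarrow> 'y" assume \<theta>: "\<theta> \<in> test_functions_in (cball 0 1)"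
    obtain M where M: "0 \<le> M" "C_bound i \<theta> M" using C_bound_test_function[OF test_functions_in_subset[OF \<theta>]] by blast
    show "((\<lambda>r. scaled_error T k a (P a) r \<theta>) \<longlongrightarrow> 0) (at_right 0)"
    proof (rule tendstoI)
      fix e :: real assume "0 < e"
      let ?e = "e / (C * M + 1)"
      have CM: "0 < C * M + 1" using C M(1) by (simp add: add_nonneg_pos)
      have "0 < ?e" using \<open>0 < e\<close> CM by simp
      from err[OF Pc[OF that] P(2)[OF that] this] obtain \<delta> where \<delta>: "0 < \<delta>"
        "\<And>r. 0 < r \<Longrightarrow> r < \<delta> \<Longrightarrow> \<bar>scaled_error T k a (P a) r \<theta>\<bar> \<le> ?e * (C * M)" using \<theta> M(2) by blast
      have "?e * (C * M) < ?e * (C * M + 1)" using \<open>0 < ?e\<close> by (intro mult_strict_left_mono) auto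
      also have "\<dots> = e" using CM by simp
      finally have "dist (scaled_error T k a (P a) r \<theta>) 0 < e" if "0 < r" "r < \<delta>" for r
        using \<delta>(2)[OF that] by simp
      then show "\<forall>\<^sub>F r in at_right 0. dist (scaled_error T k a (P a) r \<theta>) 0 < e"
        unfolding eventually_at_right_field using \<delta>(1) by blast
    qed
  qed
  let ?W = "\<lambda>e l. {a \<in> A. jets_close u P k e l a}"
  let ?F = "\<lambda>j l. closure (?W (inverse (real (Suc j))) l)"
  have "\<exists>C. (\<forall>j R. \<exists>l. \<forall>c\<in>C. norm c < R \<longrightarrow> c \<in> ?F j l) \<and> outer_measure_of lebesgue (A - C) < ennreal \<epsilon>"
  proof (rule egorov_closed_sets[OF closed_closure _ _ assms(5)])
    show "?F j l \<subseteq> ?F j m" if "l \<le> m" for j l m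
      using jets_close_mono[OF _ that order_refl] by (intro closure_mono) blast
    show "A \<subseteq> (\<Union>l. ?F j l)" for j
    proof
      fix a assume "a \<in> A"
      then obtain l where "jets_close u P k (inverse (real (Suc j))) l a" using close[of a "inverse (real (Suc j))"] by auto
      then have "a \<in> ?W (inverse (real (Suc j))) l" using \<open>a \<in> A\<close> by simp
      from subsetD[OF closure_subset this] show "a \<in> (\<Union>l. ?F j l)" by (rule UN_I[OF UNIV_I])
    qed
  qed
  then obtain G where G: "\<And>j R. \<exists>l. \<forall>c\<in>G. norm c < R \<longrightarrow> c \<in> ?F j l" "outer_measure_of lebesgue (A - G) < ennreal \<epsilon>"
    by blast
  have G': "\<exists>l. \<forall>c\<in>G. norm c < R \<longrightarrow> c \<in> closure {a \<in> A. jets_close u P k e l a}" if "0 < e" for R e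
  proof -
    obtain j where j: "inverse (real (Suc j)) < e" using reals_Archimedean[OF \<open>0 < e\<close>] by blast
    have "?F j l \<subseteq> closure (?W e l)" for l
      by (intro closure_mono Collect_mono) (use jets_close_mono[OF _ order_refl less_imp_le[OF j]] in blast)
    then show ?thesis using G(1)[of R j] by blast
  qed
  have "\<exists>g. of_class k g \<and> (\<forall>c\<in>G. \<forall>vs. length vs \<le> k \<longrightarrow> (\<lambda>j. iter_deriv (u j) vs c) \<longlonglongrightarrow> iter_deriv g vs c)"
    by (rule glue_approximations[OF u]) (rule jets_close_imp_close_scales[OF G'])
  then obtain g where g: "of_class k g"
    "\<And>c vs. c \<in> G \<Longrightarrow> length vs \<le> k \<Longrightarrow> (\<lambda>j. iter_deriv (u j) vs c) \<longlonglongrightarrow> iter_deriv g vs c"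
    by blast
  have "pt_deriv k T m a = nth_deriv m g a" if a: "a \<in> A" "a \<in> G" and m: "m \<le> k" for a m
  proof -
    have the: "(THE Q. pt_approximation T k a Q) = P a"
      using pt[OF a(1)] pt_approximation_unique[OF T] by blast
    have "iter_deriv (P a) vs a = iter_deriv g vs a" if "length vs = m" for vs
    proof (rule blinfun_eqI)
      fix y
      have "length vs \<le> k" using that m by simp
      then have "(\<lambda>j. blinfun_apply (iter_deriv (u j) vs a) y) \<longlonglongrightarrow> blinfun_apply (iter_deriv g vs a) y"
        by (intro tendsto_intros g(2) a)
      moreover have "(\<lambda>j. blinfun_apply (iter_deriv (u j) vs a) y) \<longlonglongrightarrow> iter_deriv (P a) vs a y"
        unfolding u_def using \<open>length vs \<le> k\<close> by (intro pt_approximation_jet_limit[OF T pt[OF a(1)] \<phi> repr])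
      ultimately show "iter_deriv (P a) vs a y = iter_deriv g vs a y" by (rule LIMSEQ_unique[rotated])
    qed
    then show ?thesis unfolding pt_deriv_def the nth_deriv_def by (auto simp: restrict_def)
  qed
  then have "A - {a. \<forall>m\<le>k. pt_deriv k T m a = nth_deriv m g a} \<subseteq> A - G" by blast
  then have "outer_measure_of lebesgue (A - {a. \<forall>m\<le>k. pt_deriv k T m a = nth_deriv m g a}) < ennreal \<epsilon>"
    using outer_measure_of_mono G(2) by (metis (no_types, lifting) le_less_trans)
  then show ?thesis using g(1) by blast
qed

end
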